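(* Let $a<b$ be coprime positive integers, let $1\le k\le a$, and let $X$ be the set of $\pi\in\mathsf{NC}(a,b)$ having exactly $k$ blocks. Let $C=\mathbb{Z}_{b-1}$ act on $X$ by rotation. Then $(X,C,X(q))$ exhibits the cyclic sieving phenomenon, where $$X(q)=\mathsf{Nar}_q(a,b,k)=\frac{1}{[a]_q}\begin{bmatrix}a\\k\end{bmatrix}_q\begin{bmatrix}b-1\\k-1\end{bmatrix}_q.$$
   Context: Let $a<b$ be coprime positive integers and $[b-1]=\{1,\dots,b-1\}$. An $a,b$-Dyck path is a lattice path from $(0,0)$ to $(b,a)$ using unit north and east steps that stays weakly above the line $y=\frac{a}{b}x$. A valley of such a path $D$ is a lattice point of $D$ immediately preceded by an east step and immediately followed by a north step. From each valley $P$ fire the laser $\ell(P)$: the segment of slope $\frac ab$ from $P$ going northeast until it first meets $D$ again. Label the east endpoints of the first $b-1$ east steps of $D$ from left to right by $1,\dots,b-1$, each label regarded as sitting slightly below its lattice point. The set partition $\pi(D)$ of $[b-1]$ declares $i\sim j$ iff labels $i,j$ are not separated by any valley laser. $\mathsf{NC}(a,b)=\{\pi(D): D\text{ an }a,b\text{-Dyck path}\}$. Rotation: a generator of $\mathbb Z_{b-1}$ acts by $\mathtt{rot}$, the permutation $i\mapsto i+1$ ($i<b-1$), $b-1\mapsto1$, applied blockwise. Notation: $[n]_q=1+q+\cdots+q^{n-1}$, $[n]_q!=[1]_q\cdots[n]_q$, $\begin{bmatrix}n\\k\end{bmatrix}_q=\frac{[n]_q!}{[k]_q![n-k]_q!}$.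 Cyclic sieving: for a finite set $X$ acted on by a cyclic group $C=\langle c\rangle$ of order $n$ and a polynomial $X(q)$ with nonnegative integer coefficients, $(X,C,X(q))$ exhibits the cyclic sieving phenomenon if $X(\zeta^d)=|\{x\in X: c^d.x=x\}|$ for all $d\ge0$, where $\zeta$ is a primitive $n$-th root of unity. *)

theory Defs
  imports
    "HOL-Algebra.Group_Action"
    "HOL-Algebra.Elementary_Groups"
    "HOL-Analysis.Analysis"
    "HOL-Computational_Algebra.Polynomial_Factorial"
begin

section \<open>Rational Dyck paths\<close>

datatype step = North | East

definition vertex :: "step list \<Rightarrow> nat \<Rightarrow> real \<times> real" where
  "vertex D n = (real (count_list (take n D) East), real (count_list (take n D) North))"

definition path_points :: "step list \<Rightarrow> (real \<times> real) set" where
  "path_points D = (\<Union>n<length D. closed_segment (vertex D n) (vertex D (Suc n)))"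

definition dyck_paths :: "nat \<Rightarrow> nat \<Rightarrow> step list set" where
  "dyck_paths a b = {D. vertex D (length D) = (real b, real a) \<and>
                        (\<forall>(x, y) \<in> path_points D. y \<ge> real a / real b * x)}"

definition valleys :: "step list \<Rightarrow> (real \<times> real) set" where
  "valleys D = {vertex D (Suc n) |n. Suc n < length D \<and> D ! n = East \<and> D ! Suc n = North}"

text \<open>The half-line from \<open>P\<close> in direction \<open>(b, a)\<close>, cut off at the first later point of
  \<open>D\<close>; that point is included, since only the parameters strictly before \<open>t\<close> have to avoid \<open>D\<close>.\<close>

definition laser :: "nat \<Rightarrow> nat \<Rightarrow> step list \<Rightarrow> real \<times> real \<Rightarrow> (real \<times> real) set" where
  "laser a b D P = {P + t *\<^sub>R (real b, real a) |t.
     0 \<le> t \<and> (\<forall>s. 0 < s \<and> s < t \<longrightarrow> P + s *\<^sub>R (real b, real a) \<notin> path_points D)}"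

section \<open>Rational noncrossing partitions\<close>

definition east_steps :: "step list \<Rightarrow> nat list" where
  "east_steps D = filter (\<lambda>n. D ! n = East) [0..<length D]"

text \<open>Label \<open>i\<close>, lowered by \<open>\<epsilon>\<close> from the east endpoint of the \<open>i\<close>-th east step
  (counted from 1).\<close>

definition label :: "step list \<Rightarrow> real \<Rightarrow> nat \<Rightarrow> real \<times> real" where
  "label D \<epsilon> i = vertex D (Suc (east_steps D ! (i - 1))) - (0, \<epsilon>)"

text \<open>The path alone is an arc and does not disconnect the plane; a laser \<open>L\<close> together with the
  stretch of the path between its two endpoints encloses a bounded region.  Hence two labels are
  separated by \<open>L\<close> iff they lie in different components of the complement of path and laser.
  \<open>Slightly below\<close> means for all sufficiently small \<open>\<epsilon> > 0\<close>.\<close>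

definition separated :: "step list \<Rightarrow> (real \<times> real) set \<Rightarrow> nat \<Rightarrow> nat \<Rightarrow> bool" where
  "separated D L i j \<longleftrightarrow>
     (\<forall>\<^sub>F \<epsilon> in at_right 0. \<not> connected_component (- (path_points D \<union> L)) (label D \<epsilon> i) (label D \<epsilon> j))"

definition laser_partition :: "nat \<Rightarrow> nat \<Rightarrow> step list \<Rightarrow> nat set set" where
  "laser_partition a b D =
     {1..b - 1} // {(i, j). i \<in> {1..b - 1} \<and> j \<in> {1..b - 1} \<and>
                            (\<forall>P \<in> valleys D. \<not> separated D (laser a b D P) i j)}"

definition NC :: "nat \<Rightarrow> nat \<Rightarrow> nat set set set" where
  "NC a b = laser_partition a b ` dyck_paths a b"

definition NC_blocks :: "nat \<Rightarrow> nat \<Rightarrow> nat \<Rightarrow> nat set set set" where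
  "NC_blocks a b k = {\<pi> \<in> NC a b. card \<pi> = k}"

section \<open>Rotation\<close>

definition rot :: "nat \<Rightarrow> nat \<Rightarrow> nat" where
  "rot n i = (if i < n then i + 1 else 1)"

definition rot_partition :: "nat \<Rightarrow> nat set set \<Rightarrow> nat set set" where
  "rot_partition n \<pi> = (\<lambda>B. rot n ` B) ` \<pi>"

text \<open>Elements of \<open>integer_mod_group n\<close> are the representatives \<open>0, \<dots>, n - 1\<close>.  The
  restriction to \<open>X\<close> is needed because permutations in \<open>BijGroup X\<close> are extensional.\<close>

definition rotation_action ::
    "nat \<Rightarrow> nat set set set \<Rightarrow> int \<Rightarrow> nat set set \<Rightarrow> nat set set" where
  "rotation_action n X d = restrict (rot_partition n ^^ nat d) X"

section \<open>Cyclic sieving\<close>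

definition primitive_unity_root :: "nat \<Rightarrow> complex \<Rightarrow> bool" where
  "primitive_unity_root n \<zeta> \<longleftrightarrow> \<zeta> ^ n = 1 \<and> (\<forall>m. 0 < m \<and> m < n \<longrightarrow> \<zeta> ^ m \<noteq> 1)"

definition cyclic_sieving ::
    "('g, 'm) monoid_scheme \<Rightarrow> 'g \<Rightarrow> ('g \<Rightarrow> 'x \<Rightarrow> 'x) \<Rightarrow> 'x set \<Rightarrow> int poly \<Rightarrow> bool" where
  "cyclic_sieving G c \<phi> X p \<longleftrightarrow>
     finite X \<and> finite (carrier G) \<and> group_action G X \<phi> \<and>
     c \<in> carrier G \<and> generate G {c} = carrier G \<and>
     (\<forall>i. coeff p i \<ge> 0) \<and>
     (\<forall>\<zeta>. primitive_unity_root (Coset.order G) \<zeta> \<longrightarrow>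
        (\<forall>d::nat. poly (map_poly of_int p) (\<zeta> ^ d) =
                  of_nat (card {x \<in> X. \<phi> (c [^]\<^bsub>G\<^esub> d) x = x})))"

section \<open>Rational q-Narayana numbers\<close>

text \<open>All quotients are formed in the fraction field of the integer polynomials in \<open>q\<close>.\<close>

definition q_int :: "nat \<Rightarrow> int poly fract" where
  "q_int n = (\<Sum>i<n. to_fract [:0, 1:] ^ i)"

definition q_fact :: "nat \<Rightarrow> int poly fract" where
  "q_fact n = (\<Prod>i=1..n. q_int i)"

definition q_binomial :: "nat \<Rightarrow> nat \<Rightarrow> int poly fract" where
  "q_binomial n k = q_fact n / (q_fact k * q_fact (n - k))"

definition q_narayana :: "nat \<Rightarrow> nat \<Rightarrow> nat \<Rightarrow> int poly fract" where
  "q_narayana a b k = 1 / q_int a * q_binomial a k * q_binomial (b - 1) (k - 1)"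

end

theory Submission
  imports Defs
begin

text \<open>
  A Dyck path is recorded by the numbers of north steps on the vertical lines \<open>x = 0, \<dots>, b - 2\<close>,
  repeated periodically with period \<open>N = b - 1\<close>. For such a word \<open>u\<close> let \<open>ht u\<close> be the walk with
  steps \<open>b u\<^sub>j - a\<close>. The laser from a valley covers the labels up to the next time the walk falls to
  the height of the valley, so two labels are in the same block iff the last earlier times at which
  the walk was lower agree. In this form the partition makes sense for every periodic word of sum
  at most \<open>a\<close>, and rotating the partition is shifting the word; if the sum is less than \<open>a\<close>, the
  record lows of the walk form one further block, whose rank is the missing mass. A block may carry
  its rank in front of any of its elements, and a word is determined by its partition once the place
  where the Dyck path starts is fixed; hence the set of these partitions is closed under rotation.

  For \<open>N = e g\<close> with \<open>e \<ge> 2\<close> the partitions fixed by the rotation by \<open>g\<close> correspond to the words of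
  period \<open>g\<close>: of full sum if no block is fixed, and of smaller sum if there is a fixed (central)
  block. These are counted by products of binomial coefficients, and so are all partitions, by the
  cycle lemma. The same numbers come from \<open>[b] p = [b, k] [a - 1, k - 1]\<close> and the q-Lucas theorem.

  Integrality of \<open>p\<close> follows from a Bezout identity for \<open>[a]\<close> and \<open>[b]\<close>. Nonnegativity follows because a
  product of Gaussian polynomials is unimodal, which is seen from the action of \<open>sl\<^sub>2\<close> on subsets.
\<close>

section \<open>Periodic words and their walks\<close>

text \<open>The obstacle is that a partition fixed by a rotation need not come from a word with the
  matching period: the word of its Dyck path starts at 0, a place that the rotation moves, and a
  block may carry its rank in front of any of its elements. A word is unique only relative to a
  place below everything to its right (\<open>root\<close>), so the proof has to find such a place
  that the shift by \<open>g\<close> preserves. Two arithmetic facts drive the combinatorics. Modulo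
  \<open>b\<close> the height at \<open>j\<close> is \<open>- a * j\<close> with \<open>a\<close>
  prime to \<open>b\<close>, so the \<open>b = N + 1\<close> points \<open>c, ..., c + N\<close> of
  a window have distinct heights and every minimum over a window is strict. And
  \<open>b * a - a * N = a\<close>, so a full walk gains only \<open>a\<close> per period, less than
  \<open>b\<close>. The identity with \<open>[b]\<close> replaces the definition with
  \<open>[a]\<close> because \<open>b\<close> is 1 modulo every divisor of \<open>N\<close>: at each
  nontrivial \<open>N\<close>-th root of unity \<open>[b]\<close> takes the value 1, whereas
  \<open>[a]\<close> may vanish.\<close>

lemma int_step_const:
  fixes f :: "int \<Rightarrow> 'a"
  assumes "\<And>j. f (j + 1) = f j"
  shows "f i = f 0"
proof (induction i rule: int_induct[where k = 0])
  case (step1 i) then show ?case using assms[of i] by simp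
next
  case (step2 i) then show ?case using assms[of "i - 1"] by simp
qed simp

definition periodic :: "int \<Rightarrow> (int \<Rightarrow> nat) \<Rightarrow> bool" where
  "periodic n u \<longleftrightarrow> (\<forall>j. u (j + n) = u j)"

definition psum :: "(int \<Rightarrow> nat) \<Rightarrow> int \<Rightarrow> nat" where
  "psum u n = (\<Sum>i\<in>{0..<n}. u i)"

lemma periodic_mult:
  assumes "periodic n u" shows "u (j + k * n) = u j"
proof -
  have "u (j + i * n) = u (j + 0 * n)" for i
    by (rule int_step_const[of "\<lambda>i. u (j + i * n)"])
       (use assms in \<open>simp add: periodic_def algebra_simps\<close>, metis add.assoc add.commute)
  then show ?thesis by simp
qed

lemma periodic_mod: "periodic n u \<Longrightarrow> u (j mod n) = u j"
  using periodic_mult[of n u "j mod n" "j div n"] by (simp add: algebra_simps)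

locale slope =
  fixes a b N :: int
  assumes a_pos: "0 < a" and a_less: "a < b" and coprime_ab: "coprime a b" and b_eq: "b = N + 1"
begin

lemma N_pos: "0 < N" using a_pos a_less b_eq by simp

definition ht :: "(int \<Rightarrow> nat) \<Rightarrow> int \<Rightarrow> int" where
  "ht u j = (if 0 \<le> j then (\<Sum>i\<in>{0..<j}. b * int (u i) - a)
             else - (\<Sum>i\<in>{j..<0}. b * int (u i) - a))"

lemma ht_0 [simp]: "ht u 0 = 0" by (simp add: ht_def)

lemma ht_step: "ht u (j + 1) = ht u j + b * int (u j) - a"
proof (cases "0 \<le> j")
  case True
  then have "{0..<j+1} = insert j {0..<j}" by auto
  then show ?thesis using True by (simp add: ht_def)
next
  case False
  then have "{j..<0} = insert j {j+1..<0}" by auto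
  then show ?thesis using False by (auto simp add: ht_def)
qed

lemma ht_step_ge: "ht u j - a \<le> ht u (j + 1)"
  using ht_step[of u j] a_pos a_less by simp

text \<open>Increments determine a walk up to a constant. A formula for the walk of a shifted or
  altered word therefore only needs its increments checked.\<close>

lemma ht_unique:
  assumes "\<And>j. f (j + 1) = f j + b * int (u j) - a"
  shows "f j - f i = ht u j - ht u i"
proof -
  have "f k - ht u k = f 0 - ht u 0" for k
    by (rule int_step_const[of "\<lambda>k. f k - ht u k"]) (simp add: assms ht_step)
  from this[of i] this[of j] show ?thesis by simp
qed

lemma ht_nonneg_sum: "0 \<le> n \<Longrightarrow> ht u n = b * int (psum u n) - a * n"
  by (simp add: ht_def psum_def sum_subtractf sum_distrib_left)

lemma ht_periodic:
  assumes "periodic n u" "0 \<le> n"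
  shows "ht u (j + n) = ht u j + (b * int (psum u n) - a * n)"
proof -
  have "ht u (j + n) - ht u (0 + n) = ht u j - ht u 0"
    by (rule ht_unique[of "\<lambda>j. ht u (j + n)" u])
       (use assms ht_step[of u "_ + n"] in \<open>simp add: periodic_def algebra_simps\<close>)
  then show ?thesis using ht_nonneg_sum[OF assms(2)] by simp
qed

lemma ht_shift: "ht (\<lambda>j. u (j + c)) j = ht u (j + c) - ht u c"
proof -
  have "ht u (j + c) - ht u (0 + c) = ht (\<lambda>j. u (j + c)) j - ht (\<lambda>j. u (j + c)) 0"
  proof (rule ht_unique)
    show "ht u (j + 1 + c) = ht u (j + c) + b * int (u (j + c)) - a" for j
      using ht_step[of u "j + c"] by (simp add: algebra_simps)
  qed
  then show ?thesis by simp
qed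

lemma ht_cong_mod: "b dvd ht u j + a * j"
proof -
  have "(b dvd ht u j + a * j) = (b dvd ht u 0 + a * 0)"
  proof (rule int_step_const[of "\<lambda>j. b dvd ht u j + a * j"])
    fix j
    have "ht u (j + 1) + a * (j + 1) = (ht u j + a * j) + b * int (u j)"
      using ht_step[of u j] by (simp add: algebra_simps)
    then show "(b dvd ht u (j + 1) + a * (j + 1)) = (b dvd ht u j + a * j)"
      by (metis dvd_add_left_iff dvd_triv_left)
  qed
  then show ?thesis by simp
qed

text \<open>Equal heights make \<open>b\<close> divide \<open>a * (i - j)\<close>, hence
  \<open>i - j\<close>. The bound \<open>b\<close> is exactly large enough to compare both ends
  \<open>c\<close> and \<open>c + N\<close> of a window.\<close>

lemma ht_inj:
  assumes "ht u i = ht u j" "\<bar>i - j\<bar> < b" shows "i = j"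
proof -
  have "b dvd (ht u i + a * i) - (ht u j + a * j)"
    using ht_cong_mod by (metis dvd_diff)
  then have "b dvd a * (i - j)" using assms(1) by (simp add: algebra_simps)
  then have "b dvd i - j" using coprime_ab by (simp add: coprime_dvd_mult_right_iff coprime_commute)
  then show ?thesis using assms(2) by (metis dvd_imp_le_int abs_ge_self abs_of_pos a_pos a_less
     less_trans linorder_not_le right_minus_eq)
qed

section \<open>Previous lows and the block relation\<close>

definition prev_low :: "(int \<Rightarrow> nat) \<Rightarrow> int \<Rightarrow> int \<Rightarrow> bool" where
  "prev_low u p q \<longleftrightarrow> p < q \<and> ht u p < ht u q \<and> (\<forall>j. p < j \<and> j < q \<longrightarrow> ht u q \<le> ht u j)"

text \<open>On a Dyck word, \<open>prev_low u p q\<close> says that \<open>p\<close> is the start of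
  the innermost laser over the label \<open>q\<close>, with \<open>p = 0\<close> if there is none.
  Positions without a previous low, the record lows, all count as related.\<close>

definition same_low :: "(int \<Rightarrow> nat) \<Rightarrow> int \<Rightarrow> int \<Rightarrow> bool" where
  "same_low u i j \<longleftrightarrow> (\<forall>p. prev_low u p i \<longleftrightarrow> prev_low u p j)"

text \<open>Words live on all integers. A block whose arcs cross the boundary of
  \<open>{1..N}\<close> is seen as one block only after some of its elements are translated by
  periods.\<close>

definition rel :: "(int \<Rightarrow> nat) \<Rightarrow> int \<Rightarrow> int \<Rightarrow> bool" where
  "rel u i j \<longleftrightarrow> (\<exists>k. same_low u i (j + k * N))"

definition record_low :: "(int \<Rightarrow> nat) \<Rightarrow> int \<Rightarrow> bool" where
  "record_low u q \<longleftrightarrow> (\<forall>p<q. ht u q \<le> ht u p)"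

text \<open>A place where a Dyck path may start: no arc from a previous low to its position passes
  over \<open>c\<close>.\<close>

definition root :: "(int \<Rightarrow> nat) \<Rightarrow> int \<Rightarrow> bool" where
  "root u c \<longleftrightarrow> (\<forall>j>c. ht u c < ht u j)"

lemma prev_low_unique: "prev_low u p q \<Longrightarrow> prev_low u p' q \<Longrightarrow> p = p'"
  unfolding prev_low_def by (metis linorder_neqE_linordered_idom linorder_not_le)

lemma prev_low_ex:
  assumes "p < q" "ht u p < ht u q"
  obtains p' where "p \<le> p'" "prev_low u p' q"
proof -
  let ?A = "{j \<in> {p..<q}. ht u j < ht u q}"
  have fin: "finite ?A" by (rule finite_subset[of _ "{p..<q}"]) auto
  have ne: "?A \<noteq> {}" using assms by auto
  have "Max ?A \<in> ?A" using Max_in[OF fin ne] .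
  moreover have "ht u q \<le> ht u j" if "Max ?A < j" "j < q" for j
  proof (rule ccontr)
    assume "\<not> ?thesis"
    then have "j \<in> ?A" using that \<open>Max ?A \<in> ?A\<close> by auto
    then show False using Max_ge[OF fin] that by fastforce
  qed
  ultimately show ?thesis by (intro that[of "Max ?A"]) (auto simp: prev_low_def)
qed

lemma prev_low_ge: "prev_low u p q \<Longrightarrow> j < q \<Longrightarrow> ht u j < ht u q \<Longrightarrow> j \<le> p"
  unfolding prev_low_def by (meson linorder_not_le)

lemma record_low_iff: "record_low u q \<longleftrightarrow> (\<forall>p. \<not> prev_low u p q)"
  unfolding record_low_def by (metis linorder_not_le prev_low_def prev_low_ex)

lemma same_low_if_prev_low: "prev_low u p i \<Longrightarrow> prev_low u p j \<Longrightarrow> same_low u i j"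
  unfolding same_low_def using prev_low_unique by metis

lemma same_low_record: "record_low u i \<Longrightarrow> record_low u j \<Longrightarrow> same_low u i j"
  unfolding same_low_def record_low_iff by simp

text \<open>An arc starting at \<open>p\<close> forces an up step there, so the element directly
  behind \<open>p\<close> has the same previous low. This lets the positions with a positive letter
  name the blocks.\<close>

lemma prev_low_succ:
  assumes "prev_low u p q" shows "prev_low u p (p + 1)"
proof -
  have "ht u p < ht u (p + 1)"
  proof (cases "q = p + 1")
    case False
    then have "ht u q \<le> ht u (p + 1)" "ht u p < ht u q"
      using assms unfolding prev_low_def by auto
    then show ?thesis by simp
  qed (use assms in \<open>auto simp: prev_low_def\<close>)
  then show ?thesis by (auto simp: prev_low_def)
qed

lemma pos_iff_ht_less: "0 < u p \<longleftrightarrow> ht u p < ht u (p + 1)"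
proof (cases "u p")
  case (Suc n)
  have "b * 1 \<le> b * int (u p)" using Suc a_pos a_less by (intro mult_left_mono) auto
  then show ?thesis using Suc ht_step[of u p] a_less by simp
qed (use ht_step[of u p] a_pos in simp)

lemma prev_low_succ_iff: "prev_low u p (p + 1) \<longleftrightarrow> 0 < u p"
  by (auto simp: prev_low_def pos_iff_ht_less)

lemma prev_low_shift: "prev_low (\<lambda>j. u (j + c)) p q \<longleftrightarrow> prev_low u (p + c) (q + c)"
proof -
  have "(\<forall>j. p + c < j \<and> j < q + c \<longrightarrow> P j) \<longleftrightarrow> (\<forall>j. p < j \<and> j < q \<longrightarrow> P (j + c))" for P
    by (metis add_less_cancel_right diff_add_cancel)
  then show ?thesis by (simp add: prev_low_def ht_shift)
qed

lemma prev_low_periodic: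
  assumes "periodic n u"
  shows "prev_low u (p + k * n) (q + k * n) \<longleftrightarrow> prev_low u p q"
proof -
  have "(\<lambda>j. u (j + k * n)) = u" using periodic_mult[OF assms] by auto
  then show ?thesis using prev_low_shift[of u "k * n" p q] by simp
qed

lemma same_low_shift: "same_low (\<lambda>j. u (j + c)) i j \<longleftrightarrow> same_low u (i + c) (j + c)"
  unfolding same_low_def prev_low_shift by (metis diff_add_cancel)

lemma rel_shift: "rel (\<lambda>j. u (j + c)) i j \<longleftrightarrow> rel u (i + c) (j + c)"
  unfolding rel_def same_low_shift by (simp add: algebra_simps)

lemma record_low_shift: "record_low (\<lambda>j. u (j + c)) q \<longleftrightarrow> record_low u (q + c)"
  unfolding record_low_iff prev_low_shift by (metis diff_add_cancel)

lemma root_shift: "root (\<lambda>j. u (j + c)) q \<longleftrightarrow> root u (q + c)"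
  unfolding root_def ht_shift
  by (simp, metis add_less_cancel_right diff_add_cancel)

lemma periodic_shift: "periodic n u \<Longrightarrow> periodic n (\<lambda>j. u (j + c))"
  unfolding periodic_def by (metis add.assoc add.commute)

lemma same_low_periodic:
  assumes "periodic n u"
  shows "same_low u (i + k * n) (j + k * n) \<longleftrightarrow> same_low u i j"
proof -
  have "(\<lambda>j. u (j + k * n)) = u" using periodic_mult[OF assms] by auto
  then show ?thesis using same_low_shift[of u "k * n" i j] by simp
qed

lemma record_low_periodic:
  assumes "periodic n u" shows "record_low u (q + k * n) \<longleftrightarrow> record_low u q"
proof -
  have "(\<lambda>j. u (j + k * n)) = u" using periodic_mult[OF assms] by auto
  then show ?thesis using record_low_shift[of u "k * n" q] by simp
qed

lemma root_periodic:
  assumes "periodic n u" shows "root u (q + k * n) \<longleftrightarrow> root u q"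
proof -
  have "(\<lambda>j. u (j + k * n)) = u" using periodic_mult[OF assms] by auto
  then show ?thesis using root_shift[of u "k * n" q] by simp
qed

lemma rel_refl: "rel u i i"
  unfolding rel_def same_low_def by (rule exI[of _ 0]) simp

lemma rel_sym:
  assumes "periodic N u" "rel u i j" shows "rel u j i"
proof -
  obtain k where "same_low u i (j + k * N)" using assms(2) unfolding rel_def by blast
  then have "same_low u (i + - k * N + k * N) (j + k * N)" by simp
  then have "same_low u (i + - k * N) j" unfolding same_low_periodic[OF assms(1)] .
  then show ?thesis unfolding rel_def same_low_def by metis
qed

lemma rel_trans:
  assumes "periodic N u" "rel u i j" "rel u j l" shows "rel u i l"
proof -
  obtain k k' where "same_low u i (j + k * N)" "same_low u j (l + k' * N)"
    using assms(2,3) unfolding rel_def by blast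
  then have "same_low u i (j + k * N)" "same_low u (j + k * N) (l + k' * N + k * N)"
    using same_low_periodic[OF assms(1)] by auto
  then have "same_low u i (l + (k' + k) * N)" by (simp add: same_low_def algebra_simps)
  then show ?thesis unfolding rel_def by blast
qed

lemma rel_add_mult2: "rel u i (j + k * N) \<longleftrightarrow> rel u i j"
  unfolding rel_def
  by (metis (no_types, lifting) add.assoc add.commute diff_add_cancel distrib_right)

lemma rel_add_mult1: "periodic N u \<Longrightarrow> rel u (i + k * N) j \<longleftrightarrow> rel u i j"
  using rel_add_mult2 rel_sym by metis

lemma rel_add_mult:
  "periodic N u \<Longrightarrow> rel u (i + k * N) (j + k' * N) \<longleftrightarrow> rel u i j"
  by (simp add: rel_add_mult1 rel_add_mult2)

lemma rel_record_low:
  assumes "periodic N u" "rel u i j" "record_low u i" shows "record_low u j"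
proof -
  obtain k where "same_low u i (j + k * N)" using assms(2) unfolding rel_def by blast
  then have "record_low u (j + k * N)" using assms(3) by (simp add: record_low_iff same_low_def)
  then show ?thesis using record_low_periodic[OF assms(1)] by simp
qed

lemma rel_if_prev_low: "prev_low u p i \<Longrightarrow> prev_low u p j \<Longrightarrow> rel u i j"
  unfolding rel_def by (rule exI[of _ 0]) (simp add: same_low_if_prev_low)

text \<open>The previous lows of \<open>i\<close> and of \<open>j\<close> lie in
  \<open>{c..<c + N}\<close> and differ by \<open>k * N\<close>, which leaves only
  \<open>k = 0\<close>. The hypothesis \<open>low\<close> is met in two situations: \<open>c\<close>
  is a root, or \<open>c + 1\<close> is a record low.\<close>

lemma rel_window:
  assumes "periodic N u"
    and low: "\<And>q p. c < q \<Longrightarrow> q \<le> c + N \<Longrightarrow> prev_low u p q \<Longrightarrow> c \<le> p"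
    and ij: "c < i" "i \<le> c + N" "c < j" "j \<le> c + N"
  shows "rel u i j \<longleftrightarrow> same_low u i j"
proof
  assume "rel u i j"
  then obtain k where k: "same_low u i (j + k * N)" unfolding rel_def by blast
  show "same_low u i j"
  proof (cases "record_low u i")
    case True
    then show ?thesis
      using rel_record_low[OF assms(1) \<open>rel u i j\<close>] same_low_record by blast
  next
    case False
    then obtain p where p: "prev_low u p i" by (auto simp: record_low_iff)
    then have "prev_low u p (j + k * N)" using k by (simp add: same_low_def)
    then have p': "prev_low u (p - k * N) j"
      using prev_low_periodic[OF assms(1), of "p - k * N" k j] by simp
    have "c \<le> p" "p < c + N" "c \<le> p - k * N" "p - k * N < c + N"
      using low p p' ij by (auto simp: prev_low_def dest: low)
    then have "k * N < 1 * N" "(- 1) * N < k * N" by linarith+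
    then have "k = 0" using N_pos by (simp only: mult_less_cancel_right_pos)
    then show ?thesis using k by simp
  qed
next
  assume "same_low u i j"
  then show "rel u i j" unfolding rel_def by (intro exI[of _ 0]) simp
qed

lemma root_prev_low_ge: "root u c \<Longrightarrow> c < q \<Longrightarrow> prev_low u p q \<Longrightarrow> c \<le> p"
  using prev_low_ge root_def by blast

text \<open>Nothing up to \<open>c\<close> is lower than \<open>c + 1\<close>, so an arc from there
  over \<open>c + 1\<close> would end no higher than it starts.\<close>

lemma record_prev_low_gt:
  assumes "record_low u (c + 1)" "c < q" "prev_low u p q" shows "c < p"
proof (rule ccontr)
  assume "\<not> c < p"
  then have "q \<noteq> c + 1" using assms by (auto simp: record_low_iff)
  then have "ht u q \<le> ht u (c + 1)" "ht u (c + 1) \<le> ht u p"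
    using assms \<open>\<not> c < p\<close> by (auto simp: prev_low_def record_low_def)
  then show False using assms(3) by (simp add: prev_low_def)
qed

section \<open>Full and deficient words\<close>

lemma ht_periodic_mult:
  assumes "periodic n u" "0 \<le> n"
  shows "ht u (j + k * n) = ht u j + k * (b * int (psum u n) - a * n)"
proof -
  let ?d = "b * int (psum u n) - a * n"
  have "ht u (j + k * n) - k * ?d = ht u (j + 0 * n) - 0 * ?d"
  proof (rule int_step_const[of "\<lambda>k. ht u (j + k * n) - k * ?d"])
    fix k
    have "j + (k + 1) * n = (j + k * n) + n" by (simp add: algebra_simps)
    then have "ht u (j + (k + 1) * n) = ht u (j + k * n) + ?d"
      by (simp only: ht_periodic[OF assms])
    moreover have "(k + 1) * ?d = k * ?d + ?d" by (simp add: algebra_simps)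
    ultimately show "ht u (j + (k + 1) * n) - (k + 1) * ?d = ht u (j + k * n) - k * ?d" by linarith
  qed
  then show ?thesis by simp
qed

text \<open>Per period the walk of a full word rises by \<open>a\<close>, while that of a deficient word falls.\<close>

definition full :: "(int \<Rightarrow> nat) \<Rightarrow> bool" where
  "full u \<longleftrightarrow> periodic N u \<and> int (psum u N) = a"

definition deficient :: "(int \<Rightarrow> nat) \<Rightarrow> bool" where
  "deficient u \<longleftrightarrow> periodic N u \<and> int (psum u N) < a"

lemma full_ht_mult:
  assumes "full u" shows "ht u (j + k * N) = ht u j + k * a"
proof -
  have "b * a - a * N = a" by (simp add: b_eq algebra_simps)
  then show ?thesis using ht_periodic_mult[of N u j k] assms N_pos by (simp add: full_def)
qed

lemma full_ht: "full u \<Longrightarrow> ht u (j + N) = ht u j + a"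
  using full_ht_mult[of u j 1] by simp

lemma full_prev_low_ex:
  assumes "full u" obtains p where "prev_low u p q"
proof -
  have "ht u (q - N) < ht u q" using full_ht[OF assms, of "q - N"] a_pos by simp
  then show ?thesis using prev_low_ex[of "q - N" q u] that N_pos by auto
qed

lemma window_representative:
  obtains k where "c < j - k * N" "j - k * N \<le> c + N"
proof
  let ?k = "(j - c - 1) div N"
  have "(j - c - 1) = ?k * N + (j - c - 1) mod N" by simp
  moreover have "0 \<le> (j - c - 1) mod N" "(j - c - 1) mod N < N" using N_pos by auto
  ultimately show "c < j - ?k * N" "j - ?k * N \<le> c + N" by linarith+
qed

lemma root_if_window:
  assumes "full u" "\<And>j. c < j \<Longrightarrow> j \<le> c + N \<Longrightarrow> ht u c < ht u j"
  shows "root u c"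
  unfolding root_def
proof (intro allI impI)
  fix j assume "c < j"
  obtain k where k: "c < j - k * N" "j - k * N \<le> c + N" using window_representative .
  have "0 \<le> k"
  proof (rule ccontr)
    assume "\<not> 0 \<le> k"
    then have "k * N \<le> (- 1) * N" using N_pos by (intro mult_right_mono) auto
    then show False using k \<open>c < j\<close> by linarith
  qed
  have "ht u j = ht u (j - k * N) + k * a" using full_ht_mult[OF assms(1), of "j - k * N" k] by simp
  moreover have "0 \<le> k * a" using \<open>0 \<le> k\<close> a_pos by simp
  ultimately show "ht u c < ht u j" using assms(2)[OF k] by simp
qed

lemma full_root_ex:
  assumes "full u" obtains c where "root u c" "0 \<le> c" "c < N"
proof -
  have "finite {0..<N}" "{0..<N} \<noteq> {}" using N_pos by auto
  from ex_min_if_finite[of "ht u ` {0..<N}"] this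
  obtain c where c: "c \<in> {0..<N}" and m: "\<And>j. j \<in> {0..<N} \<Longrightarrow> \<not> ht u j < ht u c" by auto
  have "root u c"
  proof (rule root_if_window[OF assms])
    fix j assume j: "c < j" "j \<le> c + N"
    show "ht u c < ht u j"
    proof (cases "j < N")
      case True
      then have "ht u c \<le> ht u j" using m[of j] c j by auto
      moreover have "ht u c \<noteq> ht u j" using ht_inj[of u c j] j c True b_eq by auto
      ultimately show ?thesis by simp
    next
      case False
      then have "ht u c \<le> ht u (j - N)" using m[of "j - N"] c j by auto
      then show ?thesis using full_ht[OF assms, of "j - N"] a_pos by simp
    qed
  qed
  then show ?thesis using that c by auto
qed

section \<open>Changing the letters of one residue class: filling and draining\<close>

definition upd :: "(int \<Rightarrow> nat) \<Rightarrow> int \<Rightarrow> nat \<Rightarrow> int \<Rightarrow> nat" where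
  "upd u c x = (\<lambda>j. if N dvd j - c then x else u j)"

lemma periodic_upd: "periodic N u \<Longrightarrow> periodic N (upd u c x)"
proof -
  have "N dvd j + N - c \<longleftrightarrow> N dvd j - c" for j
    by (metis add_diff_eq add.commute dvd_add_triv_right_iff diff_add_eq)
  then show "periodic N u \<Longrightarrow> periodic N (upd u c x)" unfolding periodic_def upd_def by simp
qed

lemma div_pred: "(m - 1) div N = m div N - (if N dvd m then 1 else 0)"
proof (cases "N dvd m")
  case True
  then obtain t where t: "m = N * t" by (auto simp: dvd_def)
  have "(m - 1) div N = t - 1"
    by (rule int_div_pos_eq[of _ _ _ "N - 1"]) (use t N_pos in \<open>auto simp: algebra_simps\<close>)
  then show ?thesis using True t N_pos by simp
next
  case False
  then have "m mod N \<noteq> 0" by (simp add: dvd_eq_mod_eq_0)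
  moreover have "0 \<le> m mod N" "m mod N < N" using N_pos by auto
  ultimately have "0 \<le> m mod N - 1" "m mod N - 1 < N" by linarith+
  then have "(m - 1) div N = m div N"
    by (intro int_div_pos_eq[of _ _ _ "m mod N - 1"]) auto
  then show ?thesis using False by simp
qed

text \<open>As \<open>j\<close> grows, \<open>- ((c - j) div N)\<close> increases by 1 exactly when
  \<open>j\<close> passes a position of the class of \<open>c\<close>; up to a constant it counts
  the altered letters.\<close>

lemma ht_upd:
  assumes "periodic N u"
  shows "ht (upd u c x) j - ht (upd u c x) i =
    (ht u j - b * (int x - int (u c)) * ((c - j) div N)) -
    (ht u i - b * (int x - int (u c)) * ((c - i) div N))"
proof (rule sym, rule ht_unique[of "\<lambda>j. ht u j - b * (int x - int (u c)) * ((c - j) div N)"])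
  fix j
  have d: "(c - (j + 1)) div N = (c - j) div N - (if N dvd j - c then 1 else 0)"
    using div_pred[of "c - j"] by (simp add: dvd_diff_commute algebra_simps)
  have "u j = u c" if dv: "N dvd j - c"
  proof -
    obtain t where "j - c = N * t" using dv by (auto simp: dvd_def)
    then show ?thesis using periodic_mult[OF assms, of c t] by (simp add: algebra_simps)
  qed
  then show "ht u (j + 1) - b * (int x - int (u c)) * ((c - (j + 1)) div N) =
     ht u j - b * (int x - int (u c)) * ((c - j) div N) + b * int (upd u c x j) - a"
    unfolding d upd_def using ht_step[of u j] by (auto simp: algebra_simps)
qed

lemma psum_upd:
  assumes "periodic N u"
  shows "int (psum (upd u c x) N) = int (psum u N) + (int x - int (u c))"
proof -
  have d: "(c - N) div N = c div N - 1" using N_pos div_add_self2[of N "c - N"] by simp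
  have "b * int (psum (upd u c x) N) = b * (int (psum u N) + (int x - int (u c)))"
    using ht_upd[OF assms, of c x N 0] ht_nonneg_sum[of N u] ht_nonneg_sum[of N "upd u c x"] N_pos
    unfolding d by (simp add: algebra_simps)
  then show ?thesis using a_pos a_less by simp
qed

lemma ht_upd_window:
  assumes "periodic N u" "c < j" "j \<le> c + N"
  shows "ht (upd u c x) j - ht (upd u c x) c = ht u j - ht u c + b * (int x - int (u c))"
proof -
  have "(c - j) div N = -1"
    by (rule int_div_pos_eq[of _ _ _ "c - j + N"]) (use assms in auto)
  then show ?thesis using ht_upd[OF assms(1), of c x j c] by (simp add: algebra_simps)
qed

lemma record_low_zero: "record_low u (c + 1) \<Longrightarrow> u c = 0"
  using prev_low_succ_iff[of u c] by (auto simp: record_low_iff)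

text \<open>The record lows of a deficient word form one block; the missing mass is the rank of this block
  and may be put in front of any of its elements.\<close>

lemma deficient_fill:
  assumes "deficient u" and rec: "record_low u (c + 1)"
  defines "u' \<equiv> upd u c (nat a - psum u N)"
  shows "full u'" "root u' c" "rel u' = rel u"
proof -
  have per: "periodic N u" and less: "int (psum u N) < a" using assms(1) by (auto simp: deficient_def)
  define r where "r = nat a - psum u N"
  have r: "int r = a - int (psum u N)" "0 < r" using less a_pos by (auto simp: r_def)
  have uc: "u c = 0" using record_low_zero[OF rec] .
  have u': "u' = upd u c r" by (simp add: u'_def r_def)
  have per': "periodic N u'" unfolding u' by (rule periodic_upd[OF per])
  show full: "full u'" using per' psum_upd[OF per, of c r] r uc by (simp add: full_def u')
  \<comment> \<open>Seen from the window, filling lowers \<open>c\<close> to the height of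
    \<open>c + 1 + N\<close>, the next copy of the record low and one position past the window.
    Hence \<open>c\<close> lies below the whole window.\<close>
  have drop: "ht u (c + 1 + N) = ht u c - b * int r"
  proof -
    have "ht u (c + 1 + N) = ht u (c + 1) + b * (a - int r) - a * N"
      using ht_periodic[OF per, of "c + 1"] N_pos r by simp
    then show ?thesis using ht_step[of u c] uc b_eq by (simp add: algebra_simps)
  qed
  have rec': "record_low u (c + 1 + N)" using record_low_periodic[OF per, of "c + 1" 1] rec by simp
  have win: "ht u' j = ht u j + (ht u' c - ht u c + b * int r)" if "c < j" "j \<le> c + N" for j
    using ht_upd_window[OF per that, of r] uc by (simp add: u')
  show root: "root u' c"
  proof (rule root_if_window[OF full])
    fix j assume j: "c < j" "j \<le> c + N"
    have "ht u (c + 1 + N) \<le> ht u j" using rec' j by (simp add: record_low_def)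
    moreover have "ht u (c + 1 + N) \<noteq> ht u j" using ht_inj[of u "c + 1 + N" j] j b_eq by auto
    ultimately show "ht u' c < ht u' j" using win[OF j] drop by simp
  qed
  \<comment> \<open>Old arcs survive unchanged; the only new ones lead from \<open>c\<close> to the
    record lows, which had no arc before.\<close>
  have pl: "prev_low u' p q \<longleftrightarrow> (p = c \<and> record_low u q) \<or> prev_low u p q"
    if q: "c < q" "q \<le> c + N" for p q
  proof
    assume L: "prev_low u' p q"
    have "c \<le> p" using root_prev_low_ge[OF root q(1) L] .
    show "(p = c \<and> record_low u q) \<or> prev_low u p q"
    proof (cases "p = c")
      case True
      have "record_low u q" unfolding record_low_iff
      proof (intro allI notI)
        fix t assume t: "prev_low u t q"
        have "c < t" using record_prev_low_gt[OF rec q(1) t] .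
        then have "ht u' t < ht u' q" using t win[of t] win[of q] q by (auto simp: prev_low_def)
        then show False using L t \<open>c < t\<close> True by (auto simp: prev_low_def)
      qed
      then show ?thesis using True by simp
    next
      case False
      then have "prev_low u p q" using L \<open>c \<le> p\<close> q win by (auto simp: prev_low_def)
      then show ?thesis by simp
    qed
  next
    assume "(p = c \<and> record_low u q) \<or> prev_low u p q"
    then show "prev_low u' p q"
    proof
      assume A: "p = c \<and> record_low u q"
      then show ?thesis using q win root by (auto simp: prev_low_def record_low_def root_def)
    next
      assume A: "prev_low u p q"
      have "c < p" using record_prev_low_gt[OF rec q(1) A] .
      then show ?thesis using A q win by (auto simp: prev_low_def)
    qed
  qed
  have sl: "same_low u' i j \<longleftrightarrow> same_low u i j"
    if ij: "c < i" "i \<le> c + N" "c < j" "j \<le> c + N" for i j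
  proof -
    have cp: "\<not> prev_low u c q" if "c < q" for q using record_prev_low_gt[OF rec that, of c] by auto
    show ?thesis
    proof
      assume S: "same_low u' i j"
      show "same_low u i j" unfolding same_low_def
      proof
        fix p show "prev_low u p i = prev_low u p j"
          using S pl[OF ij(1,2), of p] pl[OF ij(3,4), of p] cp[OF ij(1)] cp[OF ij(3)]
          by (cases "p = c") (auto simp: same_low_def)
      qed
    next
      assume S: "same_low u i j"
      then have "record_low u i \<longleftrightarrow> record_low u j" by (simp add: record_low_iff same_low_def)
      then show "same_low u' i j"
        using S pl[OF ij(1,2)] pl[OF ij(3,4)] by (auto simp: same_low_def)
    qed
  qed
  show "rel u' = rel u"
  proof (intro ext)
    fix i j
    obtain k where k: "c < i - k * N" "i - k * N \<le> c + N" using window_representative .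
    obtain l where l: "c < j - l * N" "j - l * N \<le> c + N" using window_representative .
    have "rel u' (i - k * N) (j - l * N) = same_low u' (i - k * N) (j - l * N)"
      by (rule rel_window[OF per' _ k l]) (use root_prev_low_ge[OF root] in blast)
    also have "\<dots> = same_low u (i - k * N) (j - l * N)" by (rule sl[OF k l])
    also have "\<dots> = rel u (i - k * N) (j - l * N)"
      by (rule rel_window[OF per _ k l, symmetric])
         (use record_prev_low_gt[OF rec] in \<open>auto intro: less_imp_le\<close>)
    finally show "rel u' i j = rel u i j"
      using rel_add_mult[OF per', of "i - k * N" k "j - l * N" l]
        rel_add_mult[OF per, of "i - k * N" k "j - l * N" l] by simp
  qed
qed

text \<open>This inverts \<open>deficient_fill\<close>. Once the drained word is known to be
  deficient with a record low at \<open>c + 1\<close>, the equality of the relations follows by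
  refilling it.\<close>

lemma full_drain:
  assumes "full u" "root u c"
  defines "u' \<equiv> upd u c 0"
  shows "deficient u'" "record_low u' (c + 1)" "rel u' = rel u" "upd u' c (nat a - psum u' N) = u"
proof -
  have per: "periodic N u" using assms(1) by (simp add: full_def)
  have uc: "0 < u c" using assms(2) by (simp add: pos_iff_ht_less root_def)
  have ps: "int (psum u' N) = a - int (u c)"
    using psum_upd[OF per, of c 0] assms(1) by (simp add: u'_def full_def)
  have per': "periodic N u'" unfolding u'_def by (rule periodic_upd[OF per])
  show def: "deficient u'" using per' ps uc by (simp add: deficient_def)
  have "nat a - psum u' N = u c" using ps a_pos by linarith
  moreover have "upd u' c (u c) = u"
  proof
    fix j
    have "u j = u c" if dv: "N dvd j - c"
    proof -
      obtain t where "j - c = N * t" using dv by (auto simp: dvd_def)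
      then show ?thesis using periodic_mult[OF per, of c t] by (simp add: algebra_simps)
    qed
    then show "upd u' c (u c) j = u j" by (auto simp: upd_def u'_def)
  qed
  ultimately show eq: "upd u' c (nat a - psum u' N) = u" by simp
  have dr: "ht u' (j + k * N) = ht u' j + k * (a - b * int (u c))" for j k
    using ht_periodic_mult[OF per', of j k] ps N_pos b_eq by (simp add: algebra_simps)
  show rec: "record_low u' (c + 1)" unfolding record_low_def
  proof (intro allI impI)
    fix p assume "p < c + 1"
    have step: "ht u' (c + 1) = ht u' c - a"
      using ht_step[of u' c] by (simp add: u'_def upd_def)
    obtain k where k: "c < p - k * N" "p - k * N \<le> c + N" using window_representative .
    have "k < 0"
    proof (rule ccontr)
      assume "\<not> k < 0"
      then have "0 \<le> k * N" using N_pos by simp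
      then show False using k \<open>p < c + 1\<close> by linarith
    qed
    let ?q = "p - k * N"
    have "ht u c < ht u ?q" using assms(2) k by (simp add: root_def)
    then have "ht u' c - b * int (u c) < ht u' ?q"
      using ht_upd_window[OF per k, of 0] by (simp add: u'_def)
    moreover have "ht u' p = ht u' ?q + k * (a - b * int (u c))" using dr[of ?q k] by simp
    \<comment> \<open>The drained walk falls by \<open>b * int (u c) - a\<close> per period, and
      \<open>p\<close> lies at least one period to the left of \<open>?q\<close>.\<close>
    moreover have "b * int (u c) - a \<le> k * (a - b * int (u c))"
    proof -
      have "b * 1 \<le> b * int (u c)" using uc a_pos a_less by (intro mult_left_mono) auto
      then have "0 \<le> b * int (u c) - a" using a_less by simp
      then have "1 * (b * int (u c) - a) \<le> (- k) * (b * int (u c) - a)"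
        using \<open>k < 0\<close> by (intro mult_right_mono) auto
      then show ?thesis by (simp add: algebra_simps)
    qed
    ultimately show "ht u' (c + 1) \<le> ht u' p" using step by linarith
  qed
  show "rel u' = rel u" using deficient_fill(3)[OF def rec] eq by simp
qed

section \<open>Moving the root\<close>

lemma full_reroot_pred:
  assumes "full u" "root u c"
  obtains u' where "full u'" "root u' (c - 1)" "rel u' = rel u"
proof -
  have per: "periodic N u" using assms(1) by (simp add: full_def)
  \<comment> \<open>This \<open>p\<close> is again a root. Draining it turns the block of
    \<open>c + N\<close> into the record lows, and the rank is then put back in front of
    \<open>c + N\<close>, which is the residue class of \<open>c - 1\<close>.\<close>
  obtain p where p: "prev_low u p (c + N)" using full_prev_low_ex[OF assms(1)] .
  have rcN: "root u (c + N)" using root_periodic[OF per, of c 1] assms(2) by simp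
  have "root u p" unfolding root_def
  proof (intro allI impI)
    fix j assume "p < j"
    show "ht u p < ht u j"
      using p rcN \<open>p < j\<close> unfolding prev_low_def root_def
      by (metis linorder_less_linear order_less_le_trans order_less_trans)
  qed
  note d = full_drain[OF assms(1) this]
  have "rel u (p + 1) (c + N)" using rel_if_prev_low[OF prev_low_succ[OF p] p] .
  then have "rel (upd u p 0) (p + 1) (c + N)" using d(3) by simp
  then have rl: "record_low (upd u p 0) (c + N - 1 + 1)"
    using rel_record_low[OF _ _ d(2)] d(1) by (simp add: deficient_def)
  note f = deficient_fill[OF d(1) rl]
  have "root (upd (upd u p 0) (c + N - 1) (nat a - psum (upd u p 0) N)) (c - 1)"
    using root_periodic[of N _ "c - 1" 1] f(1,2) by (simp add: full_def algebra_simps)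
  then show ?thesis using that[OF f(1) _ ] f(3) d(3) by simp
qed

lemma full_reroot:
  assumes "full u"
  obtains u' where "full u'" "root u' c" "rel u' = rel u"
proof -
  obtain c0 where c0: "root u c0" using full_root_ex[OF assms] .
  \<comment> \<open>Single moves go to the left only, so the start is a translate of the known root
    far enough to the right of \<open>c\<close>.\<close>
  define m where "m = nat (\<bar>c\<bar> + \<bar>c0\<bar>)"
  have "c \<le> c0 + int m * N"
  proof -
    have "int m * 1 \<le> int m * N" using N_pos by (intro mult_left_mono) auto
    then show ?thesis by (simp add: m_def)
  qed
  define n where "n = nat (c0 + int m * N - c)"
  have r: "root u (c + int n)"
    using root_periodic[of N u c0 "int m"] c0 assms \<open>c \<le> c0 + int m * N\<close>
    by (simp add: n_def full_def)
  have "\<exists>u'. full u' \<and> root u' c \<and> rel u' = rel u" if "full u" "root u (c + int n)" for u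
    using that
  proof (induction n arbitrary: u)
    case (Suc n)
    obtain u' where "full u'" "root u' (c + int (Suc n) - 1)" "rel u' = rel u"
      using full_reroot_pred[OF Suc.prems] .
    then show ?case using Suc.IH[of u'] by simp
  qed auto
  then show ?thesis using that r assms by blast
qed

section \<open>Reconstruction of a word from its partition\<close>

lemma prev_low_le_if_rel_eq:
  assumes "full u" "root u c" "full u'" "root u' c" "rel u = rel u'"
    and q: "c < q" "q \<le> c + N" "prev_low u p q" "prev_low u' p' q"
  shows "p' \<le> p"
proof -
  have per: "periodic N u" "periodic N u'" using assms by (auto simp: full_def)
  have "c \<le> p" using root_prev_low_ge[OF assms(2) q(1,3)] .
  moreover have "p < q" using q(3) by (simp add: prev_low_def)
  ultimately have w: "c < p + 1" "p + 1 \<le> c + N" using q by auto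
  \<comment> \<open>\<open>p + 1\<close> is the leftmost possible partner of \<open>q\<close> in
    \<open>u\<close>; having the same previous low as \<open>q\<close> in \<open>u'\<close>, it
    bounds that previous low by \<open>p\<close>.\<close>
  have "rel u' (p + 1) q" using rel_if_prev_low[OF prev_low_succ[OF q(3)] q(3)] assms(5) by simp
  then have "same_low u' (p + 1) q"
    using rel_window[OF per(2) _ w q(1,2)] root_prev_low_ge[OF assms(4)] by blast
  then have "prev_low u' p' (p + 1)" using q(4) by (simp add: same_low_def)
  then show ?thesis by (simp add: prev_low_def)
qed

text \<open>Two words with the same relation are compared at the last position \<open>p\<close> of the window at which
  they differ.\<close>

lemma full_eq_aux:
  assumes "full u" "root u c" "full u'" "root u' c"
    and eq: "\<And>p q. c < q \<Longrightarrow> q \<le> c + N \<Longrightarrow> prev_low u p q \<longleftrightarrow> prev_low u' p q"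
    and p: "c \<le> p" "p < c + N" "u' p < u p"
    and above: "\<And>j. p < j \<Longrightarrow> j < c + N \<Longrightarrow> u j = u' j"
  shows False
proof -
  define d where "d = int (u p) - int (u' p)"
  have d: "b \<le> b * d"
  proof -
    have "b * 1 \<le> b * d" using p a_pos a_less by (intro mult_left_mono) (auto simp: d_def)
    then show ?thesis by simp
  qed
  \<comment> \<open>To the right of \<open>p\<close> the letters agree, so the larger letter at
    \<open>p\<close> lifts \<open>u\<close> over \<open>u'\<close>, relative to \<open>p\<close>, by
    the constant \<open>b * d\<close>.\<close>
  have hd: "ht u j - ht u p = ht u' j - ht u' p + b * d" if "p < j" "j \<le> c + N" for j
  proof -
    have "ht u (p + 1 + int n) - ht u p = ht u' (p + 1 + int n) - ht u' p + b * d"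
      if "p + 1 + int n \<le> c + N" for n
      using that
    proof (induction n)
      case 0
      then show ?case using ht_step[of u p] ht_step[of u' p] by (simp add: d_def algebra_simps)
    next
      case (Suc n)
      have "u (p + 1 + int n) = u' (p + 1 + int n)" using above[of "p + 1 + int n"] Suc.prems by simp
      then show ?case
        using Suc ht_step[of u "p + 1 + int n"] ht_step[of u' "p + 1 + int n"]
        by (simp add: algebra_simps)
    qed
    from this[of "nat (j - p - 1)"] that show ?thesis by simp
  qed
  \<comment> \<open>From \<open>q\<close>, previous lows are followed downwards. They are the same
    for both words, and in \<open>u\<close> the descent cannot jump over \<open>p\<close>, so it
    ends in \<open>p\<close>; along it the heights of \<open>u'\<close> decrease as well.\<close>
  have tr: "ht u' p < ht u' q"
    if "p < q" "q \<le> c + N" "\<And>j. p < j \<Longrightarrow> j \<le> q \<Longrightarrow> ht u p < ht u j" for q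
    using that
  proof (induction "nat (q - p)" arbitrary: q rule: less_induct)
    case less
    obtain t where t: "prev_low u t q" using full_prev_low_ex[OF assms(1)] .
    have "p \<le> t" using prev_low_ge[OF t] less.prems by auto
    have t': "prev_low u' t q" using eq[of q t] t less.prems p by simp
    have tq: "t < q" "ht u' t < ht u' q" using t' by (auto simp: prev_low_def)
    show ?case
    proof (cases "t = p")
      case False
      then have "ht u' p < ht u' t"
        using less.hyps[of t] less.prems \<open>p \<le> t\<close> tq by auto
      then show ?thesis using tq by simp
    qed (use tq in simp)
  qed
  show False
  proof (cases "\<forall>j. p < j \<and> j \<le> c + N \<longrightarrow> ht u p < ht u j")
    case True
    \<comment> \<open>If \<open>u\<close> never returns to the height of \<open>p\<close>, it ends
      more than \<open>b\<close> above \<open>p\<close>, although the rise from the root over a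
      whole period is only \<open>a\<close>.\<close>
    then have "ht u' p < ht u' (c + N)" using tr[of "c + N"] p by auto
    then have "ht u p + b < ht u (c + N)" using hd[of "c + N"] p d by simp
    moreover have "ht u (c + N) = ht u c + a" by (rule full_ht[OF assms(1)])
    moreover have "ht u c \<le> ht u p" using assms(2) p(1) unfolding root_def
      by (metis order_le_less order_less_imp_le)
    ultimately show False using a_less by simp
  next
    case False
    then obtain j0 where j0: "p < j0 \<and> j0 \<le> c + N \<and> ht u j0 \<le> ht u p" by force
    \<comment> \<open>At the first return of \<open>u\<close>, one position earlier
      \<open>u'\<close> is still above \<open>p\<close> and can fall by at most \<open>a\<close>.
      Then \<open>u\<close>, higher by at least \<open>b\<close>, has not returned after
      all.\<close>
    let ?P = "\<lambda>n. p + int n \<le> c + N \<and> 0 < n \<and> ht u (p + int n) \<le> ht u p"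
    define n where "n = (LEAST n. ?P n)"
    have "?P (nat (j0 - p))" using j0 by simp
    then have n: "?P n" unfolding n_def by (rule LeastI)
    have min: "\<not> ?P m" if "m < n" for m using that not_less_Least unfolding n_def by blast
    define j where "j = p + int n"
    have lt: "ht u p < ht u i" if "p < i" "i < j" for i
    proof -
      have "nat (i - p) < n" using that by (simp add: j_def)
      then show ?thesis using min[of "nat (i - p)"] that n by (auto simp: j_def)
    qed
    have "0 < u p" using p by simp
    then have "j \<noteq> p + 1" using n by (auto simp: j_def pos_iff_ht_less)
    then have "ht u' p < ht u' (j - 1)" using tr[of "j - 1"] lt n by (auto simp: j_def)
    then have "ht u' p - a < ht u' j" using ht_step_ge[of u' "j - 1"] by simp
    then have "ht u p < ht u j" using hd[of j] n d a_less by (simp add: j_def)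
    then show False using n by (simp add: j_def)
  qed
qed

lemma full_eq:
  assumes "full u" "root u c" "full u'" "root u' c" "rel u = rel u'"
  shows "u = u'"
proof (rule ccontr)
  assume "u \<noteq> u'"
  then obtain j where j: "u j \<noteq> u' j" by auto
  have per: "periodic N u" "periodic N u'" using assms by (auto simp: full_def)
  have eq: "prev_low u p q \<longleftrightarrow> prev_low u' p q" if q: "c < q" "q \<le> c + N" for p q
  proof -
    obtain t where t: "prev_low u t q" using full_prev_low_ex[OF assms(1)] .
    obtain t' where t': "prev_low u' t' q" using full_prev_low_ex[OF assms(3)] .
    have "t = t'"
      using prev_low_le_if_rel_eq[OF assms q t t']
        prev_low_le_if_rel_eq[OF assms(3,4,1,2) assms(5)[symmetric] q t' t] by simp
    then show ?thesis using t t' prev_low_unique by blast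
  qed
  let ?D = "{i \<in> {c..<c + N}. u i \<noteq> u' i}"
  obtain k where k: "c - 1 < j - k * N" "j - k * N \<le> c - 1 + N" using window_representative .
  have "u (j - k * N) = u j" "u' (j - k * N) = u' j"
    using periodic_mult[OF per(1), of "j - k * N" k] periodic_mult[OF per(2), of "j - k * N" k] by auto
  then have "j - k * N \<in> ?D" using j k by auto
  moreover have fin: "finite ?D" by (rule finite_subset[of _ "{c..<c + N}"]) auto
  ultimately have "Max ?D \<in> ?D" using Max_in by blast
  then have p: "c \<le> Max ?D" "Max ?D < c + N" "u (Max ?D) \<noteq> u' (Max ?D)" by auto
  have above: "u i = u' i" if "Max ?D < i" "i < c + N" for i
  proof (rule ccontr)
    assume "u i \<noteq> u' i"
    then have "i \<in> ?D" using that p by auto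
    then show False using Max_ge[OF fin] that by fastforce
  qed
  from p(3) consider "u' (Max ?D) < u (Max ?D)" | "u (Max ?D) < u' (Max ?D)" by linarith
  then show False
  proof cases
    case 1
    show ?thesis by (rule full_eq_aux[OF assms(1-4) eq p(1,2) 1 above])
  next
    case 2
    show ?thesis by (rule full_eq_aux[OF assms(3,4,1,2) eq[symmetric] p(1,2) 2 above[symmetric]])
  qed
qed

end

section \<open>Partitions and rotation\<close>

lemma quotient_eq_imp_eq:
  assumes "equiv A r" "equiv A s" "A // r = A // s" shows "r = s"
proof -
  have "r \<subseteq> s" if r: "equiv A r" and s: "equiv A s" and eq: "A // r = A // s" for r s :: "('a \<times> 'a) set"
  proof (clarify)
    fix x y assume xy: "(x, y) \<in> r"
    then have "x \<in> A" using r by (auto dest: equiv_type)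
    then have "r `` {x} \<in> A // s" using eq by (metis quotientI)
    then obtain z where z: "r `` {x} = s `` {z}" by (auto elim: quotientE)
    have "x \<in> r `` {x}" using equiv_class_self[OF r \<open>x \<in> A\<close>] .
    then have "(z, x) \<in> s" "(z, y) \<in> s" using z xy by auto
    then show "(x, y) \<in> s" using s by (meson equivE symD transD)
  qed
  then show ?thesis using assms by (metis subset_antisym)
qed

lemma image_quotient:
  assumes "bij_betw f A A" "r \<subseteq> A \<times> A" "s \<subseteq> A \<times> A"
    and "\<And>x y. x \<in> A \<Longrightarrow> y \<in> A \<Longrightarrow> (f x, f y) \<in> s \<longleftrightarrow> (x, y) \<in> r"
  shows "(\<lambda>B. f ` B) ` (A // r) = A // s"
proof -
  have fA: "f ` A = A" using assms(1) by (simp add: bij_betw_def)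
  have cl: "f ` (r `` {x}) = s `` {f x}" if x: "x \<in> A" for x
  proof
    show "f ` (r `` {x}) \<subseteq> s `` {f x}" using assms(2,4) x by blast
    show "s `` {f x} \<subseteq> f ` (r `` {x})"
    proof
      fix z assume z: "z \<in> s `` {f x}"
      then have "z \<in> f ` A" using assms(3) fA by auto
      then obtain y where "y \<in> A" "z = f y" by auto
      then show "z \<in> f ` (r `` {x})" using assms(4)[OF x \<open>y \<in> A\<close>] z by auto
    qed
  qed
  have "A // r = (\<lambda>x. r `` {x}) ` A" "A // s = (\<lambda>x. s `` {x}) ` A" by (auto simp: quotient_def)
  then show ?thesis using cl fA by (auto simp: image_image) (metis (no_types, lifting) image_iff)
qed

definition support :: "(int \<Rightarrow> nat) \<Rightarrow> int \<Rightarrow> nat" where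
  "support u n = card {p \<in> {0..<n}. 0 < u p}"

lemma support_psum: "support u n = psum (\<lambda>j. if 0 < u j then 1 else 0) n"
proof -
  have "{p \<in> {0..<n}. 0 < u p} = {0..<n} \<inter> {p. 0 < u p}" by auto
  then show ?thesis unfolding support_def psum_def by (simp add: sum.If_cases)
qed

context slope begin

definition part_rel :: "(int \<Rightarrow> nat) \<Rightarrow> (nat \<times> nat) set" where
  "part_rel u = {(i, j). i \<in> {1..nat N} \<and> j \<in> {1..nat N} \<and> rel u (int i) (int j)}"

definition part :: "(int \<Rightarrow> nat) \<Rightarrow> nat set set" where
  "part u = {1..nat N} // part_rel u"

lemma equiv_part_rel: "periodic N u \<Longrightarrow> equiv {1..nat N} (part_rel u)"
  by (intro equivI refl_onI symI transI)
     (auto simp: part_rel_def rel_refl intro: rel_sym rel_trans)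

text \<open>Every integer has a translate among the labels \<open>1, ..., N\<close>, so the
  partition of the labels determines the relation on all integers.\<close>

lemma part_eq_iff:
  assumes "periodic N u" "periodic N v" shows "part u = part v \<longleftrightarrow> rel u = rel v"
proof
  assume "part u = part v"
  then have eq: "part_rel u = part_rel v"
    unfolding part_def using quotient_eq_imp_eq equiv_part_rel assms by blast
  show "rel u = rel v"
  proof (intro ext)
    fix i j
    obtain k where k: "0 < i - k * N" "i - k * N \<le> 0 + N" using window_representative .
    obtain l where l: "0 < j - l * N" "j - l * N \<le> 0 + N" using window_representative .
    have "(nat (i - k * N), nat (j - l * N)) \<in> part_rel u \<longleftrightarrow> (nat (i - k * N), nat (j - l * N)) \<in> part_rel v"
      using eq by simp
    moreover have "nat (i - k * N) \<in> {1..nat N}" "nat (j - l * N) \<in> {1..nat N}" using k l by auto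
    ultimately have "rel u (i - k * N) (j - l * N) = rel v (i - k * N) (j - l * N)"
      using k l by (simp add: part_rel_def)
    then show "rel u i j = rel v i j"
      using rel_add_mult[OF assms(1), of "i - k * N" k "j - l * N" l]
        rel_add_mult[OF assms(2), of "i - k * N" k "j - l * N" l] by simp
  qed
qed (simp add: part_def part_rel_def)

lemma rot_bij: "bij_betw (rot n) {1..n} {1..n}"
proof -
  have "inj_on (rot n) {1..n}" by (auto simp: inj_on_def rot_def split: if_splits)
  moreover have "rot n ` {1..n} \<subseteq> {1..n}" by (auto simp: rot_def)
  ultimately show ?thesis by (simp add: bij_betw_def endo_inj_surj)
qed

lemma rot_part:
  assumes "periodic N u" shows "rot_partition (nat N) (part u) = part (\<lambda>j. u (j + - 1))"
  unfolding rot_partition_def part_def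
proof (rule image_quotient[OF rot_bij])
  fix x y assume xy: "x \<in> {1..nat N}" "y \<in> {1..nat N}"
  have r: "\<exists>k. int (rot (nat N) z) + - 1 = int z + k * N" if z: "z \<in> {1..nat N}" for z
  proof (cases "z < nat N")
    case True
    then show ?thesis by (intro exI[of _ 0]) (simp add: rot_def)
  next
    case False
    then show ?thesis using z by (intro exI[of _ "-1"]) (auto simp: rot_def)
  qed
  obtain k l where "int (rot (nat N) x) + - 1 = int x + k * N" "int (rot (nat N) y) + - 1 = int y + l * N"
    using r xy by blast
  then have "rel (\<lambda>j. u (j + - 1)) (int (rot (nat N) x)) (int (rot (nat N) y)) \<longleftrightarrow> rel u (int x) (int y)"
    unfolding rel_shift using rel_add_mult[OF assms] by simp
  moreover have "rot (nat N) x \<in> {1..nat N}" "rot (nat N) y \<in> {1..nat N}"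
    using rot_bij[of "nat N"] xy bij_betwE by blast+
  ultimately show "(rot (nat N) x, rot (nat N) y) \<in> part_rel (\<lambda>j. u (j + - 1)) \<longleftrightarrow> (x, y) \<in> part_rel u"
    using xy by (simp add: part_rel_def)
qed (auto simp: part_rel_def)

lemma rot_part_power:
  assumes "periodic N u"
  shows "(rot_partition (nat N) ^^ d) (part u) = part (\<lambda>j. u (j + - int d))"
proof (induction d)
  case (Suc d)
  then show ?case using rot_part[OF periodic_shift[OF assms, of "- int d"]]
    by (simp add: algebra_simps)
qed simp

text \<open>The rise of the walk over one period is independent of where the period begins;
  cancelling \<open>b\<close> turns this into a statement about sums, without reindexing.
  \<open>psum_multiple\<close> uses the same device.\<close>

lemma psum_shift:
  assumes "periodic n u" "0 \<le> n" shows "psum (\<lambda>j. u (j + c)) n = psum u n"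
proof -
  have "ht (\<lambda>j. u (j + c)) n = ht u (c + n) - ht u c"
    unfolding ht_shift by (simp add: add.commute)
  then have "b * int (psum (\<lambda>j. u (j + c)) n) = b * int (psum u n)"
    using ht_periodic[OF assms, of c] ht_nonneg_sum[OF assms(2)] by simp
  then show ?thesis using a_pos a_less by simp
qed

lemma full_shift: "full u \<Longrightarrow> full (\<lambda>j. u (j + c))"
  using psum_shift[of N u c] periodic_shift N_pos by (simp add: full_def)

lemma deficient_shift: "deficient u \<Longrightarrow> deficient (\<lambda>j. u (j + c))"
  using psum_shift[of N u c] periodic_shift N_pos by (simp add: deficient_def)

lemma periodic_multiple:
  assumes "periodic g u" shows "periodic (e * g) u"
  using periodic_mult[OF assms] by (simp add: periodic_def)

lemma psum_multiple:
  assumes "periodic g u" "0 \<le> g" "0 \<le> e"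
  shows "int (psum u (e * g)) = e * int (psum u g)"
proof -
  have "ht u (0 + e * g) = e * (b * int (psum u g) - a * g)"
    using ht_periodic_mult[OF assms(1,2), of 0 e] by simp
  then have "b * int (psum u (e * g)) = b * (e * int (psum u g))"
    using ht_nonneg_sum[of "e * g" u] assms by (simp add: algebra_simps)
  then show ?thesis using a_pos a_less by simp
qed

lemma support_multiple:
  assumes "periodic g u" "0 \<le> g" "0 \<le> e"
  shows "int (support u (e * g)) = e * int (support u g)"
  unfolding support_psum
  by (rule psum_multiple) (use assms in \<open>auto simp: periodic_def\<close>)

text \<open>A block is named by the common previous low of its elements, taken modulo
  \<open>N\<close>. The positions that occur as previous lows are those with a positive letter, and
  \<open>p\<close> itself is recovered from the block of \<open>p + 1\<close>.\<close>

lemma card_part_full: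
  assumes "full u" shows "card (part u) = support u N"
proof -
  let ?S = "{p \<in> {0..<N}. 0 < u p}"
  let ?f = "\<lambda>p. part_rel u `` {nat (p + 1)}"
  have per: "periodic N u" using assms by (simp add: full_def)
  note eqv = equiv_part_rel[OF per]
  have inj: "inj_on ?f ?S"
  proof
    fix p p' assume p: "p \<in> ?S" "p' \<in> ?S" and eq: "?f p = ?f p'"
    have m: "nat (p + 1) \<in> {1..nat N}" "nat (p' + 1) \<in> {1..nat N}" using p by auto
    have "(nat (p + 1), nat (p' + 1)) \<in> part_rel u" using eq_equiv_class[OF eq eqv m(2)] .
    then have "rel u (p + 1) (p' + 1)" using p by (simp add: part_rel_def)
    then obtain k where k: "same_low u (p + 1) (p' + 1 + k * N)" by (auto simp: rel_def)
    have "prev_low u p (p + 1)" "prev_low u p' (p' + 1)" using p by (simp_all add: prev_low_succ_iff)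
    then have "prev_low u p (p' + 1 + k * N)" "prev_low u (p' + k * N) (p' + 1 + k * N)"
      using k prev_low_periodic[OF per] by (auto simp: same_low_def)
    then have "p = p' + k * N" by (rule prev_low_unique)
    then have "p mod N = p' mod N" by simp
    then show "p = p'" using p by simp
  qed
  have "?f ` ?S = part u"
  proof
    show "?f ` ?S \<subseteq> part u" unfolding part_def by (auto intro!: quotientI)
    show "part u \<subseteq> ?f ` ?S"
    proof
      fix B assume "B \<in> part u"
      then obtain q where q: "q \<in> {1..nat N}" "B = part_rel u `` {q}"
        unfolding part_def by (auto elim: quotientE)
      obtain p where p: "prev_low u p (int q)" using full_prev_low_ex[OF assms] .
      have pm: "p = p mod N + p div N * N" by simp
      have r: "rel u (int q) (p mod N + 1)"
      proof -
        have "rel u (int q) (p + 1)" using rel_if_prev_low[OF p prev_low_succ[OF p]] .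
        moreover have "p + 1 = (p mod N + 1) + (p div N) * N" by simp
        ultimately show ?thesis using rel_add_mult2[of u "int q" "p mod N + 1" "p div N"] by metis
      qed
      have "0 < u p" using prev_low_succ[OF p] by (simp add: prev_low_succ_iff)
      then have S: "p mod N \<in> ?S" using periodic_mod[OF per, of p] N_pos by simp
      then have "nat (p mod N + 1) \<in> {1..nat N}" by auto
      then have "(q, nat (p mod N + 1)) \<in> part_rel u" using r q S by (simp add: part_rel_def)
      then have "B = ?f (p mod N)" using q(2) equiv_class_eq[OF eqv] by blast
      then show "B \<in> ?f ` ?S" using S by blast
    qed
  qed
  then show ?thesis using card_image[OF inj] by (simp add: support_def)
qed

text \<open>The drift per period is not positive, so a minimum over one period is a lower bound for
  everything to its left.\<close>

lemma deficient_record_ex: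
  assumes "deficient u" obtains c where "record_low u (c + 1)"
proof -
  have per: "periodic N u" and less: "int (psum u N) < a" using assms by (auto simp: deficient_def)
  have "b * (int (psum u N) + 1) \<le> b * a" using less a_pos a_less by (intro mult_left_mono) auto
  then have d: "b * int (psum u N) - a * N \<le> 0" (is "?d \<le> 0")
    using b_eq a_less by (simp add: algebra_simps)
  have "finite {0..<N}" "{0..<N} \<noteq> {}" using N_pos by auto
  from ex_min_if_finite[of "ht u ` {0..<N}"] this
  obtain q where q: "q \<in> {0..<N}" and m: "\<And>j. j \<in> {0..<N} \<Longrightarrow> ht u q \<le> ht u j" by force
  have "ht u q \<le> ht u p" if "p < q" for p
  proof -
    have k: "p div N \<le> 0" using that q N_pos
      by (metis atLeastLessThan_iff div_pos_pos_trivial zdiv_mono1 order_less_imp_le)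
    have "ht u p = ht u (p mod N) + (p div N) * ?d"
      using ht_periodic_mult[OF per, of "p mod N" "p div N"] N_pos by simp
    moreover have "0 \<le> (p div N) * ?d" using k d by (simp add: mult_nonpos_nonpos)
    moreover have "ht u q \<le> ht u (p mod N)" using m[of "p mod N"] N_pos by simp
    ultimately show ?thesis by simp
  qed
  then show ?thesis using that[of "q - 1"] by (simp add: record_low_def)
qed

lemma support_upd:
  assumes "periodic N u" "u c = 0" "0 < x" shows "support (upd u c x) N = support u N + 1"
proof -
  have iff: "N dvd p - c \<longleftrightarrow> p = c mod N" if "p \<in> {0..<N}" for p
    using that by (simp add: mod_eq_dvd_iff[symmetric])
  have "{p \<in> {0..<N}. 0 < upd u c x p} = insert (c mod N) {p \<in> {0..<N}. 0 < u p}"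
    using iff assms(3) N_pos by (auto simp: upd_def)
  moreover have "c mod N \<notin> {p \<in> {0..<N}. 0 < u p}" using periodic_mod[OF assms(1), of c] assms(2) by simp
  moreover have "finite {p \<in> {0..<N}. 0 < u p}" by (rule finite_subset[of _ "{0..<N}"]) auto
  ultimately show ?thesis by (simp add: support_def)
qed

lemma deficient_part:
  assumes "deficient u"
  obtains u' where "full u'" "part u' = part u" "support u' N = support u N + 1"
proof -
  obtain c where c: "record_low u (c + 1)" using deficient_record_ex[OF assms] .
  note f = deficient_fill[OF assms c]
  have "0 < nat a - psum u N" using assms by (auto simp: deficient_def)
  then show ?thesis
    using that[OF f(1)] f(3) support_upd[of u c] record_low_zero[OF c] assms
    by (simp add: part_def part_rel_def deficient_def)
qed

lemma card_part_deficient: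
  assumes "deficient u" shows "card (part u) = support u N + 1"
  using deficient_part[OF assms] card_part_full by metis

text \<open>Both fillings at \<open>c\<close> are full, have the root \<open>c\<close> and the same
  relation, hence coincide; on the class of \<open>c\<close> both original words vanish.\<close>

lemma deficient_eq:
  assumes "deficient u" "record_low u (c + 1)" "deficient v" "record_low v (c + 1)" "rel u = rel v"
  shows "u = v"
proof -
  note f = deficient_fill[OF assms(1,2)] and f' = deficient_fill[OF assms(3,4)]
  have eq: "upd u c (nat a - psum u N) = upd v c (nat a - psum v N)"
    by (rule full_eq[OF f(1,2) f'(1,2)]) (simp add: f(3) f'(3) assms(5))
  show ?thesis
  proof
    fix j show "u j = v j"
    proof (cases "N dvd j - c")
      case True
      then obtain t where "j - c = N * t" by (auto simp: dvd_def)
      then have "j = c + t * N" by (simp add: algebra_simps)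
      then show ?thesis
        using periodic_mult[of N u c t] periodic_mult[of N v c t] assms(1,3)
          record_low_zero[OF assms(2)] record_low_zero[OF assms(4)]
        by (simp add: deficient_def)
    next
      case False
      then show ?thesis using fun_cong[OF eq, of j] by (simp add: upd_def)
    qed
  qed
qed

text \<open>The first position after \<open>c\<close> that is not above \<open>c\<close> has a
  previous low that is lower still, and this can only lie to the left of \<open>c\<close>. A missing
  root thus becomes an arc, which the relation can see.\<close>

lemma not_root:
  assumes "full u" "\<not> root u c"
  obtains p q where "prev_low u p q" "p < c" "c < q"
proof -
  obtain j0 where j0: "c < j0" "ht u j0 \<le> ht u c" using assms(2) by (force simp: root_def)
  let ?P = "\<lambda>n. 0 < n \<and> ht u (c + int n) \<le> ht u c"
  define n where "n = (LEAST n. ?P n)"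
  have "?P (nat (j0 - c))" using j0 by simp
  then have n: "?P n" unfolding n_def by (rule LeastI)
  have min: "\<not> ?P m" if "m < n" for m using that not_less_Least unfolding n_def by blast
  obtain p where p: "prev_low u p (c + int n)" using full_prev_low_ex[OF assms(1)] .
  have "p < c"
  proof (rule ccontr)
    assume A: "\<not> p < c"
    have "ht u p < ht u (c + int n)" "p < c + int n" using p by (auto simp: prev_low_def)
    moreover have "p \<noteq> c" using calculation n by auto
    ultimately show False using min[of "nat (p - c)"] n A by (auto simp: nat_less_iff)
  qed
  then show ?thesis using that p n by auto
qed

text \<open>A root at \<open>i - 1\<close> puts all four positions into one window, where related
  positions share a previous low. If the two previous lows differed, the arc that starts first would
  end no higher than it starts.\<close>

lemma rel_noncrossing:
  assumes "full u" "i < j" "j < k" "k < l" "l < i + N" "rel u i k" "rel u j l"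
  shows "rel u i j"
proof -
  obtain v where v: "full v" "root v (i - 1)" "rel v = rel u" using full_reroot[OF assms(1)] .
  have per: "periodic N v" using v by (simp add: full_def)
  have w: "rel v x y \<longleftrightarrow> same_low v x y"
    if "i - 1 < x" "x \<le> i - 1 + N" "i - 1 < y" "y \<le> i - 1 + N" for x y
    using rel_window[OF per _ that] root_prev_low_ge[OF v(2)] by blast
  have "same_low v i k" "same_low v j l" using w[of i k] w[of j l] assms v by auto
  moreover obtain p where p: "prev_low v p i" using full_prev_low_ex[OF v(1)] .
  moreover obtain q where q: "prev_low v q j" using full_prev_low_ex[OF v(1)] .
  ultimately have p': "prev_low v p k" and q': "prev_low v q l" by (auto simp: same_low_def)
  have "p < i" "ht v p < ht v k" "\<And>t. p < t \<Longrightarrow> t < k \<Longrightarrow> ht v k \<le> ht v t"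
    using p p' by (auto simp: prev_low_def)
  moreover have "q < j" "ht v q < ht v l" "\<And>t. q < t \<Longrightarrow> t < l \<Longrightarrow> ht v l \<le> ht v t"
    "\<And>t. q < t \<Longrightarrow> t < j \<Longrightarrow> ht v j \<le> ht v t"
    using q q' by (auto simp: prev_low_def)
  moreover have "\<not> p < q"
    using calculation(3)[of q] calculation(6)[of k] calculation(4,5) assms(3,4) by auto
  moreover have "\<not> q < p"
    using calculation(7)[of p] calculation(3)[of j] calculation(1,2,4,5) assms(2,3) by auto
  ultimately have "p = q" by simp
  then show ?thesis using rel_if_prev_low[OF p] q v(3) by metis
qed

end

text \<open>Among all pairs of related points at distance less than \<open>g\<close> take one of maximal distance: no
  such pair can reach across its left end.\<close>

lemma noncrossing_cut_ex:
  fixes R :: "int \<Rightarrow> int \<Rightarrow> bool" and N g :: int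
  assumes equivp: "equivp R"
    and per: "\<And>i j. R i (j + N) \<longleftrightarrow> R i j"
    and inv: "\<And>i j. R (i + g) (j + g) \<longleftrightarrow> R i j"
    and noncrossing:
      "\<forall>i j k l. i < j \<and> j < k \<and> k < l \<and> l < i + N \<and> R i k \<and> R j l \<longrightarrow> R i j"
    and no_center: "\<And>x. \<not> R x (x + g)"
    and N: "0 < g" "N = e * g" "2 \<le> e"
  shows "(\<And>i j. R i j \<Longrightarrow> i < j \<Longrightarrow> j < i + N \<Longrightarrow> j - i < g \<or> N - g < j - i)" (is "PROP ?D")
    and "\<exists>x. \<forall>x' y'. x' < x \<longrightarrow> x \<le> y' \<longrightarrow> y' - x' < g \<longrightarrow> \<not> R x' y'"
proof -
  have N2: "2 * g \<le> N" using N by simp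
  have refl: "\<And>i. R i i" and sym: "\<And>i j. R i j \<Longrightarrow> R j i"
    and trans: "\<And>i j k. R i j \<Longrightarrow> R j k \<Longrightarrow> R i k"
    using equivp by (blast intro: equivp_reflp equivp_symp equivp_transp)+
  have nc: "\<And>i j k l. i < j \<Longrightarrow> j < k \<Longrightarrow> k < l \<Longrightarrow> l < i + N \<Longrightarrow> R i k \<Longrightarrow> R j l \<Longrightarrow> R i j"
    using noncrossing by blast
  show dist: "PROP ?D"
  proof (rule ccontr)
    fix i j assume R: "R i j" and ij: "i < j" "j < i + N" and "\<not> (j - i < g \<or> N - g < j - i)"
    then have "g \<le> j - i" "j - i \<le> N - g" by auto
    moreover have "j - i \<noteq> g" using no_center[of i] R by auto
    moreover have "j - i \<noteq> N - g"
    proof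
      assume "j - i = N - g"
      then have "R j (j + g)" using per[of j i] sym[OF R] by (simp add: algebra_simps)
      then show False using no_center by simp
    qed
    \<comment> \<open>At a distance strictly between \<open>g\<close> and \<open>N - g\<close> the
      pair crosses its own translate by \<open>g\<close>.\<close>
    ultimately have "R i (i + g)" using nc[of i "i + g" j "j + g"] inv[of i j] R N by auto
    then show False using no_center by simp
  qed
  let ?S = "{d \<in> {0..<g}. \<exists>x. R x (x + d)}"
  have fin: "finite ?S" by (rule finite_subset[of _ "{0..<g}"]) auto
  have "0 \<in> ?S" using N refl by auto
  then have "Max ?S \<in> ?S" using Max_in[OF fin] by blast
  then obtain x where x: "R x (x + Max ?S)" "0 \<le> Max ?S" "Max ?S < g" by auto
  define y where "y = x + Max ?S"
  have xy: "R x y" "x \<le> y" "y < x + g" using x by (auto simp: y_def)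
  have max: "y' - x' \<le> y - x" if "R x' y'" "x' \<le> y'" "y' - x' < g" for x' y'
  proof -
    have "R x' (x' + (y' - x'))" using that by simp
    then have "y' - x' \<in> ?S" using that by (intro CollectI conjI exI[of _ x']) auto
    then show ?thesis using Max_ge[OF fin] by (simp add: y_def)
  qed
  have "\<not> R x' y'" if s: "x' < x" "x \<le> y'" "y' - x' < g" for x' y'
  proof
    assume R: "R x' y'"
    show False
    proof (cases "R x' x")
      case True
      then have R': "R x' y" using xy trans by blast
      show False
      proof (cases "y - x' < g")
        case True
        then show False using max[OF R'] s xy by auto
      next
        case False
        have "y < x' + N" using s xy N2 by linarith
        then have far: "N - g < y - x'" using dist[OF R'] False s xy by auto
        \<comment> \<open>Both \<open>y - x\<close> and \<open>x - x'\<close> are less than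
          \<open>g\<close>, so a distance above \<open>N - g\<close> is possible only for
          \<open>e = 2\<close>. There a translate of the pair by \<open>g\<close>, read backwards
          around the circle, crosses the pair \<open>x'\<close>, \<open>x\<close>.\<close>
        then have "e * g < 3 * g" using s xy N by linarith
        then have "e = 2" using N by simp
        then have e: "N = 2 * g" using N by simp
        have "R (y - g) (x' - g)" using inv[of "y - g" "x' - g"] sym[OF R'] by simp
        then have "R (y - g) (x' + g)" using per[of "y - g" "x' - g"] e by (simp add: algebra_simps)
        then have "R x' (y - g)"
          using nc[of x' "y - g" x "x' + g"] \<open>R x' x\<close> far s xy e N by auto
        then have "R (y - g) y" using R' sym trans by blast
        then show False using no_center[of "y - g"] by simp
      qed
    next
      case False
      then have "y' \<noteq> x" using R by auto
      then have s': "x < y'" using s by simp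
      have "y \<noteq> y'" using R xy False sym trans by blast
      \<comment> \<open>Otherwise the two pairs would cross. Hence \<open>y < y'\<close>, and the
        new pair properly contains the one of maximal distance.\<close>
      moreover have "\<not> y' < y"
        using nc[of x' x y' y] s s' R xy False N2 by auto
      ultimately show False using max[OF R] s xy by auto
    qed
  qed
  then show "\<exists>x. \<forall>x' y'. x' < x \<longrightarrow> x \<le> y' \<longrightarrow> y' - x' < g \<longrightarrow> \<not> R x' y'" by blast
qed

section \<open>Counting words\<close>

definition periodic_word :: "nat list \<Rightarrow> int \<Rightarrow> nat" where
  "periodic_word xs j = xs ! nat (j mod int (length xs))"

lemma periodic_periodic_word: "periodic (int (length xs)) (periodic_word xs)"
  by (simp add: periodic_def periodic_word_def)

lemma sum_int_interval: "(\<Sum>i\<in>{0..<int n}. f i) = (\<Sum>i<n. f (int i))"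
proof -
  have "bij_betw int {..<n} {0..<int n}"
    by (rule bij_betwI[of _ _ _ nat]) auto
  then show ?thesis using sum.reindex_bij_betw by (metis (no_types, lifting) sum.cong)
qed

lemma psum_periodic_word: "psum (periodic_word xs) (int (length xs)) = sum_list xs"
  unfolding psum_def sum_int_interval
  by (simp add: periodic_word_def sum_list_sum_nth atLeast0LessThan flip: of_nat_mod)

lemma support_periodic_word:
  "support (periodic_word xs) (int (length xs)) = length (filter (\<lambda>x. 0 < x) xs)"
proof -
  have "length (filter (\<lambda>x. 0 < x) xs) = (\<Sum>x\<leftarrow>xs. if 0 < x then 1 else 0)"
    by (induction xs) auto
  also have "\<dots> = (\<Sum>i<length xs. if 0 < xs ! i then 1 else 0)"
    by (simp add: sum_list_sum_nth atLeast0LessThan)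
  also have "\<dots> = support (periodic_word xs) (int (length xs))"
    unfolding support_psum psum_def sum_int_interval
    by (rule sum.cong) (auto simp: periodic_word_def simp flip: of_nat_mod)
  finally show ?thesis by simp
qed

lemma bij_betw_periodic_word:
  assumes "0 < n"
  shows "bij_betw periodic_word {xs. length xs = n} {u. periodic (int n) u}"
proof (rule bij_betwI[of _ _ _ "\<lambda>u. map (\<lambda>i. u (int i)) [0..<n]"])
  fix xs :: "nat list" assume "xs \<in> {xs. length xs = n}"
  then show "map (\<lambda>i. periodic_word xs (int i)) [0..<n] = xs"
    by (auto intro!: nth_equalityI simp: periodic_word_def simp flip: of_nat_mod)
next
  fix u assume "u \<in> {u. periodic (int n) u}"
  then have "u (j mod int n) = u j" for j using periodic_mod by auto
  moreover have "nat (j mod int n) < n" for j using assms by (simp add: nat_less_iff)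
  ultimately show "periodic_word (map (\<lambda>i. u (int i)) [0..<n]) = u"
    using assms by (auto simp: periodic_word_def)
qed (use periodic_periodic_word in auto)

lemma bij_betw_restrict:
  assumes "bij_betw f A B" "\<And>x. x \<in> A \<Longrightarrow> P x \<longleftrightarrow> Q (f x)"
  shows "bij_betw f {x \<in> A. P x} {y \<in> B. Q y}"
  using assms unfolding bij_betw_def inj_on_def by auto

lemma words_as_lists:
  assumes "0 < n"
  shows "bij_betw periodic_word {xs. length xs = n \<and> Q (length (filter (\<lambda>x. 0 < x) xs)) (sum_list xs)}
    {u. periodic (int n) u \<and> Q (support u (int n)) (psum u (int n))}"
proof -
  have "bij_betw periodic_word
      {xs \<in> {xs. length xs = n}. Q (length (filter (\<lambda>x. 0 < x) xs)) (sum_list xs)}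
      {u \<in> {u. periodic (int n) u}. Q (support u (int n)) (psum u (int n))}"
    by (rule bij_betw_restrict[OF bij_betw_periodic_word[OF assms]])
       (use support_periodic_word psum_periodic_word in auto)
  then show ?thesis by simp
qed

lemma finite_bounded_lists: "finite {xs :: nat list. length xs = n \<and> sum_list xs \<le> S}"
proof (rule finite_subset)
  show "{xs :: nat list. length xs = n \<and> sum_list xs \<le> S} \<subseteq> {xs. set xs \<subseteq> {..S} \<and> length xs = n}"
    using member_le_sum_list by fastforce
qed (simp add: finite_lists_length_eq)

text \<open>The positive entries choose \<open>m\<close> of \<open>n\<close> positions, and their
  partial sums form an \<open>m\<close>-subset of \<open>{1..S}\<close>. The induction splits off
  the first entry and sums a column of Pascal's triangle.\<close>

lemma card_lists_sum_le:
  "card {xs :: nat list. length xs = n \<and> length (filter (\<lambda>x. 0 < x) xs) = m \<and> sum_list xs \<le> S}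
     = (n choose m) * (S choose m)"
proof (induction n arbitrary: m S)
  case 0
  have "{xs :: nat list. length xs = 0 \<and> length (filter (\<lambda>x. 0 < x) xs) = m \<and> sum_list xs \<le> S}
    = (if m = 0 then {[]} else {})" by auto
  then show ?case by simp
next
  case (Suc n)
  let ?L = "\<lambda>n m S. {xs :: nat list. length xs = n \<and> length (filter (\<lambda>x. 0 < x) xs) = m \<and> sum_list xs \<le> S}"
  have fin: "finite (?L n m S)" for n m S
    by (rule finite_subset[OF _ finite_bounded_lists[of n S]]) auto
  show ?case
  proof (cases m)
    case 0
    have "?L (Suc n) 0 S = Cons 0 ` ?L n 0 S"
      by (auto simp: length_Suc_conv image_iff split: if_splits)
    then have "card (?L (Suc n) 0 S) = card (?L n 0 S)" by (simp add: card_image)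
    then show ?thesis using Suc.IH[of 0 S] 0 by simp
  next
    case (Suc m')
    have eq: "?L (Suc n) (Suc m') S = Cons 0 ` ?L n (Suc m') S \<union> (\<Union>x\<in>{1..S}. Cons x ` ?L n m' (S - x))"
    proof
      show "?L (Suc n) (Suc m') S \<subseteq> Cons 0 ` ?L n (Suc m') S \<union> (\<Union>x\<in>{1..S}. Cons x ` ?L n m' (S - x))"
      proof
        fix ys assume A: "ys \<in> ?L (Suc n) (Suc m') S"
        then obtain y xs where ys: "ys = y # xs" by (auto simp: length_Suc_conv)
        show "ys \<in> Cons 0 ` ?L n (Suc m') S \<union> (\<Union>x\<in>{1..S}. Cons x ` ?L n m' (S - x))"
        proof (cases "y = 0")
          case False
          then show ?thesis
            using A ys by (intro UnI2 UN_I[of y] image_eqI[of _ _ xs]) auto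
        qed (use A ys in auto)
      qed
    qed auto
    have "card (?L (Suc n) (Suc m') S) =
        card (Cons 0 ` ?L n (Suc m') S) + card (\<Union>x\<in>{1..S}. Cons x ` ?L n m' (S - x))"
      unfolding eq by (rule card_Un_disjoint) (use fin in auto)
    also have "card (Cons 0 ` ?L n (Suc m') S) = (n choose Suc m') * (S choose Suc m')"
      using Suc.IH by (simp add: card_image)
    also have "card (\<Union>x\<in>{1..S}. Cons x ` ?L n m' (S - x)) =
        (\<Sum>x\<in>{1..S}. card (Cons x ` ?L n m' (S - x)))"
      by (rule card_UN_disjoint) (use fin in auto)
    also have "\<dots> = (\<Sum>x\<in>{1..S}. (n choose m') * (S - x choose m'))"
      using Suc.IH by (simp add: card_image)
    also have "\<dots> = (n choose m') * (\<Sum>x\<in>{1..S}. (S - x choose m'))"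
      by (simp add: sum_distrib_left)
    also have "(\<Sum>x\<in>{1..S}. (S - x choose m')) = (\<Sum>x<S. x choose m')"
      by (rule sum.reindex_bij_witness[of _ "\<lambda>x. S - x" "\<lambda>x. S - x"]) auto
    also have "\<dots> = S choose Suc m'"
      by (induction S) simp_all
    finally show ?thesis unfolding Suc by (simp add: algebra_simps)
  qed
qed

text \<open>Subtracting the counts for the bounds \<open>s\<close> and \<open>s - 1\<close> reduces
  this to Pascal's rule.\<close>

lemma card_lists_sum_eq:
  assumes "0 < s" "0 < m"
  shows "card {xs :: nat list. length xs = n \<and> length (filter (\<lambda>x. 0 < x) xs) = m \<and> sum_list xs = s}
     = (n choose m) * (s - 1 choose (m - 1))"
proof -
  let ?L = "\<lambda>S. {xs :: nat list. length xs = n \<and> length (filter (\<lambda>x. 0 < x) xs) = m \<and> sum_list xs \<le> S}"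
  have eq: "{xs :: nat list. length xs = n \<and> length (filter (\<lambda>x. 0 < x) xs) = m \<and> sum_list xs = s} = ?L s - ?L (s - 1)"
    using assms by auto
  have fin: "finite (?L (s - 1))"
    by (rule finite_subset[OF _ finite_bounded_lists[of n "s - 1"]]) auto
  have "?L (s - 1) \<subseteq> ?L s" by auto
  from card_Diff_subset[OF fin this]
  have "card {xs :: nat list. length xs = n \<and> length (filter (\<lambda>x. 0 < x) xs) = m \<and> sum_list xs = s}
     = card (?L s) - card (?L (s - 1))"
    unfolding eq .
  then show ?thesis unfolding card_lists_sum_le using assms
    by (cases s; cases m) (simp_all add: algebra_simps)
qed

lemma finite_words: "0 < n \<Longrightarrow> finite {u. periodic (int n) u \<and> psum u (int n) \<le> S}"
  using bij_betw_finite[OF words_as_lists[of n "\<lambda>m s. s \<le> S"]] finite_bounded_lists[of n S] by simp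

lemma card_words_sum_le:
  "0 < n \<Longrightarrow> card {u. periodic (int n) u \<and> support u (int n) = m \<and> psum u (int n) \<le> S}
     = (n choose m) * (S choose m)"
  using bij_betw_same_card[OF words_as_lists[of n "\<lambda>m' s. m' = m \<and> s \<le> S"]] card_lists_sum_le[of n m S]
  by simp

lemma card_words_sum_eq:
  assumes "0 < n" "0 < s" "0 < m"
  shows "card {u. periodic (int n) u \<and> support u (int n) = m \<and> psum u (int n) = s}
     = (n choose m) * (s - 1 choose (m - 1))"
  using bij_betw_same_card[OF words_as_lists[OF assms(1), of "\<lambda>m' s'. m' = m \<and> s' = s"]]
    card_lists_sum_eq[OF assms(2,3), of n] by simp

section \<open>Partitions fixed by a rotation\<close>

context slope begin

text \<open>Sum exactly \<open>a\<close> represents the partitions without a central block. A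
  smaller sum represents those with one, its rank being the missing mass; leaving that rank out of
  the word is what allows the period \<open>g\<close>.\<close>

definition symmetric_words :: "int \<Rightarrow> (int \<Rightarrow> nat) set" where
  "symmetric_words g = {u. periodic g u \<and> int (psum u N) \<le> a}"

text \<open>Under a longer arc both \<open>p + g\<close> and \<open>q - g\<close> would be no lower
  than \<open>q\<close>. The walk would then rise strictly over the period from \<open>p\<close> but
  not over the period ending in \<open>q\<close>, although all periods have the same
  increment.\<close>

lemma prev_low_arc:
  assumes "periodic g u" "0 < g" "prev_low u p q" shows "q \<le> p + g"
proof (rule ccontr)
  assume "\<not> q \<le> p + g"
  then have "ht u q \<le> ht u (p + g)" "ht u q \<le> ht u (q - g)" "ht u p < ht u q"
    using assms by (auto simp: prev_low_def)
  moreover have "ht u (q - g + g) - ht u (q - g) = ht u (p + g) - ht u p"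
    using ht_periodic[OF assms(1), of "q - g"] ht_periodic[OF assms(1), of p] assms(2) by simp
  ultimately show False by simp
qed

context
  fixes g e :: int
  assumes g_pos: "0 < g" and e_ge: "2 \<le> e" and N_eq: "N = e * g"
begin

lemma N_ge: "2 * g \<le> N" using g_pos e_ge N_eq by simp

lemma periodic_gN: "periodic g u \<Longrightarrow> periodic N u"
  using periodic_multiple N_eq by simp

lemma symmetric_cases:
  assumes "u \<in> symmetric_words g" obtains "full u" | "deficient u"
  using assms periodic_gN[of u] unfolding symmetric_words_def full_def deficient_def
  by (cases "int (psum u N) = a") auto

text \<open>Arcs have length at most \<open>g\<close> and \<open>N\<close> is at least
  \<open>2 * g\<close>, so \<open>x\<close> and a translate of \<open>x + g\<close> cannot share a
  previous low. The relation alone thus reveals the record lows.\<close>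

lemma rel_shift_record:
  assumes "periodic g u" shows "rel u x (x + g) \<longleftrightarrow> record_low u x"
proof
  assume "record_low u x"
  then have "record_low u (x + g)" using record_low_periodic[OF assms, of x 1] by simp
  then have "same_low u x (x + g + 0 * N)" using same_low_record[OF \<open>record_low u x\<close>] by simp
  then show "rel u x (x + g)" unfolding rel_def by blast
next
  assume "rel u x (x + g)"
  then obtain k where k: "same_low u x (x + g + k * N)" unfolding rel_def by blast
  show "record_low u x" unfolding record_low_iff
  proof (intro allI notI)
    fix p assume p: "prev_low u p x"
    then have p': "prev_low u p (x + g + k * N)" using k by (simp add: same_low_def)
    have "p < x" "x \<le> p + g" "p < x + g + k * N" "x + g + k * N \<le> p + g"
      using p p' prev_low_arc[OF assms g_pos] by (auto simp: prev_low_def)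
    then have "k * N < 0 * N" "(- 1) * N < k * N" using N_ge g_pos by linarith+
    then show False using N_pos by (simp only: mult_less_cancel_right_pos)
  qed
qed

text \<open>The relation fixes the record lows and with them the choice between full and deficient.
  For two full words a common root is still needed: an arc of \<open>v\<close> over a root
  \<open>c\<close> of \<open>u\<close> is short, and transported to \<open>u\<close> it yields an
  arc of \<open>u\<close> over \<open>c\<close>.\<close>

lemma inj_on_symmetric: "inj_on part (symmetric_words g)"
proof
  fix u v assume uv: "u \<in> symmetric_words g" "v \<in> symmetric_words g" and "part u = part v"
  have pg: "periodic g u" "periodic g v" using uv by (auto simp: symmetric_words_def)
  note per = periodic_gN[OF pg(1)] periodic_gN[OF pg(2)]
  have rel: "rel u = rel v" using part_eq_iff[OF per] \<open>part u = part v\<close> by simp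
  have rec: "record_low u x \<longleftrightarrow> record_low v x" for x
    using rel_shift_record[OF pg(1)] rel_shift_record[OF pg(2)] rel by simp
  have not_full: "\<not> full w" if "record_low w x" for w x
    using full_prev_low_ex[of w x] that by (auto simp: record_low_iff)
  show "u = v"
    using symmetric_cases[OF uv(1)]
  proof cases
    case 2
    obtain c where c: "record_low u (c + 1)" using deficient_record_ex[OF 2] .
    then have c': "record_low v (c + 1)" using rec by simp
    then have "deficient v" using symmetric_cases[OF uv(2)] not_full by blast
    then show ?thesis using deficient_eq[OF 2 c _ c' rel] by simp
  next
    case 1
    have fv: "full v"
      using symmetric_cases[OF uv(2)]
    proof cases
      case d: 2
      obtain c where "record_low v (c + 1)" using deficient_record_ex[OF d] .
      then show ?thesis using rec not_full 1 by blast
    qed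
    obtain c where c: "root u c" using full_root_ex[OF 1] .
    have "root v c"
    proof (rule ccontr)
      assume "\<not> root v c"
      then obtain p q where pq: "prev_low v p q" "p < c" "c < q" using not_root[OF fv] by blast
      have "rel u (p + 1) q" using rel_if_prev_low[OF prev_low_succ[OF pq(1)] pq(1)] rel by simp
      then obtain k where k: "same_low u (p + 1) (q + k * N)" unfolding rel_def by blast
      obtain t where t: "prev_low u t (p + 1)" using full_prev_low_ex[OF 1] .
      then have t': "prev_low u t (q + k * N)" using k by (simp add: same_low_def)
      have "t < p + 1" "p + 1 \<le> t + g" "t < q + k * N" "q + k * N \<le> t + g" "q \<le> p + g"
        using t t' prev_low_arc[OF pg(1) g_pos] prev_low_arc[OF pg(2) g_pos pq(1)]
        by (auto simp: prev_low_def)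
      then have "k * N < 1 * N" "(- 1) * N < k * N" using N_ge g_pos pq by linarith+
      then have "k = 0" using N_pos by (simp only: mult_less_cancel_right_pos)
      then have "prev_low u t q" using t' by simp
      then have "c \<le> t" using root_prev_low_ge[OF c pq(3)] by simp
      then show False using \<open>t < p + 1\<close> pq by simp
    qed
    then show ?thesis using full_eq[OF 1 c fv _ rel] by simp
  qed
qed

text \<open>A representative is chosen whose distinguished place is preserved by the shift by
  \<open>g\<close>, so that uniqueness identifies the word with its shift: a record low in the
  central block if there is one, otherwise a root just before a cut of the noncrossing
  relation.\<close>

lemma symmetric_representative:
  assumes "full u" and inv: "\<And>i j. rel u (i + g) (j + g) \<longleftrightarrow> rel u i j"
  obtains v where "v \<in> symmetric_words g" "rel v = rel u"
proof (cases "\<exists>x. rel u x (x + g)")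
  case True
  then obtain x where x: "rel u x (x + g)" by blast
  obtain w where w: "full w" "root w (x - 1)" "rel w = rel u" using full_reroot[OF assms(1)] .
  define v where "v = upd w (x - 1) 0"
  have v: "deficient v" "record_low v (x - 1 + 1)" "rel v = rel u"
    using full_drain(1-3)[OF w(1,2)] w(3) by (auto simp: v_def)
  have "rel v x (x + g)" using x v(3) by simp
  then have "record_low v (x + g)" using rel_record_low v by (simp add: deficient_def)
  then have "record_low (\<lambda>j. v (j + g)) (x - 1 + 1)" unfolding record_low_shift by simp
  moreover have "rel (\<lambda>j. v (j + g)) = rel v"
    by (intro ext) (simp add: rel_shift v(3) inv)
  ultimately have "(\<lambda>j. v (j + g)) = v"
    using deficient_eq[OF deficient_shift[OF v(1)] _ v(1,2)] by blast
  then have "periodic g v" unfolding periodic_def by (rule fun_cong[THEN allI])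
  then show ?thesis using that[of v] v by (simp add: symmetric_words_def deficient_def)
next
  case False
  have per: "periodic N u" using assms(1) by (simp add: full_def)
  have P: "rel u i (j + N) \<longleftrightarrow> rel u i j" for i j using rel_add_mult2[of u i j 1] by simp
  have nc: "\<And>x. \<not> rel u x (x + g)" using False by blast
  have eq: "equivp (rel u)"
    by (intro equivpI reflpI sympI transpI) (use rel_refl rel_sym[OF per] rel_trans[OF per] in blast)+
  have "\<forall>i j k l. i < j \<and> j < k \<and> k < l \<and> l < i + N \<and> rel u i k \<and> rel u j l \<longrightarrow> rel u i j"
    using rel_noncrossing[OF assms(1)] by blast
  note cut = noncrossing_cut_ex[OF eq P inv this nc g_pos N_eq e_ge]
  obtain x where x: "\<And>x' y'. x' < x \<Longrightarrow> x \<le> y' \<Longrightarrow> y' - x' < g \<Longrightarrow> \<not> rel u x' y'"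
    using cut(2) by blast
  obtain w where w: "full w" "root w (x - 1)" "rel w = rel u" using full_reroot[OF assms(1)] .
  have perw: "periodic N w" using w(1) by (simp add: full_def)
  \<comment> \<open>An arc over \<open>x - 1 + g\<close> joins related positions at distance below
    \<open>g\<close> or above \<open>N - g\<close>. In the first case the pair moved back by
    \<open>g\<close> straddles the cut at \<open>x\<close>, in the second the complementary pair
    around the circle does.\<close>
  have "root w (x - 1 + g)"
  proof (rule ccontr)
    assume "\<not> root w (x - 1 + g)"
    then obtain p q where pq: "prev_low w p q" "p < x - 1 + g" "x - 1 + g < q"
      using not_root[OF w(1)] by blast
    have r: "rel u (p + 1) q" using rel_if_prev_low[OF prev_low_succ[OF pq(1)] pq(1)] w(3) by simp
    have "x - 1 \<le> p" using root_prev_low_ge[OF w(2) _ pq(1)] pq g_pos by simp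
    have "q \<le> x - 1 + N"
    proof (rule ccontr)
      assume "\<not> q \<le> x - 1 + N"
      moreover have "root w (x - 1 + N)" using root_periodic[OF perw, of "x - 1" 1] w(2) by simp
      ultimately have "x - 1 + N \<le> p" using root_prev_low_ge[of w "x - 1 + N" q p] pq by simp
      then show False using pq N_ge g_pos by simp
    qed
    have "q - (p + 1) < g \<or> N - g < q - (p + 1)"
      by (rule cut(1)[OF r]) (use pq \<open>x - 1 \<le> p\<close> \<open>q \<le> x - 1 + N\<close> in auto)
    then show False
    proof
      assume "q - (p + 1) < g"
      moreover have "rel u (p + 1 - g) (q - g)" using inv[of "p + 1 - g" "q - g"] r by simp
      ultimately show False using x[of "p + 1 - g" "q - g"] pq by simp
    next
      assume "N - g < q - (p + 1)"
      moreover have "rel u (q - N) (p + 1)"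
        using rel_sym[OF per r] rel_add_mult1[OF per, of "q - N" 1 "p + 1"] by simp
      ultimately show False
        using x[of "q - N" "p + 1"] \<open>x - 1 \<le> p\<close> \<open>q \<le> x - 1 + N\<close> by simp
    qed
  qed
  then have "root (\<lambda>j. w (j + g)) (x - 1)" unfolding root_shift .
  moreover have "rel (\<lambda>j. w (j + g)) = rel w" by (intro ext) (simp add: rel_shift w(3) inv)
  ultimately have "(\<lambda>j. w (j + g)) = w" using full_eq[OF full_shift[OF w(1)] _ w(1,2)] by blast
  then have "periodic g w" unfolding periodic_def by (rule fun_cong[THEN allI])
  then show ?thesis using that[of w] w by (simp add: symmetric_words_def full_def)
qed

lemma bij_betw_symmetric:
  "bij_betw part (symmetric_words g)
     {\<pi> \<in> part ` Collect full. (rot_partition (nat N) ^^ nat g) \<pi> = \<pi>}"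
  unfolding bij_betw_def
proof (intro conjI inj_on_symmetric subset_antisym subsetI)
  fix \<pi> assume "\<pi> \<in> part ` symmetric_words g"
  then obtain u where u: "u \<in> symmetric_words g" "\<pi> = part u" by blast
  have "\<pi> \<in> part ` Collect full"
    using symmetric_cases[OF u(1)]
  proof cases
    case 2
    obtain v where "full v" "part v = part u" using deficient_part[OF 2] .
    then show ?thesis using u(2) by (intro image_eqI[of _ _ v]) auto
  qed (use u in auto)
  moreover
  have pg: "periodic g u" using u by (simp add: symmetric_words_def)
  have "(\<lambda>j. u (j + - int (nat g))) = u" using periodic_mult[OF pg, of _ "- 1"] g_pos by auto
  then have "(rot_partition (nat N) ^^ nat g) \<pi> = \<pi>"
    unfolding u(2) rot_part_power[OF periodic_gN[OF pg]] by simp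
  ultimately show "\<pi> \<in> {\<pi> \<in> part ` Collect full. (rot_partition (nat N) ^^ nat g) \<pi> = \<pi>}" by simp
next
  fix \<pi> assume "\<pi> \<in> {\<pi> \<in> part ` Collect full. (rot_partition (nat N) ^^ nat g) \<pi> = \<pi>}"
  then obtain u where u: "full u" "\<pi> = part u" and fx: "(rot_partition (nat N) ^^ nat g) (part u) = part u"
    by blast
  have per: "periodic N u" using u by (simp add: full_def)
  have "part (\<lambda>j. u (j + - g)) = part u" using fx rot_part_power[OF per, of "nat g"] g_pos by simp
  then have "rel (\<lambda>j. u (j + - g)) = rel u" by (rule part_eq_iff[OF periodic_shift[OF per] per, THEN iffD1])
  then have "rel u (i + - g) (j + - g) = rel u i j" for i j using rel_shift by metis
  from this[of "_ + g" "_ + g"] have "rel u (i + g) (j + g) \<longleftrightarrow> rel u i j" for i j by simp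
  then obtain v where v: "v \<in> symmetric_words g" "rel v = rel u"
    using symmetric_representative[OF u(1)] by blast
  then have "part v = \<pi>" using u by (simp add: part_def part_rel_def)
  then show "\<pi> \<in> part ` symmetric_words g" using v by blast
qed

text \<open>Each positive letter of the short period accounts for an orbit of \<open>e\<close>
  noncentral blocks; the additional 1 is the central block.\<close>

lemma card_part_symmetric:
  assumes "u \<in> symmetric_words g"
  shows "int (card (part u)) = e * int (support u g) + (if e * int (psum u g) = a then 0 else 1)"
proof -
  have pg: "periodic g u" using assms by (simp add: symmetric_words_def)
  have ps: "int (psum u N) = e * int (psum u g)" and su: "int (support u N) = e * int (support u g)"
    using psum_multiple[OF pg, of e] support_multiple[OF pg, of e] g_pos e_ge N_eq by auto
  from symmetric_cases[OF assms] show ?thesis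
  proof cases
    case 1
    then show ?thesis using ps su card_part_full[OF 1] by (simp add: full_def)
  next
    case 2
    then show ?thesis using ps su card_part_deficient[OF 2] by (simp add: deficient_def)
  qed
qed

end

lemma card_fixed_points:
  assumes "0 < g" "2 \<le> e" "N = int e * int g"
  shows "card {\<pi> \<in> part ` Collect full. card \<pi> = k \<and> (rot_partition (nat N) ^^ g) \<pi> = \<pi>} =
     card {u. periodic (int g) u \<and> int e * int (psum u (int g)) = a \<and> e * support u (int g) = k} +
     card {u. periodic (int g) u \<and> int e * int (psum u (int g)) < a \<and> e * support u (int g) + 1 = k}"
  (is "card ?F = card ?A + card ?B")
proof -
  have A1: "0 < int g" "2 \<le> int e" using assms by auto
  note A = A1 assms(3)
  have "bij_betw part {u \<in> symmetric_words (int g). card (part u) = k}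
     {\<pi> \<in> {\<pi> \<in> part ` Collect full. (rot_partition (nat N) ^^ nat (int g)) \<pi> = \<pi>}. card \<pi> = k}"
    by (rule bij_betw_restrict[OF bij_betw_symmetric[OF A]]) simp
  from bij_betw_same_card[OF this]
  have "card ?F = card {u \<in> symmetric_words (int g). card (part u) = k}"
    by (simp add: conj_commute conj_left_commute)
  also have "{u \<in> symmetric_words (int g). card (part u) = k} = ?A \<union> ?B"
  proof -
    have "u \<in> symmetric_words (int g) \<and> card (part u) = k \<longleftrightarrow> u \<in> ?A \<union> ?B" for u
    proof (cases "u \<in> symmetric_words (int g)")
      case True
      have "periodic (int g) u" using True by (simp add: symmetric_words_def)
      then have ps: "int (psum u N) = int e * int (psum u (int g))"
        using psum_multiple[of "int g" u "int e"] A by simp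
      have "int (card (part u)) = int (e * support u (int g) + (if int e * int (psum u (int g)) = a then 0 else 1))"
        using card_part_symmetric[OF A True] by simp
      then have "card (part u) = e * support u (int g) + (if int e * int (psum u (int g)) = a then 0 else 1)"
        by (simp only: of_nat_eq_iff)
      then show ?thesis using True ps by (auto simp: symmetric_words_def)
    next
      case False
      have "int (psum u N) = int e * int (psum u (int g))" if "periodic (int g) u"
        using psum_multiple[of "int g" u "int e"] that A by simp
      then show ?thesis using False by (auto simp: symmetric_words_def)
    qed
    then show ?thesis by blast
  qed
  also have "card (?A \<union> ?B) = card ?A + card ?B"
  proof (rule card_Un_disjoint)
    have "finite {u. periodic (int g) u \<and> psum u (int g) \<le> nat a}" using finite_words assms by simp
    moreover have "psum u (int g) \<le> nat a" if "int e * int (psum u (int g)) \<le> a" for u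
    proof -
      have "1 * int (psum u (int g)) \<le> int e * int (psum u (int g))"
        using assms by (intro mult_right_mono) auto
      then show ?thesis using that by linarith
    qed
    ultimately show "finite ?A" "finite ?B" by (auto elim!: rev_finite_subset)
  qed auto
  finally show ?thesis .
qed

text \<open>The cycle lemma: among the \<open>b\<close> cyclic shifts of a word of length \<open>b\<close> and sum \<open>a\<close> exactly one
  starts at the minimum of its walk, and that one ends in a \<open>0\<close>, which is dropped.\<close>

definition dyck_words :: "(int \<Rightarrow> nat) set" where
  "dyck_words = {u. full u \<and> root u 0}"

lemma ht_cong: "(\<And>i. 0 \<le> i \<Longrightarrow> i < j \<Longrightarrow> u i = v i) \<Longrightarrow> 0 \<le> j \<Longrightarrow> ht u j = ht v j"
  by (simp add: ht_def)

lemma psum_cong: "(\<And>i. 0 \<le> i \<Longrightarrow> i < n \<Longrightarrow> u i = v i) \<Longrightarrow> psum u n = psum v n"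
  by (simp add: psum_def)

lemma support_cong: "(\<And>i. 0 \<le> i \<Longrightarrow> i < n \<Longrightarrow> u i = v i) \<Longrightarrow> support u n = support v n"
  unfolding support_psum by (rule psum_cong) simp

lemma psum_Suc: "0 \<le> n \<Longrightarrow> psum u (n + 1) = psum u n + u n"
proof -
  assume "0 \<le> n"
  then have "{0..<n + 1} = insert n {0..<n}" by auto
  then show ?thesis by (simp add: psum_def)
qed

text \<open>With period \<open>b\<close> instead of \<open>N\<close> the walk closes up, since
  \<open>b * a - a * b = 0\<close>. Its minimum then exists globally, and all shifts are on an equal
  footing.\<close>

definition cyclic_words :: "nat \<Rightarrow> (int \<Rightarrow> nat) set" where
  "cyclic_words k = {w. periodic b w \<and> support w b = k \<and> psum w b = nat a}"

lemma b_pos: "0 < b" using a_pos a_less by simp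

lemma cyclic_words_ht:
  assumes "w \<in> cyclic_words k" shows "ht w (j + i * b) = ht w j"
  using ht_periodic_mult[of b w j i] assms b_pos a_pos by (simp add: cyclic_words_def)

lemma cyclic_words_ht_mod:
  assumes "w \<in> cyclic_words k" shows "ht w (j mod b) = ht w j"
  using cyclic_words_ht[OF assms, of "j mod b" "j div b"] by simp

lemma card_cyclic_words:
  assumes "0 < k" shows "card (cyclic_words k) = (nat b choose k) * (nat a - 1 choose (k - 1))"
  using card_words_sum_eq[of "nat b" "nat a" k] assms a_pos b_pos by (simp add: cyclic_words_def)

lemma finite_cyclic_words: "finite (cyclic_words k)"
  by (rule finite_subset[OF _ finite_words[of "nat b" "nat a"]])
     (use b_pos in \<open>auto simp: cyclic_words_def\<close>)

lemma support_shift: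
  assumes "periodic n w" "0 \<le> n" shows "support (\<lambda>j. w (j + c)) n = support w n"
proof -
  have "periodic n (\<lambda>j. if 0 < w j then 1 else 0)" using assms by (simp add: periodic_def)
  from psum_shift[OF this assms(2), of c] show ?thesis unfolding support_psum by simp
qed

lemma cyclic_words_shift: "w \<in> cyclic_words k \<Longrightarrow> (\<lambda>j. w (j + c)) \<in> cyclic_words k"
  using psum_shift[of b w c] support_shift[of b w c] periodic_shift[of b w c] b_pos
  by (simp add: cyclic_words_def)

definition lowest_at :: "int \<Rightarrow> (int \<Rightarrow> nat) \<Rightarrow> bool" where
  "lowest_at c w \<longleftrightarrow> (\<forall>j. ht w c \<le> ht w j)"

lemma lowest_at_shift: "lowest_at c (\<lambda>j. w (j + d)) \<longleftrightarrow> lowest_at (c + d) w"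
  unfolding lowest_at_def ht_shift by (simp, metis diff_add_cancel)

lemma card_lowest_at:
  "card {w \<in> cyclic_words k. lowest_at c w} = card {w \<in> cyclic_words k. lowest_at 0 w}"
proof (rule bij_betw_same_card[of "\<lambda>w j. w (j + c)"], rule bij_betwI[of _ _ _ "\<lambda>w j. w (j + - c)"])
  show "(\<lambda>w j. w (j + c)) \<in> {w \<in> cyclic_words k. lowest_at c w} \<rightarrow> {w \<in> cyclic_words k. lowest_at 0 w}"
    using cyclic_words_shift by (simp add: lowest_at_shift)
  show "(\<lambda>w j. w (j + - c)) \<in> {w \<in> cyclic_words k. lowest_at 0 w} \<rightarrow> {w \<in> cyclic_words k. lowest_at c w}"
    using cyclic_words_shift lowest_at_shift[of c _ "- c"] by (auto simp del: add_uminus_conv_diff)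
qed simp_all

lemma cyclic_words_lowest:
  "cyclic_words k = (\<Union>c\<in>{0..<b}. {w \<in> cyclic_words k. lowest_at c w})"
proof -
  have "\<exists>c\<in>{0..<b}. lowest_at c w" if w: "w \<in> cyclic_words k" for w
  proof -
    have "finite (ht w ` {0..<b})" "ht w ` {0..<b} \<noteq> {}" using b_pos by auto
    from ex_min_if_finite[OF this]
    obtain c where c: "c \<in> {0..<b}" and m: "\<And>j. j \<in> {0..<b} \<Longrightarrow> ht w c \<le> ht w j" by force
    have "ht w c \<le> ht w j" for j using m[of "j mod b"] cyclic_words_ht_mod[OF w, of j] b_pos by simp
    then show ?thesis using c unfolding lowest_at_def by blast
  qed
  then show ?thesis by blast
qed

lemma card_cyclic_words_lowest:
  "card (cyclic_words k) = nat b * card {w \<in> cyclic_words k. lowest_at 0 w}"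
proof -
  have "card (cyclic_words k) = card (\<Union>c\<in>{0..<b}. {w \<in> cyclic_words k. lowest_at c w})"
    by (rule arg_cong[OF cyclic_words_lowest])
  also have "\<dots> = (\<Sum>c\<in>{0..<b}. card {w \<in> cyclic_words k. lowest_at c w})"
  proof (rule card_UN_disjoint)
    show "\<forall>c\<in>{0..<b}. \<forall>c'\<in>{0..<b}. c \<noteq> c' \<longrightarrow>
      {w \<in> cyclic_words k. lowest_at c w} \<inter> {w \<in> cyclic_words k. lowest_at c' w} = {}"
    proof (intro ballI impI equals0I)
      fix c c' w assume c: "c \<in> {0..<b}" "c' \<in> {0..<b}" "c \<noteq> c'"
        and "w \<in> {w \<in> cyclic_words k. lowest_at c w} \<inter> {w \<in> cyclic_words k. lowest_at c' w}"
      then have "ht w c = ht w c'" by (simp add: lowest_at_def order_antisym)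
      moreover have "\<bar>c - c'\<bar> < b" using c by (simp add: abs_less_iff)
      ultimately show False using ht_inj c(3) by blast
    qed
  qed (use finite_cyclic_words in auto)
  also have "\<dots> = (\<Sum>c\<in>{0..<b}. card {w \<in> cyclic_words k. lowest_at 0 w})"
    by (rule sum.cong[OF refl card_lowest_at])
  also have "\<dots> = nat b * card {w \<in> cyclic_words k. lowest_at 0 w}" by simp
  finally show ?thesis .
qed

text \<open>The last step of the period ends at height 0 and starts at a height that is not
  negative, whereas a positive letter would make it rise.\<close>

lemma lowest_word_last:
  assumes "w \<in> cyclic_words k" "lowest_at 0 w" shows "w N = 0"
proof (rule ccontr)
  assume "w N \<noteq> 0"
  then have "b * 1 \<le> b * int (w N)" using b_pos by (intro mult_left_mono) auto
  moreover have "ht w (N + 1) = 0"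
    using cyclic_words_ht[OF assms(1), of 0 1] unfolding b_eq[symmetric] by simp
  moreover have "0 \<le> ht w N" using assms(2) unfolding lowest_at_def by (metis ht_0)
  ultimately show False using ht_step[of w N] a_less by simp
qed

lemma support_Suc: "0 \<le> n \<Longrightarrow> support w (n + 1) = support w n + (if 0 < w n then 1 else 0)"
  unfolding support_psum by (rule psum_Suc)

lemma truncate_dyck_word:
  assumes w: "w \<in> cyclic_words k" "lowest_at 0 w"
  shows "(\<lambda>j. w (j mod N)) \<in> dyck_words" "support (\<lambda>j. w (j mod N)) N = k"
proof -
  let ?u = "\<lambda>j. w (j mod N)"
  note last = lowest_word_last[OF w]
  have "support ?u N = support w N" by (rule support_cong) simp
  also have "\<dots> = support w b" using support_Suc[of N w] last N_pos b_eq by simp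
  also have "\<dots> = k" using w by (simp add: cyclic_words_def)
  finally show "support ?u N = k" .
  have "psum ?u N = psum w N" by (rule psum_cong) simp
  also have "\<dots> = psum w b" using psum_Suc[of N w] last N_pos b_eq by simp
  also have "\<dots> = nat a" using w by (simp add: cyclic_words_def)
  finally have full: "full ?u" using a_pos by (simp add: full_def periodic_def)
  have "root ?u 0"
  proof (rule root_if_window[OF full])
    fix j assume j: "0 < j" "j \<le> 0 + N"
    have "ht ?u j = ht w j" by (rule ht_cong) (use j in auto)
    moreover have "ht w 0 \<le> ht w j" using w(2) unfolding lowest_at_def by blast
    moreover have "ht w 0 \<noteq> ht w j" using ht_inj[of w 0 j] j b_eq by auto
    ultimately show "ht ?u 0 < ht ?u j" by simp
  qed
  then show "?u \<in> dyck_words" using full by (simp add: dyck_words_def)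
qed

lemma extend_dyck_word:
  assumes "u \<in> dyck_words" "support u N = k"
  defines "w \<equiv> \<lambda>j. if j mod b = N then 0 else u (j mod b)"
  shows "w \<in> cyclic_words k" "lowest_at 0 w"
proof -
  have small: "w i = u i" if "0 \<le> i" "i < N" for i
    using that b_eq by (simp add: w_def)
  have last: "w N = 0" using N_pos b_eq by (simp add: w_def)
  have "support w b = support w N" using support_Suc[of N w] last N_pos b_eq by simp
  also have "\<dots> = support u N" by (rule support_cong) (rule small)
  finally have s: "support w b = k" using assms(2) by simp
  have "psum w b = psum w N" using psum_Suc[of N w] last N_pos b_eq by simp
  also have "\<dots> = psum u N" by (rule psum_cong) (rule small)
  finally have "psum w b = nat a" using assms(1) by (auto simp: dyck_words_def full_def)
  then show W: "w \<in> cyclic_words k" using s by (simp add: cyclic_words_def periodic_def w_def)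
  have "ht w 0 \<le> ht w j" for j
  proof -
    have m: "0 \<le> j mod b" "j mod b < b" using b_pos by auto
    have "ht w j = ht w (j mod b)" using cyclic_words_ht_mod[OF W, of j] by simp
    also have "\<dots> = ht u (j mod b)"
      by (rule ht_cong) (use m b_eq small in auto)
    finally have e: "ht w j = ht u (j mod b)" .
    show ?thesis
    proof (cases "j mod b = 0")
      case False
      then have "0 < j mod b" using m by simp
      then have "ht u 0 < ht u (j mod b)" using assms(1) by (simp add: dyck_words_def root_def)
      then show ?thesis using e by simp
    qed (use e in simp)
  qed
  then show "lowest_at 0 w" by (simp add: lowest_at_def)
qed

lemma card_dyck_words:
  assumes "0 < k"
  shows "nat b * card {u \<in> dyck_words. support u N = k} = (nat b choose k) * (nat a - 1 choose (k - 1))"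
proof -
  have "card {w \<in> cyclic_words k. lowest_at 0 w} = card {u \<in> dyck_words. support u N = k}"
  proof (rule bij_betw_same_card[of "\<lambda>w j. w (j mod N)"],
      rule bij_betwI[of _ _ _ "\<lambda>u j. if j mod b = N then 0 else u (j mod b)"])
    show "(\<lambda>w j. w (j mod N)) \<in> {w \<in> cyclic_words k. lowest_at 0 w} \<rightarrow> {u \<in> dyck_words. support u N = k}"
      using truncate_dyck_word by blast
    show "(\<lambda>u j. if j mod b = N then 0 else u (j mod b)) \<in>
        {u \<in> dyck_words. support u N = k} \<rightarrow> {w \<in> cyclic_words k. lowest_at 0 w}"
      using extend_dyck_word by blast
    show "(\<lambda>j. if j mod b = N then 0 else w (j mod b mod N)) = w"
      if w: "w \<in> {w \<in> cyclic_words k. lowest_at 0 w}" for w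
    proof
      fix j
      have m: "0 \<le> j mod b" "j mod b < b" using b_pos by auto
      have "periodic b w" using w by (simp add: cyclic_words_def)
      then have "w (j mod b) = w j" by (rule periodic_mod)
      moreover have "w N = 0" using lowest_word_last w by blast
      moreover have "j mod b mod N = j mod b" if "j mod b \<noteq> N"
        by (rule mod_pos_pos_trivial) (use m that b_eq in auto)
      ultimately show "(if j mod b = N then 0 else w (j mod b mod N)) = w j"
        by (cases "j mod b = N") auto
    qed
    show "(\<lambda>j. if j mod N mod b = N then 0 else u (j mod N mod b)) = u"
      if u: "u \<in> {u \<in> dyck_words. support u N = k}" for u
    proof
      fix j
      have m: "0 \<le> j mod N" "j mod N < N" using N_pos by auto
      have "periodic N u" using u by (simp add: dyck_words_def full_def)
      then have "u (j mod N) = u j" by (rule periodic_mod)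
      moreover have "j mod N mod b = j mod N" by (rule mod_pos_pos_trivial) (use m b_eq in auto)
      ultimately show "(if j mod N mod b = N then 0 else u (j mod N mod b)) = u j"
        using m by simp
    qed
  qed
  then show ?thesis using card_cyclic_words[OF assms] card_cyclic_words_lowest by simp
qed

lemma inj_on_dyck_words: "inj_on part dyck_words"
proof
  fix u v assume uv: "u \<in> dyck_words" "v \<in> dyck_words" "part u = part v"
  then have "rel u = rel v" using part_eq_iff[of u v] by (simp add: dyck_words_def full_def)
  then show "u = v" using full_eq[of u 0 v] uv by (simp add: dyck_words_def)
qed

text \<open>Moving the root to 0 does not change the partition, so Dyck words represent the
  partitions of all full words. The latter class is visibly closed under shifts.\<close>

lemma part_dyck_words: "part ` dyck_words = part ` Collect full"
proof
  show "part ` Collect full \<subseteq> part ` dyck_words"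
  proof
    fix \<pi> assume "\<pi> \<in> part ` Collect full"
    then obtain u where u: "full u" "\<pi> = part u" by blast
    obtain v where "full v" "root v 0" "rel v = rel u" using full_reroot[OF u(1)] .
    then show "\<pi> \<in> part ` dyck_words"
      using u by (intro image_eqI[of _ _ v]) (auto simp: dyck_words_def part_def part_rel_def)
  qed
qed (auto simp: dyck_words_def)

lemma card_part_full_eq:
  "card {\<pi> \<in> part ` Collect full. card \<pi> = k} = card {u \<in> dyck_words. support u N = k}"
proof -
  have "bij_betw part dyck_words (part ` Collect full)"
    unfolding bij_betw_def using inj_on_dyck_words part_dyck_words by blast
  then have "bij_betw part {u \<in> dyck_words. support u N = k} {\<pi> \<in> part ` Collect full. card \<pi> = k}"
    by (rule bij_betw_restrict) (simp add: dyck_words_def card_part_full)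
  from bij_betw_same_card[OF this] show ?thesis by (rule sym)
qed

end

section \<open>Gaussian polynomials\<close>

definition qpoly :: "nat \<Rightarrow> int poly" where
  "qpoly n = (\<Sum>i<n. [:0, 1:] ^ i)"

definition qfact_poly :: "nat \<Rightarrow> int poly" where
  "qfact_poly n = (\<Prod>i=1..n. qpoly i)"

fun gauss :: "nat \<Rightarrow> nat \<Rightarrow> int poly" where
  "gauss n 0 = 1"
| "gauss 0 (Suc m) = 0"
| "gauss (Suc n) (Suc m) = gauss n m + [:0, 1:] ^ Suc m * gauss n (Suc m)"

lemma gauss_eq_0: "n < m \<Longrightarrow> gauss n m = 0"
  by (induction n m rule: gauss.induct) auto

lemma gauss_self: "gauss n n = 1"
  by (induction n) (simp_all add: gauss_eq_0)

lemma qpoly_0 [simp]: "qpoly 0 = 0" and qpoly_Suc: "qpoly (Suc n) = qpoly n + [:0, 1:] ^ n"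
  by (simp_all add: qpoly_def)

lemma qpoly_add: "qpoly (m + n) = qpoly m + [:0, 1:] ^ m * qpoly n"
  by (induction n) (simp_all add: qpoly_Suc algebra_simps power_add)

lemma qfact_poly_Suc: "qfact_poly (Suc n) = qfact_poly n * qpoly (Suc n)"
  by (simp add: qfact_poly_def)

lemma qfact_poly_0 [simp]: "qfact_poly 0 = 1" by (simp add: qfact_poly_def)

lemma gauss_qfact: "m \<le> n \<Longrightarrow> qfact_poly m * qfact_poly (n - m) * gauss n m = qfact_poly n"
proof (induction n m rule: gauss.induct)
  case (3 n m)
  show ?case
  proof (cases "m = n")
    case True
    then show ?thesis using 3 by (auto simp: gauss_eq_0 qfact_poly_Suc)
  next
    case False
    then have mn: "Suc m \<le> n" using 3 by simp
    then have s: "n - m = Suc (n - Suc m)" by simp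
    have "qfact_poly (Suc m) * qfact_poly (n - m) * gauss (Suc n) (Suc m)
      = qpoly (Suc m) * (qfact_poly m * qfact_poly (n - m) * gauss n m)
        + [:0, 1:] ^ Suc m * qpoly (n - m) * (qfact_poly (Suc m) * qfact_poly (n - Suc m) * gauss n (Suc m))"
      unfolding s by (simp add: qfact_poly_Suc algebra_simps)
    also have "\<dots> = qfact_poly n * (qpoly (Suc m) + [:0, 1:] ^ Suc m * qpoly (n - m))"
      using 3 mn by (simp add: algebra_simps)
    also have "qpoly (Suc m) + [:0, 1:] ^ Suc m * qpoly (n - m) = qpoly (Suc n)"
      using qpoly_add[of "Suc m" "n - m"] 3 by simp
    finally show ?thesis by (simp add: qfact_poly_Suc)
  qed
qed auto

lemma coeff_qpoly: "coeff (qpoly n) i = (if i < n then 1 else 0)"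
proof -
  have "[:0, 1::int:] ^ i = monom 1 i" for i by (simp add: monom_altdef)
  then show ?thesis by (simp add: qpoly_def coeff_sum if_distrib sum.delta' cong: if_cong)
qed

lemma qpoly_nonzero: "0 < n \<Longrightarrow> qpoly n \<noteq> 0"
  using coeff_qpoly[of n 0] by auto

lemma qfact_poly_nonzero: "qfact_poly n \<noteq> 0"
  by (simp add: qfact_poly_def qpoly_nonzero)

lemma to_fract_power: "to_fract (p ^ n) = to_fract p ^ n"
  by (induction n) auto

lemma to_fract_sum: "to_fract (sum f A) = (\<Sum>i\<in>A. to_fract (f i))"
  by (induction A rule: infinite_finite_induct) auto

lemma to_fract_prod: "to_fract (prod f A) = (\<Prod>i\<in>A. to_fract (f i))"
  by (induction A rule: infinite_finite_induct) auto

lemma q_int_eq: "q_int n = to_fract (qpoly n)"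
  by (simp add: q_int_def qpoly_def to_fract_sum to_fract_power)

lemma q_fact_eq: "q_fact n = to_fract (qfact_poly n)"
  by (simp add: q_fact_def qfact_poly_def to_fract_prod q_int_eq)

lemma q_binomial_eq:
  assumes "m \<le> n" shows "q_binomial n m = to_fract (gauss n m)"
proof -
  have "to_fract (qfact_poly m) * to_fract (qfact_poly (n - m)) * to_fract (gauss n m) = to_fract (qfact_poly n)"
    using gauss_qfact[OF assms] by (metis to_fract_mult)
  moreover have "to_fract (qfact_poly m) \<noteq> 0" "to_fract (qfact_poly (n - m)) \<noteq> 0"
    using qfact_poly_nonzero by simp_all
  ultimately show ?thesis unfolding q_binomial_def q_fact_eq by (simp add: field_simps)
qed

lemma gauss_absorb:
  assumes "m \<le> n" shows "qpoly (Suc m) * gauss (Suc n) (Suc m) = qpoly (Suc n) * gauss n m"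
proof -
  let ?c = "qfact_poly m * qfact_poly (n - m)"
  have "?c * (qpoly (Suc m) * gauss (Suc n) (Suc m)) = qfact_poly (Suc n)"
    using gauss_qfact[of "Suc m" "Suc n"] assms by (simp add: qfact_poly_Suc algebra_simps)
  also have "\<dots> = ?c * (qpoly (Suc n) * gauss n m)"
    using gauss_qfact[OF assms] by (simp add: qfact_poly_Suc algebra_simps)
  finally show ?thesis using qfact_poly_nonzero by simp
qed

text \<open>Euclid's algorithm by subtraction lifts to polynomials through
  \<open>[n] = [n - m] + q^(n - m) [m]\<close>.\<close>

lemma qpoly_bezout:
  "coprime m n \<Longrightarrow> \<exists>u v. u * qpoly m + v * qpoly n = 1"
proof (induction "m + n" arbitrary: m n rule: less_induct)
  case less
  have main: "\<exists>u v. u * qpoly m + v * qpoly n = 1" if cp: "coprime m n" and le: "m \<le> n"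
    and IH: "\<And>m' n'. m' + n' < m + n \<Longrightarrow> coprime m' n' \<Longrightarrow> \<exists>u v. u * qpoly m' + v * qpoly n' = 1" for m n :: nat
  proof (cases "m = 0")
    case True
    then have "n = 1" using cp by simp
    then have "0 * qpoly m + 1 * qpoly n = 1" by (simp add: qpoly_def)
    then show ?thesis by blast
  next
    case False
    have "coprime m (n - m)" using cp le by (metis coprime_iff_gcd_eq_1 gcd.commute gcd_diff1_nat)
    then obtain u v where uv: "u * qpoly m + v * qpoly (n - m) = 1"
      using IH[of m "n - m"] False le by auto
    have q: "qpoly n = qpoly (n - m) + [:0, 1:] ^ (n - m) * qpoly m"
      using qpoly_add[of "n - m" m] le by simp
    have "(u - v * [:0, 1:] ^ (n - m)) * qpoly m + v * qpoly n = 1"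
      unfolding q using uv by (simp add: algebra_simps)
    then show ?thesis by blast
  qed
  show ?case
  proof (cases "m \<le> n")
    case True
    then show ?thesis using main[OF less.prems True] less.hyps by blast
  next
    case False
    have "\<exists>u v. u * qpoly n + v * qpoly m = 1"
      by (rule main[of n m]) (use False less in \<open>auto simp: coprime_commute add.commute\<close>)
    then show ?thesis by (metis add.commute)
  qed
qed

text \<open>Absorption in the first Gaussian factor trades \<open>[a]\<close> for
  \<open>[k]\<close>, and absorption in the second trades \<open>[k]\<close> for \<open>[b]\<close>;
  so both \<open>[a]\<close> and \<open>[b]\<close> times the fraction are polynomials.\<close>

lemma narayana_poly_ex:
  assumes "0 < a" "a < b" "coprime a b" "1 \<le> k" "k \<le> a"
  obtains p where "to_fract p = q_narayana a b k"
    "qpoly b * p = gauss b k * gauss (a - 1) (k - 1)"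
proof -
  let ?P = "q_narayana a b k"
  obtain k' where k': "k = Suc k'" using assms by (cases k) auto
  obtain a' where a': "a = Suc a'" using assms by (cases a) auto
  obtain b' where b': "b = Suc b'" using assms by (cases b) auto
  have P: "?P = 1 / to_fract (qpoly a) * to_fract (gauss a k) * to_fract (gauss b' k')"
    using q_binomial_eq[of k a] q_binomial_eq[of k' b'] assms
    by (simp add: q_narayana_def q_int_eq k' b')
  have nz: "to_fract (qpoly a) \<noteq> 0" "to_fract (qpoly k) \<noteq> 0" using qpoly_nonzero assms by simp_all
  have Pa: "to_fract (qpoly a) * ?P = to_fract (gauss a k * gauss b' k')"
    using nz by (simp add: P)
  have "to_fract (qpoly k) * to_fract (gauss a k) = to_fract (qpoly a) * to_fract (gauss a' k')"
    using gauss_absorb[of k' a'] assms unfolding k' a' by (metis Suc_le_mono to_fract_mult)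
  then have Pk: "to_fract (qpoly k) * ?P = to_fract (gauss a' k' * gauss b' k')"
    using nz by (simp add: P field_simps)
  have "to_fract (qpoly k) * to_fract (gauss b k) = to_fract (qpoly b) * to_fract (gauss b' k')"
    using gauss_absorb[of k' b'] assms unfolding k' b' by (metis Suc_le_mono le_trans less_imp_le to_fract_mult)
  then have "to_fract (qpoly k) * (to_fract (qpoly b) * ?P) = to_fract (qpoly k) * to_fract (gauss b k * gauss a' k')"
    using Pk by (simp add: algebra_simps)
  then have Pb: "to_fract (qpoly b) * ?P = to_fract (gauss b k * gauss a' k')" using nz by simp
  obtain u v where "u * qpoly a + v * qpoly b = 1" using qpoly_bezout[OF assms(3)] by blast
  then have one: "to_fract u * to_fract (qpoly a) + to_fract v * to_fract (qpoly b) = 1"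
    by (metis to_fract_1 to_fract_add to_fract_mult)
  define p where "p = u * (gauss a k * gauss b' k') + v * (gauss b k * gauss a' k')"
  have "to_fract p = to_fract u * (to_fract (qpoly a) * ?P) + to_fract v * (to_fract (qpoly b) * ?P)"
    unfolding Pa Pb p_def by simp
  also have "\<dots> = (to_fract u * to_fract (qpoly a) + to_fract v * to_fract (qpoly b)) * ?P"
    by (simp add: algebra_simps)
  finally have p: "to_fract p = ?P" using one by simp
  then have "to_fract (qpoly b * p) = to_fract (gauss b k * gauss a' k')" using Pb by simp
  then have "qpoly b * p = gauss b k * gauss (a - 1) (k - 1)"
    using k' a' by (simp only: to_fract_eq_iff diff_Suc_1)
  then show ?thesis using that p by blast
qed


section \<open>Values at roots of unity and the q-Lucas theorem\<close>

definition ev :: "complex \<Rightarrow> int poly \<Rightarrow> complex" where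
  "ev z p = poly (map_poly of_int p) z"

lemma ev_simps [simp]:
  "ev z (p + r) = ev z p + ev z r" "ev z (p * r) = ev z p * ev z r" "ev z 0 = 0" "ev z 1 = 1"
  "ev z [:1:] = 1" "ev z [:0, 1:] = z" "ev z (p ^ n) = ev z p ^ n" "ev z (pCons 0 p) = z * ev z p"
proof -
  have "map_poly of_int (p + r) = (map_poly of_int p + map_poly of_int r :: complex poly)"
    by (rule poly_eqI) (simp add: coeff_map_poly)
  then show "ev z (p + r) = ev z p + ev z r" by (simp add: ev_def)
  have "map_poly of_int (p * r) = (map_poly of_int p * map_poly of_int r :: complex poly)" for p r
    by (rule poly_eqI) (simp add: coeff_map_poly coeff_mult)
  then show m: "ev z (p * r) = ev z p * ev z r" for p r by (simp add: ev_def)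
  show "ev z (pCons 0 p) = z * ev z p" by (simp add: ev_def map_poly_pCons)
  show o: "ev z 1 = 1" by (simp add: ev_def)
  show "ev z 0 = 0" by (simp add: ev_def)
  show "ev z [:1:] = 1" by (simp add: ev_def map_poly_pCons)
  show "ev z [:0, 1:] = z" by (simp add: ev_def map_poly_pCons)
  show "ev z (p ^ n) = ev z p ^ n" by (induction n) (simp_all add: m o)
qed

lemma ev_qpoly: "ev z (qpoly n) = (\<Sum>i<n. z ^ i)"
  by (induction n) (simp_all add: qpoly_Suc)

lemma ev_gauss_1: "ev 1 (gauss n m) = of_nat (n choose m)"
  by (induction n m rule: gauss.induct) simp_all

context
  fixes z :: complex and e :: nat
  assumes e: "2 \<le> e" and z: "primitive_unity_root e z"
begin

lemma z_neq_1: "z \<noteq> 1" using z e unfolding primitive_unity_root_def by (metis One_nat_def Suc_1 Suc_le_eq power_one_right zero_less_Suc)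

lemma z_power: "z ^ e = 1" using z by (simp add: primitive_unity_root_def)

lemma ev_qpoly_root: "ev z (qpoly n) = (z ^ n - 1) / (z - 1)"
  using z_neq_1 by (simp add: ev_qpoly geometric_sum)

text \<open>In the absorption identity \<open>[e]\<close> vanishes at \<open>z\<close>, while
  \<open>[m]\<close> does not.\<close>

lemma ev_gauss_period: "0 < m \<Longrightarrow> m < e \<Longrightarrow> ev z (gauss e m) = 0"
proof -
  assume m: "0 < m" "m < e"
  then obtain m' e' where s: "m = Suc m'" "e = Suc e'" using e by (metis Suc_pred less_trans)
  have "ev z (qpoly m) * ev z (gauss e m) = ev z (qpoly e) * ev z (gauss e' m')"
    using gauss_absorb[of m' e'] m unfolding s by (metis Suc_less_SucD ev_simps(2) less_imp_le)
  also have "ev z (qpoly e) = 0" by (simp add: ev_qpoly_root z_power)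
  finally show ?thesis
    using m z z_neq_1 by (simp add: ev_qpoly_root primitive_unity_root_def)
qed

text \<open>Row \<open>e\<close> has only its two outer entries left at \<open>z\<close>. Since
  \<open>z ^ e = 1\<close>, Pascal's rule has the same coefficients in both columns \<open>m\<close>
  and \<open>m - e\<close>, so the sum of two copies propagates through all later rows.\<close>

lemma ev_gauss_add:
  "ev z (gauss (n + e) m) = ev z (gauss n m) + (if e \<le> m then ev z (gauss n (m - e)) else 0)"
proof (induction n arbitrary: m)
  case 0
  consider "m = 0" | "0 < m" "m < e" | "m = e" | "e < m" by linarith
  then show ?case
  proof cases
    case 2
    then obtain m' where "m = Suc m'" by (cases m) auto
    then show ?thesis using 2 ev_gauss_period by simp
  next
    case 3
    then obtain m' where "m = Suc m'" using e by (cases m) auto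
    then show ?thesis using 3 by (simp add: gauss_self)
  next
    case 4
    then obtain m' where "m - e = Suc m'" "m = Suc (m' + e)" by (metis Suc_diff_Suc add_diff_inverse_nat add.commute diff_Suc_Suc less_imp_Suc_add not_less_iff_gr_or_eq add_Suc_right add_diff_cancel_left')
    then show ?thesis using 4 gauss_eq_0[of e m] by simp
  qed (use e in simp)
next
  case (Suc n)
  show ?case
  proof (cases m)
    case 0
    then show ?thesis using e by simp
  next
    case (Suc m')
    have "ev z (gauss (Suc n + e) m) = ev z (gauss (n + e) m') + z ^ Suc m' * ev z (gauss (n + e) (Suc m'))"
      by (simp add: Suc)
    also have "\<dots> = ev z (gauss n m') + (if e \<le> m' then ev z (gauss n (m' - e)) else 0)
       + z ^ Suc m' * (ev z (gauss n (Suc m')) + (if e \<le> Suc m' then ev z (gauss n (Suc m' - e)) else 0))"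
      by (simp only: Suc.IH)
    also have "\<dots> = ev z (gauss (Suc n) m) + (if e \<le> m then ev z (gauss (Suc n) (m - e)) else 0)"
    proof -
      consider "Suc m' < e" | "Suc m' = e" | "e \<le> m'" by linarith
      then show ?thesis
      proof cases
        case 2
        then have "z ^ Suc m' = 1" using z_power by simp
        then show ?thesis unfolding Suc 2[symmetric] by (simp del: power_Suc)
      next
        case 3
        then obtain t where t: "m' = e + t" using le_Suc_ex by blast
        have "z ^ Suc m' = z ^ Suc t" by (simp add: t power_add z_power)
        moreover have "Suc m' - e = Suc t" "m' - e = t" using t by auto
        ultimately show ?thesis using 3 Suc by (simp del: power_Suc add: algebra_simps)
      qed (simp add: Suc)
    qed
    finally show ?thesis .
  qed
qed

lemma ev_gauss_lucas:
  "ev z (gauss n m) = of_nat (n div e choose (m div e)) * ev z (gauss (n mod e) (m mod e))"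
proof (induction n arbitrary: m rule: less_induct)
  case (less n)
  show ?case
  proof (cases "n < e")
    case True
    show ?thesis
    proof (cases "m < e")
      case False
      then have "ev z (gauss n m) = 0" using True gauss_eq_0[of n m] by simp
      moreover have "0 < m div e" using False e by (simp add: div_greater_zero_iff)
      ultimately show ?thesis using True by (simp add: binomial_eq_0)
    qed (use True in simp)
  next
    case False
    define n' where "n' = n - e"
    have n: "n = n' + e" "n' < n" using False e by (auto simp: n'_def)
    have d: "n div e = Suc (n' div e)" "n mod e = n' mod e" using n(1) e by auto
    show ?thesis
    proof (cases "e \<le> m")
      case True
      define m' where "m' = m - e"
      have m: "m = m' + e" using True by (simp add: m'_def)
      have dm: "m div e = Suc (m' div e)" "m mod e = m' mod e" using m e by auto
      show ?thesis
        using ev_gauss_add[of n' m] True less.IH[OF n(2), of m] less.IH[OF n(2), of m']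
        unfolding d dm unfolding n(1)[symmetric] by (simp add: m'_def[symmetric] dm algebra_simps)
    next
      case False
      then show ?thesis
        using ev_gauss_add[of n' m] less.IH[OF n(2), of m]
        unfolding d unfolding n(1)[symmetric] by simp
    qed
  qed
qed

end

section \<open>Unimodality\<close>

text \<open>A homogeneous system with fewer equations than unknowns: one equation with a nonzero
  coefficient is used to eliminate one unknown.\<close>

lemma kernel_ex:
  fixes M :: "'b \<Rightarrow> 'a \<Rightarrow> real"
  assumes "finite B" "finite A" "card B < card A"
  shows "\<exists>x. (\<exists>i\<in>A. x i \<noteq> 0) \<and> (\<forall>j\<in>B. (\<Sum>i\<in>A. M j i * x i) = 0)"
  using assms
proof (induction B arbitrary: A M rule: finite_induct)
  case empty
  then obtain i where "i \<in> A" by fastforce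
  then show ?case by (intro exI[of _ "\<lambda>_. 1"]) auto
next
  case (insert b B)
  show ?case
  proof (cases "\<forall>i\<in>A. M b i = 0")
    case True
    have "card B < card A" using insert by simp
    then obtain x where "\<exists>i\<in>A. x i \<noteq> 0" "\<forall>j\<in>B. (\<Sum>i\<in>A. M j i * x i) = 0"
      using insert.IH[OF insert.prems(1)] by blast
    moreover have "(\<Sum>i\<in>A. M b i * x i) = 0" using True by simp
    ultimately show ?thesis by blast
  next
    case False
    then obtain p where p: "p \<in> A" "M b p \<noteq> 0" by blast
    let ?A = "A - {p}" and ?M = "\<lambda>j i. M j i - M j p / M b p * M b i"
    have "card B < card ?A" "finite ?A" using insert p by auto
    from insert.IH[OF this(2,1), of ?M] obtain x
      where x: "\<exists>i\<in>?A. x i \<noteq> 0" "\<forall>j\<in>B. (\<Sum>i\<in>?A. ?M j i * x i) = 0" by blast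
    define y where "y = x(p := - (\<Sum>i\<in>?A. M b i * x i) / M b p)"
    have s: "(\<Sum>i\<in>A. M j i * y i) = M j p * y p + (\<Sum>i\<in>?A. M j i * x i)" for j
      using p insert.prems(1) by (subst sum.remove[of A p]) (auto simp: y_def intro!: sum.cong)
    have "(\<Sum>i\<in>A. M b i * y i) = 0" unfolding s using p by (simp add: y_def)
    moreover have "(\<Sum>i\<in>A. M j i * y i) = 0" if "j \<in> B" for j
    proof -
      have "(\<Sum>i\<in>?A. ?M j i * x i) = (\<Sum>i\<in>?A. M j i * x i) - M j p / M b p * (\<Sum>i\<in>?A. M b i * x i)"
        by (simp add: left_diff_distrib sum_subtractf sum_distrib_left mult.assoc)
      then show ?thesis unfolding s using x(2) that by (simp add: y_def)
    qed
    moreover have "\<exists>i\<in>A. y i \<noteq> 0" using x(1) by (auto simp: y_def)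
    ultimately show ?thesis by blast
  qed
qed

text \<open>Moving one element of a subset of a chain up or down by one step gives operators whose weighted
  sums satisfy \<open>\<parallel>Fx\<parallel>\<^sup>2 - \<parallel>F\<^sup>*x\<parallel>\<^sup>2 = \<Sum>\<lambda>(T) x(T)\<^sup>2\<close>. When \<open>\<lambda> > 0\<close>, the operator \<open>F\<close> is injective, which
  compares the sizes of two adjacent levels.\<close>

definition up :: "nat \<Rightarrow> (nat set \<Rightarrow> real) \<Rightarrow> nat set \<Rightarrow> real" where
  "up t x T = (if Suc t \<in> T \<and> t \<notin> T then x (insert t (T - {Suc t})) else 0)"

definition down :: "nat \<Rightarrow> (nat set \<Rightarrow> real) \<Rightarrow> nat set \<Rightarrow> real" where
  "down t x T = (if t \<in> T \<and> Suc t \<notin> T then x (insert (Suc t) (T - {t})) else 0)"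

lemma up_down_adjoint:
  assumes "Suc t < n"
  shows "(\<Sum>T\<in>Pow {..<n}. up t x T * y T) = (\<Sum>T\<in>Pow {..<n}. x T * down t y T)"
proof -
  let ?A = "{T \<in> Pow {..<n}. Suc t \<in> T \<and> t \<notin> T}" and ?B = "{T \<in> Pow {..<n}. t \<in> T \<and> Suc t \<notin> T}"
  have "(\<Sum>T\<in>Pow {..<n}. up t x T * y T) = (\<Sum>T\<in>?A. x (insert t (T - {Suc t})) * y T)"
    by (rule sum.mono_neutral_cong_right) (auto simp: up_def)
  also have "\<dots> = (\<Sum>T\<in>?B. x T * y (insert (Suc t) (T - {t})))"
    by (rule sum.reindex_bij_witness[of _ "\<lambda>T. insert (Suc t) (T - {t})" "\<lambda>T. insert t (T - {Suc t})"])
       (use assms in \<open>auto simp: insert_absorb insert_Diff_if\<close>)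
  also have "\<dots> = (\<Sum>T\<in>Pow {..<n}. x T * down t y T)"
    by (rule sum.mono_neutral_cong_left) (auto simp: down_def)
  finally show ?thesis .
qed

text \<open>For adjacent \<open>s\<close> and \<open>t\<close> both sides vanish, because either
  move destroys the configuration that the other one requires.\<close>

lemma down_up_commute:
  assumes "s \<noteq> t" shows "down s (up t x) T = up t (down s x) T"
proof -
  have "insert t (insert (Suc s) (T - {s}) - {Suc t}) = insert (Suc s) (insert t (T - {Suc t}) - {s})"
    if "s \<noteq> t" using that by auto
  then show ?thesis using assms by (auto simp: up_def down_def)
qed

text \<open>Each composition restores \<open>T\<close> when exactly one of \<open>t\<close>,
  \<open>Suc t\<close> is occupied, namely \<open>t\<close> for the first and \<open>Suc t\<close>
  for the second. The commutator is therefore diagonal.\<close>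

lemma down_up_same: "down t (up t x) T - up t (down t x) T = ((if t \<in> T then 1 else 0) - (if Suc t \<in> T then 1 else 0)) * x T"
proof -
  have "insert t (insert (Suc t) (T - {t}) - {Suc t}) = T" if "t \<in> T" "Suc t \<notin> T" using that by auto
  moreover have "insert (Suc t) (insert t (T - {Suc t}) - {t}) = T" if "t \<notin> T" "Suc t \<in> T" using that by auto
  ultimately show ?thesis by (auto simp: up_def down_def)
qed

text \<open>Expanding the squares and passing to adjoints leaves the commutators of single moves,
  and only those with equal index survive.\<close>

lemma up_down_norm:
  fixes c :: "nat \<Rightarrow> real"
  shows "(\<Sum>T\<in>Pow {..<n}. (\<Sum>t<n - 1. c t * up t x T)\<^sup>2) - (\<Sum>T\<in>Pow {..<n}. (\<Sum>t<n - 1. c t * down t x T)\<^sup>2)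
    = (\<Sum>T\<in>Pow {..<n}. (\<Sum>t<n - 1. (c t)\<^sup>2 * ((if t \<in> T then 1 else 0) - (if Suc t \<in> T then 1 else 0))) * (x T)\<^sup>2)"
proof -
  let ?P = "Pow {..<n}" and ?J = "{..<n - 1}"
  define \<phi> where "\<phi> y z = (\<Sum>T\<in>?P. y T * z T)" for y z :: "nat set \<Rightarrow> real"
  have sq: "(\<Sum>T\<in>?P. (\<Sum>t\<in>?J. c t * f t T)\<^sup>2) = (\<Sum>s\<in>?J. \<Sum>t\<in>?J. c s * c t * \<phi> (f s) (f t))" for f
  proof -
    have "(\<Sum>T\<in>?P. (\<Sum>t\<in>?J. c t * f t T)\<^sup>2) = (\<Sum>T\<in>?P. \<Sum>s\<in>?J. \<Sum>t\<in>?J. c s * c t * (f s T * f t T))"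
      by (rule sum.cong) (auto simp: power2_eq_square sum_product intro!: sum.cong)
    also have "\<dots> = (\<Sum>s\<in>?J. \<Sum>T\<in>?P. \<Sum>t\<in>?J. c s * c t * (f s T * f t T))" by (rule sum.swap)
    also have "\<dots> = (\<Sum>s\<in>?J. \<Sum>t\<in>?J. \<Sum>T\<in>?P. c s * c t * (f s T * f t T))"
      by (rule sum.cong[OF refl]) (rule sum.swap)
    finally show ?thesis by (simp add: \<phi>_def sum_distrib_left)
  qed
  have u: "\<phi> (up s x) (up t x) = \<phi> x (down s (up t x))" if "s \<in> ?J" for s t
    using up_down_adjoint[of s n x "up t x"] that by (simp add: \<phi>_def)
  have comm: "\<phi> y z = \<phi> z y" for y z by (simp add: \<phi>_def mult.commute)
  have d: "\<phi> (down s x) (down t x) = \<phi> x (up t (down s x))" if "t \<in> ?J" for s t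
    using up_down_adjoint[of t n "down s x" x] that comm by (simp add: \<phi>_def)
  have "(\<Sum>T\<in>?P. (\<Sum>t\<in>?J. c t * up t x T)\<^sup>2) - (\<Sum>T\<in>?P. (\<Sum>t\<in>?J. c t * down t x T)\<^sup>2)
    = (\<Sum>s\<in>?J. \<Sum>t\<in>?J. c s * c t * (\<phi> x (down s (up t x)) - \<phi> x (up t (down s x))))"
    unfolding sq by (simp add: u d sum_subtractf algebra_simps)
  also have "\<dots> = (\<Sum>s\<in>?J. \<Sum>t\<in>?J. if t = s then (c t)\<^sup>2 * (\<phi> x (down t (up t x)) - \<phi> x (up t (down t x))) else 0)"
  proof (intro sum.cong refl)
    fix s t
    have "down s (up t x) = up t (down s x)" if "s \<noteq> t" using down_up_commute[OF that] by blast
    then show "c s * c t * (\<phi> x (down s (up t x)) - \<phi> x (up t (down s x))) =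
       (if t = s then (c t)\<^sup>2 * (\<phi> x (down t (up t x)) - \<phi> x (up t (down t x))) else 0)"
      by (auto simp: power2_eq_square)
  qed
  also have "\<dots> = (\<Sum>s\<in>?J. (c s)\<^sup>2 * (\<phi> x (down s (up s x)) - \<phi> x (up s (down s x))))"
    by (simp add: sum.delta)
  also have "\<dots> = (\<Sum>s\<in>?J. \<Sum>T\<in>?P. (c s)\<^sup>2 * ((if s \<in> T then 1 else 0) - (if Suc s \<in> T then 1 else 0)) * (x T)\<^sup>2)"
  proof (rule sum.cong[OF refl])
    fix s
    have "\<phi> x (down s (up s x)) - \<phi> x (up s (down s x)) = (\<Sum>T\<in>?P. x T * (down s (up s x) T - up s (down s x) T))"
      by (simp add: \<phi>_def sum_subtractf right_diff_distrib)
    also have "\<dots> = (\<Sum>T\<in>?P. ((if s \<in> T then 1 else 0) - (if Suc s \<in> T then 1 else 0)) * (x T)\<^sup>2)"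
      unfolding down_up_same by (simp add: power2_eq_square mult.left_commute)
    finally show "(c s)\<^sup>2 * (\<phi> x (down s (up s x)) - \<phi> x (up s (down s x))) =
       (\<Sum>T\<in>?P. (c s)\<^sup>2 * ((if s \<in> T then 1 else 0) - (if Suc s \<in> T then 1 else 0)) * (x T)\<^sup>2)"
      by (simp add: sum_distrib_left mult.assoc)
  qed
  also have "\<dots> = (\<Sum>T\<in>?P. \<Sum>s\<in>?J. (c s)\<^sup>2 * ((if s \<in> T then 1 else 0) - (if Suc s \<in> T then 1 else 0)) * (x T)\<^sup>2)"
    by (rule sum.swap)
  finally show ?thesis by (simp add: sum_distrib_right)
qed

text \<open>A pair of subsets of \<open>{..<n1}\<close> and \<open>{..<n2}\<close> is encoded as one subset of \<open>{..<n1 + n2}\<close>; the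
  weights \<open>step_weight\<close> are the squared matrix entries of the representation of \<open>sl\<^sub>2\<close> on the two chains,
  and vanish at the junction.\<close>

definition pos_weight :: "nat \<Rightarrow> nat \<Rightarrow> nat" where
  "pos_weight n1 t = (if t < n1 then t else t - n1)"

definition step_weight :: "nat \<Rightarrow> nat \<Rightarrow> nat \<Rightarrow> nat" where
  "step_weight n1 n2 t = (if t < n1 then (t + 1) * (n1 - 1 - t) else (t - n1 + 1) * (n1 + n2 - 1 - t))"

definition level :: "nat \<Rightarrow> nat \<Rightarrow> nat \<Rightarrow> nat \<Rightarrow> nat \<Rightarrow> nat set set" where
  "level n1 m1 n2 m2 j = {T \<in> Pow {..<n1 + n2}. card (T \<inter> {..<n1}) = m1 \<and> card (T - {..<n1}) = m2 \<and>
      (\<Sum>t\<in>T. pos_weight n1 t) = j}"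

lemma finite_level: "finite (level n1 m1 n2 m2 j)"
  by (simp add: level_def)

lemma card_exchange:
  assumes "finite X" "s \<in> X" "t \<notin> X" shows "card (insert t (X - {s})) = card X"
proof -
  have "card (insert t (X - {s})) = Suc (card (X - {s}))" using assms by (intro card_insert_disjoint) auto
  then show ?thesis using card_Suc_Diff1[OF assms(1,2)] by (rule trans)
qed

lemma level_move_iff:
  assumes "t \<notin> T" "Suc t \<in> T" "step_weight n1 n2 t \<noteq> 0" "T \<subseteq> {..<n1 + n2}"
  shows "T \<in> level n1 m1 n2 m2 (Suc j) \<longleftrightarrow> insert t (T - {Suc t}) \<in> level n1 m1 n2 m2 j"
proof -
  let ?S = "insert t (T - {Suc t})"
  have fin: "finite T" using finite_subset[OF assms(4)] by simp
  have "Suc t \<noteq> n1" using assms(3) unfolding step_weight_def by auto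
  then have side: "t < n1 \<longleftrightarrow> Suc t < n1" by linarith
  have sub: "?S \<subseteq> {..<n1 + n2}" using assms by auto
  have c1: "card (?S \<inter> {..<n1}) = card (T \<inter> {..<n1})"
  proof (cases "t < n1")
    case True
    then have e: "?S \<inter> {..<n1} = insert t ((T \<inter> {..<n1}) - {Suc t})" by auto
    show ?thesis unfolding e by (rule card_exchange) (use True side assms fin in auto)
  next
    case False
    then have "?S \<inter> {..<n1} = T \<inter> {..<n1}" using side by auto
    then show ?thesis by simp
  qed
  have c2: "card (?S - {..<n1}) = card (T - {..<n1})"
  proof (cases "t < n1")
    case True
    then have "?S - {..<n1} = T - {..<n1}" using side by auto
    then show ?thesis by simp
  next
    case False
    then have e: "?S - {..<n1} = insert t ((T - {..<n1}) - {Suc t})" by auto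
    show ?thesis unfolding e by (rule card_exchange) (use False side assms fin in auto)
  qed
  have "(\<Sum>i\<in>T. pos_weight n1 i) = pos_weight n1 (Suc t) + (\<Sum>i\<in>T - {Suc t}. pos_weight n1 i)"
    by (rule sum.remove[OF fin assms(2)])
  moreover have "(\<Sum>i\<in>?S. pos_weight n1 i) = pos_weight n1 t + (\<Sum>i\<in>T - {Suc t}. pos_weight n1 i)"
    using fin assms by simp
  moreover have "pos_weight n1 (Suc t) = Suc (pos_weight n1 t)" using side by (auto simp: pos_weight_def)
  ultimately have "(\<Sum>i\<in>T. pos_weight n1 i) = Suc (\<Sum>i\<in>?S. pos_weight n1 i)" by linarith
  then have "(\<Sum>i\<in>T. pos_weight n1 i) = Suc j \<longleftrightarrow> (\<Sum>i\<in>?S. pos_weight n1 i) = j" by linarith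
  then show ?thesis unfolding level_def mem_Collect_eq Pow_iff c1 c2 using sub assms(4) by blast
qed

text \<open>Summation by parts: on a chain of length \<open>n\<close> consecutive weights differ by
  \<open>n - 1 - 2 * t\<close>, and they vanish at the ends of both chains, so no boundary terms
  remain.\<close>

lemma step_weight_sum:
  assumes "T \<subseteq> {..<n1 + n2}" "card (T \<inter> {..<n1}) = m1" "card (T - {..<n1}) = m2"
  shows "(\<Sum>t<n1 + n2 - 1. real (step_weight n1 n2 t) * ((if t \<in> T then 1 else 0) - (if Suc t \<in> T then 1 else 0)))
    = real m1 * (real n1 - 1) + real m2 * (real n2 - 1) - 2 * real (\<Sum>t\<in>T. pos_weight n1 t)"
proof -
  let ?n = "n1 + n2" and ?w = "\<lambda>t. real (step_weight n1 n2 t)"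
  \<comment> \<open>The weight of the step that leads to \<open>t\<close> from below; no step leads
    to 0.\<close>
  let ?v = "\<lambda>t. if t = 0 then 0 else ?w (t - 1)"
  have fin: "finite T" using finite_subset[OF assms(1)] by simp
  have d: "?w t - ?v t = (if t < n1 then real n1 - 1 else real n2 - 1) - 2 * real (pos_weight n1 t)"
    if tn: "t < ?n" for t
  proof -
    show ?thesis
    proof (cases t)
      case 0
      then show ?thesis using tn by (cases "n1 = 0") (simp_all add: step_weight_def pos_weight_def of_nat_diff)
    next
      case (Suc t')
      consider "Suc t' < n1" | "Suc t' = n1" | "n1 < Suc t'" by linarith
      then show ?thesis
      proof cases
        case 1
        then obtain r where "n1 = Suc (Suc t') + r" using less_imp_Suc_add[OF 1] by auto
        then show ?thesis using Suc by (simp add: step_weight_def pos_weight_def algebra_simps)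
      next
        case 2
        then obtain r where "n2 = Suc r" using tn Suc by (cases n2) auto
        then show ?thesis using Suc 2 by (auto simp add: step_weight_def pos_weight_def algebra_simps)
      next
        case 3
        then obtain i where i: "t' = n1 + i" using le_Suc_ex by (metis less_Suc_eq_le)
        then obtain r where "n2 = Suc (Suc i) + r"
          using less_imp_Suc_add[of "Suc i" n2] tn Suc by auto
        then show ?thesis using Suc i by (simp add: step_weight_def pos_weight_def algebra_simps)
      qed
    qed
  qed
  have ind: "(\<Sum>t<?n. f t * (if t \<in> T then 1 else 0)) = (\<Sum>t\<in>T. f t)" for f :: "nat \<Rightarrow> real"
    using assms(1) by (simp add: if_distrib sum.If_cases Int_absorb1 cong: if_cong)
  have "(\<Sum>t<?n - 1. ?w t * (if t \<in> T then 1 else 0)) = (\<Sum>t<?n. ?w t * (if t \<in> T then 1 else 0))"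
  proof (cases "?n")
    case (Suc k)
    have "?w k = 0" using Suc by (auto simp: step_weight_def)
    then show ?thesis using Suc by simp
  qed simp
  moreover have "(\<Sum>t<?n - 1. ?w t * (if Suc t \<in> T then 1 else 0)) = (\<Sum>t<?n. ?v t * (if t \<in> T then 1 else 0))"
  proof (cases "?n")
    case (Suc k)
    then show ?thesis by (simp add: sum.lessThan_Suc_shift del: sum.lessThan_Suc)
  qed simp
  ultimately have "(\<Sum>t<?n - 1. ?w t * ((if t \<in> T then 1 else 0) - (if Suc t \<in> T then 1 else 0)))
    = (\<Sum>t\<in>T. ?w t) - (\<Sum>t\<in>T. ?v t)"
    unfolding right_diff_distrib sum_subtractf ind by simp
  also have "\<dots> = (\<Sum>t\<in>T. (if t < n1 then real n1 - 1 else real n2 - 1) - 2 * real (pos_weight n1 t))"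
    unfolding sum_subtractf[symmetric] by (rule sum.cong[OF refl], rule d) (use assms(1) in auto)
  also have "\<dots> = (\<Sum>t\<in>T. (if t < n1 then real n1 - 1 else real n2 - 1)) - 2 * real (\<Sum>t\<in>T. pos_weight n1 t)"
    by (simp add: sum_subtractf sum_distrib_left)
  also have "(\<Sum>t\<in>T. (if t < n1 then real n1 - 1 else real n2 - 1)) = real m1 * (real n1 - 1) + real m2 * (real n2 - 1)"
  proof -
    have "T \<inter> {t. t < n1} = T \<inter> {..<n1}" "T \<inter> - {t. t < n1} = T - {..<n1}" by auto
    then show ?thesis using assms fin by (simp add: sum.If_cases)
  qed
  finally show ?thesis .
qed

section \<open>Comparing adjacent levels\<close>

lemma move_kernel_ex:
  fixes c :: "nat \<Rightarrow> real"
  assumes "finite A" "finite B" "card B < card A"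
    and "\<And>t T. T \<in> P \<Longrightarrow> C t T \<Longrightarrow> mv t T \<in> A \<Longrightarrow> c t \<noteq> 0 \<Longrightarrow> T \<in> B"
  shows "\<exists>x. (\<forall>T. T \<notin> A \<longrightarrow> x T = 0) \<and> (\<exists>T\<in>A. x T \<noteq> 0) \<and>
    (\<forall>T\<in>P. (\<Sum>t<k. c t * (if C t T then x (mv t T) else 0)) = 0)"
proof -
  \<comment> \<open>The matrix of the weighted moves from vectors on \<open>A\<close> to values on
    \<open>B\<close>. Outside \<open>B\<close> every move either has weight 0 or reads
    \<open>x\<close> outside \<open>A\<close>, where \<open>x\<close> is 0.\<close>
  let ?M = "\<lambda>T' T. \<Sum>t<k. c t * (if C t T' \<and> T = mv t T' then 1 else 0)"
  obtain y where y: "\<exists>i\<in>A. y i \<noteq> 0" "\<forall>T'\<in>B. (\<Sum>T\<in>A. ?M T' T * y T) = 0"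
    using kernel_ex[OF assms(2,1,3), of ?M] by blast
  define x where "x T = (if T \<in> A then y T else 0)" for T
  have "(\<Sum>t<k. c t * (if C t T' then x (mv t T') else 0)) = 0" if "T' \<in> P" for T'
  proof (cases "T' \<in> B")
    case True
    have "(if C t T' then x (mv t T') else 0) = (\<Sum>T\<in>A. (if C t T' \<and> T = mv t T' then 1 else 0) * y T)" for t
    proof (cases "C t T'")
      case True
      have "(\<Sum>T\<in>A. (if T = mv t T' then 1 else 0) * y T) = (\<Sum>T\<in>A. if T = mv t T' then y T else 0)"
        by (rule sum.cong) auto
      then show ?thesis using True assms(1) by (simp add: x_def sum.delta)
    qed simp
    then have "(\<Sum>t<k. c t * (if C t T' then x (mv t T') else 0)) =
        (\<Sum>t<k. \<Sum>T\<in>A. c t * (if C t T' \<and> T = mv t T' then 1 else 0) * y T)"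
      by (simp only: sum_distrib_left mult.assoc)
    also have "\<dots> = (\<Sum>T\<in>A. ?M T' T * y T)"
      by (subst sum.swap) (simp add: sum_distrib_right)
    finally show ?thesis using y True by simp
  next
    case False
    have "c t * (if C t T' then x (mv t T') else 0) = 0" for t
      using assms(4)[OF that, of t] False by (auto simp: x_def)
    then show ?thesis by (intro sum.neutral) blast
  qed
  moreover have "\<forall>T. T \<notin> A \<longrightarrow> x T = 0" "\<exists>T\<in>A. x T \<noteq> 0" using y by (auto simp: x_def)
  ultimately show ?thesis by blast
qed

lemma level_weight:
  assumes "T \<in> level n1 m1 n2 m2 j"
  shows "(\<Sum>t<n1 + n2 - 1. (sqrt (real (step_weight n1 n2 t)))\<^sup>2 * ((if t \<in> T then 1 else 0) - (if Suc t \<in> T then 1 else 0)))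
    = real m1 * (real n1 - 1) + real m2 * (real n2 - 1) - 2 * real j"
  using step_weight_sum[of T n1 n2 m1 m2] assms by (simp add: level_def del: of_nat_sum)

text \<open>If the next level were smaller, the sum of the \<open>up\<close> moves would annihilate
  a nonzero vector on level \<open>j\<close>. There the diagonal entries are positive, so minus a
  sum of squares would be positive.\<close>

lemma level_card_up:
  assumes "2 * real j < real m1 * (real n1 - 1) + real m2 * (real n2 - 1)"
  shows "card (level n1 m1 n2 m2 j) \<le> card (level n1 m1 n2 m2 (Suc j))"
proof (rule ccontr)
  let ?P = "Pow {..<n1 + n2}" and ?A = "level n1 m1 n2 m2 j" and ?B = "level n1 m1 n2 m2 (Suc j)"
  let ?c = "\<lambda>t. sqrt (real (step_weight n1 n2 t))"
  assume "\<not> card ?A \<le> card ?B"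
  then have less: "card ?B < card ?A" by simp
  have mv: "T \<in> ?B" if "T \<in> ?P" "Suc t \<in> T \<and> t \<notin> T" "insert t (T - {Suc t}) \<in> ?A" "?c t \<noteq> 0" for t T
    using level_move_iff[of t T n1 n2 m1 m2 j] that by simp
  have "\<exists>x. (\<forall>T. T \<notin> ?A \<longrightarrow> x T = 0) \<and> (\<exists>T\<in>?A. x T \<noteq> 0) \<and>
    (\<forall>T\<in>?P. (\<Sum>t<n1 + n2 - 1. ?c t * (if Suc t \<in> T \<and> t \<notin> T then x (insert t (T - {Suc t})) else 0)) = 0)"
    by (rule move_kernel_ex[OF finite_level finite_level less]) (rule mv)
  then obtain x where x: "\<And>T. T \<notin> ?A \<Longrightarrow> x T = 0" "\<exists>T\<in>?A. x T \<noteq> 0"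
    "\<And>T. T \<in> ?P \<Longrightarrow> (\<Sum>t<n1 + n2 - 1. ?c t * (if Suc t \<in> T \<and> t \<notin> T then x (insert t (T - {Suc t})) else 0)) = 0"
    by blast
  have "0 < (\<Sum>T\<in>?P. (\<Sum>t<n1 + n2 - 1. (?c t)\<^sup>2 * ((if t \<in> T then 1 else 0) - (if Suc t \<in> T then 1 else 0))) * (x T)\<^sup>2)"
    (is "0 < (\<Sum>T\<in>?P. ?L T * (x T)\<^sup>2)")
  proof -
    obtain T0 where T0: "T0 \<in> ?A" "x T0 \<noteq> 0" using x(2) by blast
    have l: "0 < ?L T" if "T \<in> ?A" for T using level_weight[OF that] assms by linarith
    show ?thesis
    proof (rule sum_pos2[of _ T0])
      show "0 < ?L T0 * (x T0)\<^sup>2" using l[OF T0(1)] T0(2) by simp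
      show "0 \<le> ?L T * (x T)\<^sup>2" for T
      proof (cases "T \<in> ?A")
        case True
        then show ?thesis using less_imp_le[OF l[OF True]] by (intro mult_nonneg_nonneg) auto
      qed (simp add: x(1))
    qed (use T0 in \<open>auto simp: level_def\<close>)
  qed
  also have "\<dots> = (\<Sum>T\<in>?P. (\<Sum>t<n1 + n2 - 1. ?c t * up t x T)\<^sup>2) - (\<Sum>T\<in>?P. (\<Sum>t<n1 + n2 - 1. ?c t * down t x T)\<^sup>2)"
    by (rule up_down_norm[symmetric])
  also have "(\<Sum>T\<in>?P. (\<Sum>t<n1 + n2 - 1. ?c t * up t x T)\<^sup>2) = 0"
    unfolding up_def by (rule sum.neutral, rule ballI) (simp only: x(3) power_zero_numeral)
  finally have "0 < - (\<Sum>T\<in>?P. (\<Sum>t<n1 + n2 - 1. ?c t * down t x T)\<^sup>2)" by simp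
  moreover have "0 \<le> (\<Sum>T\<in>?P. (\<Sum>t<n1 + n2 - 1. ?c t * down t x T)\<^sup>2)" by (intro sum_nonneg) simp
  ultimately show False by linarith
qed

text \<open>The mirror image: the sum of the \<open>down\<close> moves would annihilate a nonzero
  vector on level \<open>Suc j\<close>, where the diagonal entries are negative.\<close>

lemma level_card_down:
  assumes "real m1 * (real n1 - 1) + real m2 * (real n2 - 1) < 2 * real (Suc j)"
  shows "card (level n1 m1 n2 m2 (Suc j)) \<le> card (level n1 m1 n2 m2 j)"
proof (rule ccontr)
  let ?P = "Pow {..<n1 + n2}" and ?B = "level n1 m1 n2 m2 j" and ?A = "level n1 m1 n2 m2 (Suc j)"
  let ?c = "\<lambda>t. sqrt (real (step_weight n1 n2 t))"
  assume "\<not> card ?A \<le> card ?B"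
  then have less: "card ?B < card ?A" by simp
  have mv: "T \<in> ?B" if "T \<in> ?P" "t \<in> T \<and> Suc t \<notin> T" "insert (Suc t) (T - {t}) \<in> ?A" "?c t \<noteq> 0" for t T
  proof -
    have "insert t (insert (Suc t) (T - {t}) - {Suc t}) = T" using that by auto
    moreover have "insert (Suc t) (T - {t}) \<subseteq> {..<n1 + n2}" using that by (auto simp: level_def)
    ultimately show ?thesis
      using level_move_iff[of t "insert (Suc t) (T - {t})" n1 n2 m1 m2 j] that by simp
  qed
  have "\<exists>x. (\<forall>T. T \<notin> ?A \<longrightarrow> x T = 0) \<and> (\<exists>T\<in>?A. x T \<noteq> 0) \<and>
    (\<forall>T\<in>?P. (\<Sum>t<n1 + n2 - 1. ?c t * (if t \<in> T \<and> Suc t \<notin> T then x (insert (Suc t) (T - {t})) else 0)) = 0)"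
    by (rule move_kernel_ex[OF finite_level finite_level less]) (rule mv)
  then obtain x where x: "\<And>T. T \<notin> ?A \<Longrightarrow> x T = 0" "\<exists>T\<in>?A. x T \<noteq> 0"
    "\<And>T. T \<in> ?P \<Longrightarrow> (\<Sum>t<n1 + n2 - 1. ?c t * (if t \<in> T \<and> Suc t \<notin> T then x (insert (Suc t) (T - {t})) else 0)) = 0"
    by blast
  have "(\<Sum>T\<in>?P. (\<Sum>t<n1 + n2 - 1. (?c t)\<^sup>2 * ((if t \<in> T then 1 else 0) - (if Suc t \<in> T then 1 else 0))) * (x T)\<^sup>2)
    = (\<Sum>T\<in>?P. (\<Sum>t<n1 + n2 - 1. ?c t * up t x T)\<^sup>2) - (\<Sum>T\<in>?P. (\<Sum>t<n1 + n2 - 1. ?c t * down t x T)\<^sup>2)"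
    by (rule up_down_norm[symmetric])
  also have "(\<Sum>T\<in>?P. (\<Sum>t<n1 + n2 - 1. ?c t * down t x T)\<^sup>2) = 0"
    unfolding down_def by (rule sum.neutral, rule ballI) (simp only: x(3) power_zero_numeral)
  also have "(\<Sum>T\<in>?P. (\<Sum>t<n1 + n2 - 1. ?c t * up t x T)\<^sup>2) - 0 \<ge> 0" by (simp add: sum_nonneg)
  finally have ge: "0 \<le> (\<Sum>T\<in>?P. (\<Sum>t<n1 + n2 - 1. (?c t)\<^sup>2 * ((if t \<in> T then 1 else 0) - (if Suc t \<in> T then 1 else 0))) * (x T)\<^sup>2)"
    (is "0 \<le> (\<Sum>T\<in>?P. ?L T * (x T)\<^sup>2)") .
  obtain T0 where T0: "T0 \<in> ?A" "x T0 \<noteq> 0" using x(2) by blast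
  have l: "?L T < 0" if "T \<in> ?A" for T using level_weight[OF that] assms by linarith
  have "0 < (\<Sum>T\<in>?P. - (?L T * (x T)\<^sup>2))"
  proof (rule sum_pos2[of _ T0])
    show "0 < - (?L T0 * (x T0)\<^sup>2)" using l[OF T0(1)] T0(2) by (simp add: mult_neg_pos)
    show "0 \<le> - (?L T * (x T)\<^sup>2)" for T
    proof (cases "T \<in> ?A")
      case True
      have "?L T * (x T)\<^sup>2 \<le> 0" using less_imp_le[OF l[OF True]] by (intro mult_nonpos_nonneg) auto
      then show ?thesis by linarith
    qed (simp add: x(1))
  qed (use T0 in \<open>auto simp: level_def\<close>)
  then show False using ge unfolding sum_negf by linarith
qed

section \<open>Gaussian polynomials as generating functions of subsets\<close>

definition subsets :: "nat \<Rightarrow> nat \<Rightarrow> nat set set" where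
  "subsets n m = {S \<in> Pow {..<n}. card S = m}"

lemma finite_subsets: "finite (subsets n m)"
  by (simp add: subsets_def)

lemma finite_subsets_mem: "S \<in> subsets n m \<Longrightarrow> finite S"
  by (auto simp: subsets_def intro: finite_subset)

lemma subsets_Suc:
  "subsets (Suc n) (Suc m) = (\<lambda>S. insert 0 (Suc ` S)) ` subsets n m \<union> (`) Suc ` subsets n (Suc m)"
proof
  show "subsets (Suc n) (Suc m) \<subseteq> (\<lambda>S. insert 0 (Suc ` S)) ` subsets n m \<union> (`) Suc ` subsets n (Suc m)"
  proof
    fix S assume S: "S \<in> subsets (Suc n) (Suc m)"
    define R where "R = (\<lambda>t. t - 1) ` (S - {0})"
    have img: "Suc ` R = S - {0}" by (auto simp: R_def image_iff)
    then have cR: "card R = card (S - {0})" by (metis card_image inj_Suc inj_on_subset subset_UNIV)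
    have "R \<subseteq> {..<n}" using S by (auto simp: R_def subsets_def)
    show "S \<in> (\<lambda>S. insert 0 (Suc ` S)) ` subsets n m \<union> (`) Suc ` subsets n (Suc m)"
    proof (cases "0 \<in> S")
      case True
      then have "R \<in> subsets n m" using S cR \<open>R \<subseteq> {..<n}\<close> by (simp add: subsets_def)
      moreover have "S = insert 0 (Suc ` R)" using img True by auto
      ultimately show ?thesis by blast
    next
      case False
      then have "R \<in> subsets n (Suc m)" using S cR \<open>R \<subseteq> {..<n}\<close> by (simp add: subsets_def)
      moreover have "S = Suc ` R" using img False by auto
      ultimately show ?thesis by blast
    qed
  qed
  have "insert 0 (Suc ` S) \<in> subsets (Suc n) (Suc m)" if S: "S \<in> subsets n m" for S
    using S finite_subsets_mem[OF S] by (auto simp: subsets_def card_image)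
  moreover have "Suc ` S \<in> subsets (Suc n) (Suc m)" if S: "S \<in> subsets n (Suc m)" for S
    using S by (auto simp: subsets_def card_image)
  ultimately show "(\<lambda>S. insert 0 (Suc ` S)) ` subsets n m \<union> (`) Suc ` subsets n (Suc m) \<subseteq> subsets (Suc n) (Suc m)"
    by blast
qed

text \<open>The power on the left is the least element sum of an \<open>m\<close>-subset. Subsets
  are split by whether they contain 0; translating the remaining elements by 1 costs one factor q
  each.\<close>

lemma gauss_subsets:
  "[:0, 1:] ^ (\<Sum>i<m. i) * gauss n m = (\<Sum>S\<in>subsets n m. [:0, 1:] ^ (\<Sum>t\<in>S. t))"
proof (induction n m rule: gauss.induct)
  case (1 n)
  have "S = {}" if "S \<in> subsets n 0" for S
    using that finite_subsets_mem[OF that] by (simp add: subsets_def)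
  then have "subsets n 0 = {{}}" by (auto simp: subsets_def)
  then show ?case by simp
next
  case (2 m)
  have "subsets 0 (Suc m) = {}" by (auto simp: subsets_def)
  then show ?case by simp
next
  case (3 n m)
  let ?q = "[:0, 1 :: int:]"
  have sum_Suc: "(\<Sum>t\<in>Suc ` S. t) = m' + (\<Sum>t\<in>S. t)" if "S \<in> subsets n m'" for S m'
  proof -
    have "(\<Sum>t\<in>Suc ` S. t) = (\<Sum>t\<in>S. 1 + t)" by (simp add: sum.reindex)
    then show ?thesis using that by (simp only: sum.distrib) (simp add: subsets_def)
  qed
  have inj1: "inj_on (\<lambda>S. insert 0 (Suc ` S)) (subsets n m)"
  proof
    fix S R :: "nat set" assume "insert 0 (Suc ` S) = insert 0 (Suc ` R)"
    then have "Suc ` S = Suc ` R" by (metis Diff_insert_absorb image_iff nat.distinct(1))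
    then show "S = R" by (simp add: inj_image_eq_iff)
  qed
  have inj2: "inj_on ((`) Suc) (subsets n (Suc m))" by (auto simp: inj_on_def inj_image_eq_iff)
  have "(\<Sum>S\<in>subsets (Suc n) (Suc m). ?q ^ (\<Sum>t\<in>S. t))
     = (\<Sum>S\<in>(\<lambda>S. insert 0 (Suc ` S)) ` subsets n m. ?q ^ (\<Sum>t\<in>S. t)) + (\<Sum>S\<in>(`) Suc ` subsets n (Suc m). ?q ^ (\<Sum>t\<in>S. t))"
    unfolding subsets_Suc by (rule sum.union_disjoint) (auto simp: finite_subsets)
  also have "(\<Sum>S\<in>(\<lambda>S. insert 0 (Suc ` S)) ` subsets n m. ?q ^ (\<Sum>t\<in>S. t)) = (\<Sum>S\<in>subsets n m. ?q ^ m * ?q ^ (\<Sum>t\<in>S. t))"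
    unfolding sum.reindex[OF inj1] o_def
  proof (rule sum.cong[OF refl])
    fix S assume S: "S \<in> subsets n m"
    have "(\<Sum>t\<in>insert 0 (Suc ` S). t) = (\<Sum>t\<in>Suc ` S. t)"
      using finite_subsets_mem[OF S] by (subst sum.insert) auto
    then show "?q ^ (\<Sum>t\<in>insert 0 (Suc ` S). t) = ?q ^ m * ?q ^ (\<Sum>t\<in>S. t)"
      by (simp only: sum_Suc[OF S] power_add)
  qed
  also have "\<dots> = ?q ^ m * (?q ^ (\<Sum>i<m. i) * gauss n m)" unfolding 3(1) sum_distrib_left ..
  also have "(\<Sum>S\<in>(`) Suc ` subsets n (Suc m). ?q ^ (\<Sum>t\<in>S. t)) = (\<Sum>S\<in>subsets n (Suc m). ?q ^ Suc m * ?q ^ (\<Sum>t\<in>S. t))"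
    unfolding sum.reindex[OF inj2] o_def
    by (rule sum.cong[OF refl]) (simp only: sum_Suc power_add)
  also have "\<dots> = ?q ^ Suc m * (?q ^ (\<Sum>i<Suc m. i) * gauss n (Suc m))" unfolding 3(2) sum_distrib_left ..
  finally have "(\<Sum>S\<in>subsets (Suc n) (Suc m). ?q ^ (\<Sum>t\<in>S. t)) =
     ?q ^ m * (?q ^ (\<Sum>i<m. i) * gauss n m) + ?q ^ Suc m * (?q ^ (\<Sum>i<Suc m. i) * gauss n (Suc m))" .
  also have "\<dots> = ?q ^ (\<Sum>i<Suc m. i) * (gauss n m + ?q ^ Suc m * gauss n (Suc m))"
    by (simp only: sum.lessThan_Suc power_add distrib_left mult_ac)
  finally show ?case by simp
qed

lemma q_power_monom: "[:0, 1:] ^ n = (monom 1 n :: int poly)"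
  by (simp add: monom_altdef)

lemma coeff_q_power_sum:
  assumes "finite F" shows "coeff (\<Sum>T\<in>F. [:0, 1 :: int:] ^ w T) i = int (card {T \<in> F. w T = i})"
proof -
  have "coeff (\<Sum>T\<in>F. [:0, 1 :: int:] ^ w T) i = (\<Sum>T\<in>F. if w T = i then 1 else 0)"
    by (simp add: q_power_monom coeff_sum)
  also have "\<dots> = int (card {T \<in> F. w T = i})"
    using assms by (simp add: sum.If_cases Int_def)
  finally show ?thesis .
qed

lemma coeff_gauss_mult:
  "coeff (gauss n1 m1 * gauss n2 m2) i = int (card (level n1 m1 n2 m2 (i + ((\<Sum>t<m1. t) + (\<Sum>t<m2. t)))))"
proof -
  let ?q = "[:0, 1 :: int:]" and ?k = "(\<Sum>t<m1. t) + (\<Sum>t<m2. t)"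
  define F where "F = {T \<in> Pow {..<n1 + n2}. card (T \<inter> {..<n1}) = m1 \<and> card (T - {..<n1}) = m2}"
  have "?q ^ ?k * (gauss n1 m1 * gauss n2 m2) =
      (?q ^ (\<Sum>t<m1. t) * gauss n1 m1) * (?q ^ (\<Sum>t<m2. t) * gauss n2 m2)"
    by (simp only: power_add mult_ac)
  also have "\<dots> = (\<Sum>S\<in>subsets n1 m1. \<Sum>R\<in>subsets n2 m2. ?q ^ (\<Sum>t\<in>S. t) * ?q ^ (\<Sum>t\<in>R. t))"
    unfolding gauss_subsets sum_product ..
  also have "\<dots> = (\<Sum>(S, R)\<in>subsets n1 m1 \<times> subsets n2 m2. ?q ^ ((\<Sum>t\<in>S. t) + (\<Sum>t\<in>R. t)))"
    by (simp only: power_add sum.cartesian_product)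
  also have "\<dots> = (\<Sum>T\<in>F. ?q ^ (\<Sum>t\<in>T. pos_weight n1 t))"
  proof (rule sum.reindex_bij_witness[of _ "\<lambda>T. (T \<inter> {..<n1}, (\<lambda>t. t - n1) ` (T - {..<n1}))" "\<lambda>(S, R). S \<union> (+) n1 ` R"])
    fix p assume p: "p \<in> subsets n1 m1 \<times> subsets n2 m2"
    obtain S R where pe: "p = (S, R)" by force
    have S: "S \<subseteq> {..<n1}" "card S = m1" "finite S" and R: "R \<subseteq> {..<n2}" "card R = m2" "finite R"
      using p finite_subsets_mem[of S] finite_subsets_mem[of R] by (auto simp: pe subsets_def)
    have i1: "(S \<union> (+) n1 ` R) \<inter> {..<n1} = S" and i2: "(S \<union> (+) n1 ` R) - {..<n1} = (+) n1 ` R"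
      using S R by auto
    have i3: "(\<lambda>t. t - n1) ` (+) n1 ` R = R" by (simp add: image_image)
    show "(\<lambda>T. (T \<inter> {..<n1}, (\<lambda>t. t - n1) ` (T - {..<n1}))) ((\<lambda>(S, R). S \<union> (+) n1 ` R) p) = p"
      unfolding pe prod.case i1 i2 i3 ..
    have cR: "card ((+) n1 ` R) = m2" using R by (simp add: card_image)
    have "S \<union> (+) n1 ` R \<subseteq> {..<n1 + n2}" using S R by auto
    then show "(\<lambda>(S, R). S \<union> (+) n1 ` R) p \<in> F"
      unfolding pe prod.case F_def mem_Collect_eq i1 i2 cR using S by blast
    have "(\<Sum>t\<in>S \<union> (+) n1 ` R. pos_weight n1 t) = (\<Sum>t\<in>S. pos_weight n1 t) + (\<Sum>t\<in>(+) n1 ` R. pos_weight n1 t)"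
      by (rule sum.union_disjoint) (use S R in auto)
    also have "(\<Sum>t\<in>S. pos_weight n1 t) = (\<Sum>t\<in>S. t)"
      by (rule sum.cong) (use S in \<open>auto simp: pos_weight_def\<close>)
    also have "(\<Sum>t\<in>(+) n1 ` R. pos_weight n1 t) = (\<Sum>t\<in>R. t)"
      by (subst sum.reindex) (auto simp: pos_weight_def)
    finally show "?q ^ (\<Sum>t\<in>(\<lambda>(S, R). S \<union> (+) n1 ` R) p. pos_weight n1 t) =
        (case p of (S, R) \<Rightarrow> ?q ^ ((\<Sum>t\<in>S. t) + (\<Sum>t\<in>R. t)))"
      unfolding pe prod.case by (rule arg_cong)
  next
    fix T assume T: "T \<in> F"
    have img: "(+) n1 ` (\<lambda>t. t - n1) ` (T - {..<n1}) = T - {..<n1}"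
      by (auto simp: image_iff)
    show "(\<lambda>(S, R). S \<union> (+) n1 ` R) (T \<inter> {..<n1}, (\<lambda>t. t - n1) ` (T - {..<n1})) = T"
      unfolding prod.case img by blast
    have "inj_on (\<lambda>t. t - n1) (T - {..<n1})" by (auto simp: inj_on_def)
    then have "card ((\<lambda>t. t - n1) ` (T - {..<n1})) = m2" using T by (simp add: card_image F_def)
    moreover have "(\<lambda>t. t - n1) ` (T - {..<n1}) \<subseteq> {..<n2}" using T by (auto simp: F_def)
    ultimately show "(T \<inter> {..<n1}, (\<lambda>t. t - n1) ` (T - {..<n1})) \<in> subsets n1 m1 \<times> subsets n2 m2"
      using T by (auto simp: subsets_def F_def)
  qed
  finally have "coeff (?q ^ ?k * (gauss n1 m1 * gauss n2 m2)) (i + ?k) = coeff (\<Sum>T\<in>F. ?q ^ (\<Sum>t\<in>T. pos_weight n1 t)) (i + ?k)"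
    by simp
  also have "\<dots> = int (card {T \<in> F. (\<Sum>t\<in>T. pos_weight n1 t) = i + ?k})"
    by (rule coeff_q_power_sum) (simp add: F_def)
  also have "{T \<in> F. (\<Sum>t\<in>T. pos_weight n1 t) = i + ?k} = level n1 m1 n2 m2 (i + ?k)"
    by (auto simp: F_def level_def)
  also have "coeff (?q ^ ?k * (gauss n1 m1 * gauss n2 m2)) (i + ?k) = coeff (gauss n1 m1 * gauss n2 m2) i"
    unfolding q_power_monom coeff_monom_mult by simp
  finally show ?thesis .
qed

text \<open>Since \<open>(1 - q^n) p = (1 - q) f\<close>, the differences of the unimodal sequence \<open>f\<close> control \<open>p\<close>: from below
  in the lower half and from above in the upper half.\<close>

lemma quotient_coeff_nonneg:
  assumes f: "qpoly n * p = gauss n1 m1 * gauss n2 m2" and "0 < n"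
  shows "0 \<le> coeff p i"
proof -
  let ?q = "[:0, 1 :: int:]" and ?f = "gauss n1 m1 * gauss n2 m2" and ?s = "(\<Sum>t<m1. t) + (\<Sum>t<m2. t)"
  define L where "L = real m1 * (real n1 - 1) + real m2 * (real n2 - 1)"
  have geo: "qpoly n - ?q * qpoly n = 1 - ?q ^ n" for n
    by (induction n) (simp_all add: qpoly_Suc one_pCons algebra_simps)
  have id: "?f - ?q * ?f = p - ?q ^ n * p"
  proof -
    have "?f - ?q * ?f = (qpoly n - ?q * qpoly n) * p" unfolding f[symmetric] by (simp add: algebra_simps)
    then show ?thesis unfolding geo by (simp add: algebra_simps)
  qed
  have rec: "coeff ?f i - (if i = 0 then 0 else coeff ?f (i - 1)) = coeff p i - (if i < n then 0 else coeff p (i - n))" for i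
  proof -
    have "coeff (?q * r) i = (if i = 0 then 0 else coeff r (i - 1))" for r i
      by (cases i) auto
    moreover have "coeff (?q ^ n * r) i = (if i < n then 0 else coeff r (i - n))" for r i
      unfolding q_power_monom coeff_monom_mult by simp
    ultimately show ?thesis using arg_cong[OF id, of "\<lambda>r. coeff r i"] by (simp only: coeff_diff)
  qed
  have low: "0 \<le> coeff p i" if "2 * real (i + ?s) \<le> L" for i
    using that
  proof (induction i rule: less_induct)
    case (less i)
    have "0 \<le> coeff ?f i - (if i = 0 then 0 else coeff ?f (i - 1))"
    proof (cases i)
      case (Suc i')
      have "2 * real (i' + ?s) < L" using less.prems Suc by simp
      then have "card (level n1 m1 n2 m2 (i' + ?s)) \<le> card (level n1 m1 n2 m2 (Suc (i' + ?s)))"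
        unfolding L_def by (rule level_card_up)
      then show ?thesis unfolding coeff_gauss_mult using Suc by simp
    qed (simp add: coeff_gauss_mult)
    moreover have "0 \<le> (if i < n then 0 else coeff p (i - n))"
      using less.IH[of "i - n"] less.prems \<open>0 < n\<close> by auto
    ultimately show ?case using rec[of i] by linarith
  qed
  \<comment> \<open>In the upper half the sequence \<open>?f\<close> no longer increases, so passing
    from \<open>i\<close> to \<open>i + n\<close> cannot increase the coefficient of
    \<open>p\<close>.\<close>
  have high: "coeff p (i + k * n) \<le> coeff p i" if "L < 2 * real (i + ?s)" for i k
  proof (induction k)
    case (Suc k)
    define j where "j = i + k * n + (n - 1)"
    have j: "Suc j = i + Suc k * n" using \<open>0 < n\<close> by (simp add: j_def)
    have "real (i + ?s) \<le> real (Suc (j + ?s))" unfolding of_nat_le_iff by (simp add: j_def)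
    then have "2 * real (i + ?s) \<le> 2 * real (Suc (j + ?s))" by (rule mult_left_mono) simp
    with that have "L < 2 * real (Suc (j + ?s))" by (rule order.strict_trans2)
    then have "card (level n1 m1 n2 m2 (Suc (j + ?s))) \<le> card (level n1 m1 n2 m2 (j + ?s))"
      unfolding L_def by (rule level_card_down)
    then have "coeff ?f (Suc j) \<le> coeff ?f j" unfolding coeff_gauss_mult by simp
    moreover have "\<not> Suc j < n" "Suc j - n = i + k * n" using j by auto
    ultimately have "coeff p (Suc j) \<le> coeff p (i + k * n)"
      using rec[of "Suc j"] by (simp only: if_False nat.distinct diff_Suc_1 split: if_splits)
    then show ?case using Suc.IH unfolding j by (rule order_trans)
  qed simp
  show ?thesis
  proof (cases "2 * real (i + ?s) \<le> L")
    case False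
    \<comment> \<open>So many steps of length \<open>n\<close> lead beyond the degree, where the
      coefficient is 0 and yet at most \<open>coeff p i\<close>.\<close>
    have "Suc (degree p) * 1 \<le> Suc (degree p) * n" using \<open>0 < n\<close> by (intro mult_le_mono2) simp
    then have "Suc (degree p) \<le> i + Suc (degree p) * n"
      by (intro trans_le_add2) (simp only: mult_1_right)
    then have "degree p < i + Suc (degree p) * n" by (simp only: Suc_le_eq)
    then have "coeff p (i + Suc (degree p) * n) = 0" by (rule coeff_eq_0)
    then show ?thesis using high[of i "Suc (degree p)"] False by simp
  qed (rule low)
qed

section \<open>Heights of a lattice path\<close>

definition ecount :: "step list \<Rightarrow> nat \<Rightarrow> nat" where
  "ecount D n = count_list (take n D) East"

definition ncount :: "step list \<Rightarrow> nat \<Rightarrow> nat" where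
  "ncount D n = count_list (take n D) North"

lemma vertex_eq: "vertex D n = (real (ecount D n), real (ncount D n))"
  by (simp add: vertex_def ecount_def ncount_def)

lemma count_take_mono: "m \<le> n \<Longrightarrow> count_list (take m D) s \<le> count_list (take n D) s"
proof -
  assume "m \<le> n"
  then have "take n D = take m D @ take (n - m) (drop m D)"
    by (metis le_add_diff_inverse take_add)
  then show ?thesis by simp
qed

lemma ecount_mono: "m \<le> n \<Longrightarrow> ecount D m \<le> ecount D n"
  and ncount_mono: "m \<le> n \<Longrightarrow> ncount D m \<le> ncount D n"
  by (simp_all add: ecount_def ncount_def count_take_mono)

lemma ecount_Suc: "n < length D \<Longrightarrow> ecount D (Suc n) = ecount D n + (if D ! n = East then 1 else 0)"
  and ncount_Suc: "n < length D \<Longrightarrow> ncount D (Suc n) = ncount D n + (if D ! n = North then 1 else 0)"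
  by (simp_all add: ecount_def ncount_def take_Suc_conv_app_nth)

lemma east_steps_snoc: "east_steps (D @ [s]) = east_steps D @ (if s = East then [length D] else [])"
proof -
  have "filter (\<lambda>n. (D @ [s]) ! n = East) [0..<length D] = filter (\<lambda>n. D ! n = East) [0..<length D]"
    by (rule filter_cong) (auto simp: nth_append)
  then show ?thesis by (simp add: east_steps_def)
qed

lemma length_east_steps: "length (east_steps D) = count_list D East"
proof (induction D rule: rev_induct)
  case (snoc s D) then show ?case by (simp add: east_steps_snoc)
qed (simp add: east_steps_def)

lemma east_steps_nth:
  assumes "i < count_list D East"
  shows "east_steps D ! i < length D" "D ! (east_steps D ! i) = East" "ecount D (east_steps D ! i) = i"
  using assms
proof (induction D rule: rev_induct)
  case (snoc s D)
  { case 1 then show ?case using snoc length_east_steps[of D]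
      by (cases "i < count_list D East") (auto simp: east_steps_snoc nth_append less_Suc_eq split: if_splits) }
  { case 2 then show ?case using snoc length_east_steps[of D]
      by (cases "i < count_list D East") (auto simp: east_steps_snoc nth_append split: if_splits) }
  { case 3 then show ?case using snoc length_east_steps[of D]
      by (cases "i < count_list D East") (auto simp: east_steps_snoc nth_append ecount_def split: if_splits) }
qed simp_all

text \<open>East steps are counted from 1 but listed from 0. The height is read before the step, and
  an east step does not change it, so it is also the height of the labelled endpoint.\<close>

definition hgt :: "step list \<Rightarrow> nat \<Rightarrow> nat" where
  "hgt D i = ncount D (east_steps D ! (i - 1))"

context
  fixes D :: "step list" and b :: nat
  assumes b: "count_list D East = b"
begin

lemma east_step:
  assumes "1 \<le> i" "i \<le> b"
  obtains n where "n = east_steps D ! (i - 1)" "n < length D" "D ! n = East" "ecount D n = i - 1"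
    "ecount D (Suc n) = i" "ncount D n = hgt D i" "ncount D (Suc n) = hgt D i"
proof -
  have "i - 1 < count_list D East" using assms b by simp
  note e = east_steps_nth[OF this]
  show ?thesis
    using that[OF refl e] ecount_Suc[OF e(1)] ncount_Suc[OF e(1)] e assms by (simp add: hgt_def)
qed

lemma hgt_le_ncount:
  assumes "1 \<le> i" "i \<le> b" "i \<le> ecount D n" shows "hgt D i \<le> ncount D n"
proof -
  obtain e where e: "ecount D e = i - 1" "ncount D e = hgt D i" using east_step[OF assms(1,2)] .
  have "e \<le> n" using ecount_mono[of n e D] e assms by (cases "e \<le> n") auto
  then show ?thesis using ncount_mono[of e n D] e by simp
qed

lemma ncount_le_hgt:
  assumes "i \<le> b" "ecount D n < i" shows "ncount D n \<le> hgt D i"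
proof -
  have "1 \<le> i" using assms by simp
  then obtain e where e: "ecount D (Suc e) = i" "ncount D e = hgt D i" using east_step[OF _ assms(1)] by blast
  have "n \<le> e" using ecount_mono[of "Suc e" n D] e assms by (cases "n \<le> e") auto
  then show ?thesis using ncount_mono[of n e D] e by simp
qed

lemma hgt_mono:
  assumes "1 \<le> i" "i \<le> j" "j \<le> b" shows "hgt D i \<le> hgt D j"
proof -
  obtain e where e: "ecount D (Suc e) = j" "ncount D (Suc e) = hgt D j"
    using east_step[of j] assms by (metis le_trans)
  then show ?thesis using hgt_le_ncount[of i "Suc e"] assms by simp
qed

lemma ecount_le: "ecount D n \<le> b"
  using count_take_mono[of n "max n (length D)" D East] b by (simp add: ecount_def)

section \<open>Points of the path\<close>

lemma mem_horizontal_segment: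
  "(s, t) \<in> closed_segment (x, y) (x + 1 :: real, y :: real) \<longleftrightarrow> x \<le> s \<and> s \<le> x + 1 \<and> t = y"
proof
  assume "(s, t) \<in> closed_segment (x, y) (x + 1, y)"
  then show "x \<le> s \<and> s \<le> x + 1 \<and> t = y" by (auto simp: in_segment algebra_simps)
next
  assume "x \<le> s \<and> s \<le> x + 1 \<and> t = y"
  then show "(s, t) \<in> closed_segment (x, y) (x + 1, y)"
    by (auto simp: in_segment algebra_simps intro!: exI[of _ "s - x"])
qed

lemma mem_vertical_segment:
  "(s, t) \<in> closed_segment (x, y) (x :: real, y + 1 :: real) \<longleftrightarrow> y \<le> t \<and> t \<le> y + 1 \<and> s = x"
proof
  assume "(s, t) \<in> closed_segment (x, y) (x, y + 1)"
  then show "y \<le> t \<and> t \<le> y + 1 \<and> s = x" by (auto simp: in_segment algebra_simps)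
next
  assume "y \<le> t \<and> t \<le> y + 1 \<and> s = x"
  then show "(s, t) \<in> closed_segment (x, y) (x, y + 1)"
    by (auto simp: in_segment algebra_simps intro!: exI[of _ "t - y"])
qed

lemma mem_path_points:
  "(x, y) \<in> path_points D \<longleftrightarrow> (\<exists>n<length D.
     (D ! n = East \<and> real (ecount D n) \<le> x \<and> x \<le> real (ecount D n) + 1 \<and> y = real (ncount D n)) \<or>
     (D ! n = North \<and> x = real (ecount D n) \<and> real (ncount D n) \<le> y \<and> y \<le> real (ncount D n) + 1))"
proof -
  have "(x, y) \<in> closed_segment (vertex D n) (vertex D (Suc n)) \<longleftrightarrow>
     (D ! n = East \<and> real (ecount D n) \<le> x \<and> x \<le> real (ecount D n) + 1 \<and> y = real (ncount D n)) \<or>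
     (D ! n = North \<and> x = real (ecount D n) \<and> real (ncount D n) \<le> y \<and> y \<le> real (ncount D n) + 1)"
    if "n < length D" for n
    using mem_horizontal_segment[of x y "real (ecount D n)" "real (ncount D n)"]
      mem_vertical_segment[of x y "real (ecount D n)" "real (ncount D n)"]
    by (cases "D ! n") (auto simp: vertex_eq ecount_Suc[OF that] ncount_Suc[OF that] add.commute)
  then show ?thesis by (auto simp: path_points_def)
qed

lemma path_points_range:
  assumes "(x, y) \<in> path_points D" shows "0 \<le> x" "x \<le> real b" "0 \<le> y"
proof -
  obtain n where n: "n < length D"
     "(D ! n = East \<and> real (ecount D n) \<le> x \<and> x \<le> real (ecount D n) + 1 \<and> y = real (ncount D n)) \<or>
     (D ! n = North \<and> x = real (ecount D n) \<and> real (ncount D n) \<le> y \<and> y \<le> real (ncount D n) + 1)"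
    using assms mem_path_points by blast
  then show "0 \<le> x" "x \<le> real b" "0 \<le> y"
    using ecount_le[of n] ecount_le[of "Suc n"] ecount_Suc[OF n(1)] by auto
qed

lemma path_points_above:
  assumes "(x, y) \<in> path_points D" "1 \<le> i" "i \<le> b" "real i - 1 < x"
  shows "real (hgt D i) \<le> y"
proof -
  obtain n where n: "n < length D"
     "(D ! n = East \<and> real (ecount D n) \<le> x \<and> x \<le> real (ecount D n) + 1 \<and> y = real (ncount D n)) \<or>
     (D ! n = North \<and> x = real (ecount D n) \<and> real (ncount D n) \<le> y \<and> y \<le> real (ncount D n) + 1)"
    using assms mem_path_points by blast
  from n(2) show ?thesis
  proof
    assume A: "D ! n = East \<and> real (ecount D n) \<le> x \<and> x \<le> real (ecount D n) + 1 \<and> y = real (ncount D n)"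
    then have "i \<le> ecount D (Suc n)" using assms(4) ecount_Suc[OF n(1)] by simp
    then have "hgt D i \<le> ncount D (Suc n)" by (rule hgt_le_ncount[OF assms(2,3)])
    then show ?thesis using A ncount_Suc[OF n(1)] by simp
  next
    assume A: "D ! n = North \<and> x = real (ecount D n) \<and> real (ncount D n) \<le> y \<and> y \<le> real (ncount D n) + 1"
    then have "i \<le> ecount D n" using assms(4) by simp
    then have "hgt D i \<le> ncount D n" by (rule hgt_le_ncount[OF assms(2,3)])
    then show ?thesis using A by simp
  qed
qed

lemma horizontal_path_points:
  assumes "1 \<le> i" "i \<le> b" "real i - 1 \<le> x" "x \<le> real i"
  shows "(x, real (hgt D i)) \<in> path_points D"
proof -
  obtain n where "n < length D" "D ! n = East" "ecount D n = i - 1" "ncount D n = hgt D i"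
    using east_step[OF assms(1,2)] .
  then show ?thesis using assms unfolding mem_path_points by (auto simp: of_nat_diff intro!: exI[of _ n])
qed

lemma vertical_path_points:
  assumes "1 \<le> i" "i < b" "real (hgt D i) \<le> y" "y \<le> real (hgt D (Suc i))"
  shows "(real i, y) \<in> path_points D"
proof -
  obtain e where e: "ecount D e = i - 1" "ecount D (Suc e) = i" "ncount D (Suc e) = hgt D i"
    using east_step[of i] assms by (metis less_imp_le)
  obtain e' where e': "e' < length D" "ecount D e' = i" "ncount D e' = hgt D (Suc i)"
    using east_step[of "Suc i"] assms by (metis Suc_leI diff_Suc_1 le_add1 plus_1_eq_Suc)
  have "Suc e \<le> e'" using ecount_mono[of e' e D] e e' assms by (cases "Suc e \<le> e'") auto
  \<comment> \<open>The last vertex between the two east steps that is no higher than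
    \<open>y\<close>: unless it is the end, the step after it is a north step containing the
    point.\<close>
  let ?A = "{n \<in> {Suc e..e'}. real (ncount D n) \<le> y}"
  have fin: "finite ?A" by (rule finite_subset[of _ "{Suc e..e'}"]) auto
  have "Suc e \<in> ?A" using \<open>Suc e \<le> e'\<close> e assms by auto
  define n where "n = Max ?A"
  have "n \<in> ?A" using Max_in[OF fin] \<open>Suc e \<in> ?A\<close> unfolding n_def by blast
  then have n: "Suc e \<le> n" "n \<le> e'" "real (ncount D n) \<le> y" by auto
  show ?thesis
  proof (cases "n = e'")
    case True
    then have "y = real (hgt D (Suc i))" using n e' assms by simp
    then show ?thesis using horizontal_path_points[of "Suc i" "real i"] assms by simp
  next
    case False
    then have l: "n < length D" "Suc n \<le> e'" using n e' by auto
    have "Suc n \<notin> ?A" using Max_ge[OF fin, of "Suc n"] unfolding n_def[symmetric] by auto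
    then have y: "y < real (ncount D (Suc n))" using l n by auto
    then have "D ! n = North" using ncount_Suc[OF l(1)] n by (auto split: if_splits)
    moreover have "ecount D n = i"
      using ecount_mono[OF n(1), of D] ecount_mono[OF n(2), of D] e e' by simp
    moreover have "ncount D (Suc n) = ncount D n + 1" using ncount_Suc[OF l(1)] calculation by simp
    ultimately show ?thesis using y n(3) l(1) unfolding mem_path_points by (intro exI[of _ n]) auto
  qed
qed

lemma label_eq:
  assumes "1 \<le> i" "i \<le> b" shows "label D \<epsilon> i = (real i, real (hgt D i) - \<epsilon>)"
proof -
  obtain n where "n = east_steps D ! (i - 1)" "ecount D (Suc n) = i" "ncount D (Suc n) = hgt D i"
    using east_step[OF assms] .
  then show ?thesis by (simp add: label_def vertex_eq)
qed

end

text \<open>Over each east step the boundary line is highest at the right end, so these finitely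
  many points decide.\<close>

lemma dyck_paths_iff:
  assumes "0 < b"
  shows "D \<in> dyck_paths a b \<longleftrightarrow> count_list D East = b \<and> count_list D North = a \<and>
    (\<forall>i\<in>{1..b}. a * i \<le> b * hgt D i)"
proof -
  have v: "vertex D (length D) = (real b, real a) \<longleftrightarrow> count_list D East = b \<and> count_list D North = a"
    by (simp add: vertex_def)
  have "(\<forall>(x, y)\<in>path_points D. real a / real b * x \<le> y) \<longleftrightarrow> (\<forall>i\<in>{1..b}. a * i \<le> b * hgt D i)"
    if bD: "count_list D East = b"
  proof
    assume A: "\<forall>(x, y)\<in>path_points D. real a / real b * x \<le> y"
    show "\<forall>i\<in>{1..b}. a * i \<le> b * hgt D i"
    proof
      fix i assume "i \<in> {1..b}"
      then have "(real i, real (hgt D i)) \<in> path_points D" by (intro horizontal_path_points[OF bD]) auto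
      then have "real a / real b * real i \<le> real (hgt D i)" using A by auto
      then have "real (a * i) \<le> real (b * hgt D i)" using assms by (simp add: field_simps)
      then show "a * i \<le> b * hgt D i" by (simp only: of_nat_le_iff)
    qed
  next
    assume A: "\<forall>i\<in>{1..b}. a * i \<le> b * hgt D i"
    show "\<forall>(x, y)\<in>path_points D. real a / real b * x \<le> y"
    proof clarify
      fix x y assume xy: "(x, y) \<in> path_points D"
      note r = path_points_range[OF bD xy]
      show "real a / real b * x \<le> y"
      proof (cases "x = 0")
        case False
        define i where "i = nat \<lceil>x\<rceil>"
        have i: "1 \<le> i" "i \<le> b" "real i - 1 < x" "x \<le> real i"
          using r False unfolding i_def by linarith+
        have "real (a * i) \<le> real (b * hgt D i)" using A i unfolding of_nat_le_iff by auto
        then have "real a / real b * real i \<le> real (hgt D i)" using assms by (simp add: field_simps)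
        moreover have "real a / real b * x \<le> real a / real b * real i" using i by (intro mult_left_mono) auto
        moreover have "real (hgt D i) \<le> y" by (rule path_points_above[OF bD xy i(1-3)])
        ultimately show ?thesis by linarith
      qed (use r in simp)
    qed
  qed
  then show ?thesis unfolding dyck_paths_def mem_Collect_eq v by blast
qed

section \<open>Dyck paths and their valleys\<close>

locale dyck_path =
  fixes a b N :: nat and D :: "step list"
  assumes b_eq: "b = Suc N" and a_pos: "0 < a" and a_less: "a < b" and coprime_ab: "coprime a b" and dyck: "D \<in> dyck_paths a b"
begin

lemma b_pos: "0 < b" using a_less by simp

lemma bD: "count_list D East = b" and aD: "count_list D North = a"
  and hgt_ge: "1 \<le> i \<Longrightarrow> i \<le> b \<Longrightarrow> a * i \<le> b * hgt D i"
  using dyck dyck_paths_iff[OF b_pos] by auto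

lemmas hgt_mono' = hgt_mono[OF bD]

lemma hgt_le: "1 \<le> i \<Longrightarrow> i \<le> b \<Longrightarrow> hgt D i \<le> a"
  using hgt_le_ncount[OF bD, of i "length D"] bD aD by (simp add: ecount_def ncount_def)

lemma hgt_b: "hgt D b = a"
proof -
  have "b * a \<le> b * hgt D b" using hgt_ge[of b] b_pos by (simp add: mult.commute)
  then show ?thesis using hgt_le[of b] b_pos by simp
qed

lemma valleys_eq: "valleys D = {(real p, real (hgt D p)) |p. 1 \<le> p \<and> p < b \<and> hgt D p < hgt D (Suc p)}"
proof (intro subset_antisym subsetI)
  fix P assume "P \<in> valleys D"
  then obtain n where n: "P = vertex D (Suc n)" "Suc n < length D" "D ! n = East" "D ! Suc n = North"
    by (auto simp: valleys_def)
  define p where "p = ecount D (Suc n)"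
  have p: "1 \<le> p" "p \<le> b" "ecount D n = p - 1" using ecount_Suc[of n D] n ecount_le[OF bD, of "Suc n"] by (auto simp: p_def)
  have "hgt D p \<le> ncount D (Suc n)" by (rule hgt_le_ncount[OF bD]) (use p in \<open>auto simp: p_def\<close>)
  moreover have "ncount D n \<le> hgt D p" by (rule ncount_le_hgt[OF bD]) (use p in auto)
  ultimately have h: "ncount D (Suc n) = hgt D p" using ncount_Suc[of n D] n by simp
  have n2: "ecount D (Suc (Suc n)) = p" "ncount D (Suc (Suc n)) = Suc (hgt D p)"
    using ecount_Suc[of "Suc n" D] ncount_Suc[of "Suc n" D] n h by (auto simp: p_def)
  have "p \<noteq> b"
  proof
    assume "p = b"
    then have "ncount D (Suc (Suc n)) = Suc a" using n2 hgt_b by simp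
    moreover have "ncount D (Suc (Suc n)) \<le> a"
      using count_take_mono[of "Suc (Suc n)" "max (Suc (Suc n)) (length D)" D North] aD by (simp add: ncount_def)
    ultimately show False by simp
  qed
  then have "p < b" using p by simp
  moreover have "Suc (hgt D p) \<le> hgt D (Suc p)"
    using ncount_le_hgt[OF bD, of "Suc p" "Suc (Suc n)"] n2 \<open>p < b\<close> by simp
  ultimately show "P \<in> {(real p, real (hgt D p)) |p. 1 \<le> p \<and> p < b \<and> hgt D p < hgt D (Suc p)}"
    using n(1) p h by (auto simp: vertex_eq p_def)
next
  fix P assume "P \<in> {(real p, real (hgt D p)) |p. 1 \<le> p \<and> p < b \<and> hgt D p < hgt D (Suc p)}"
  then obtain p where p: "P = (real p, real (hgt D p))" "1 \<le> p" "p < b" "hgt D p < hgt D (Suc p)" by blast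
  obtain n where n: "n < length D" "D ! n = East" "ecount D n = p - 1" "ecount D (Suc n) = p" "ncount D (Suc n) = hgt D p"
    using east_step[OF bD p(2)] p by (metis less_imp_le)
  have "Suc n < length D"
  proof (rule ccontr)
    assume "\<not> Suc n < length D"
    then have "ecount D (Suc n) = b" using bD n by (simp add: ecount_def)
    then show False using n p by simp
  qed
  moreover have "D ! Suc n = North"
  proof (rule ccontr)
    assume "D ! Suc n \<noteq> North"
    then have "D ! Suc n = East" by (cases "D ! Suc n") auto
    then have "ecount D (Suc (Suc n)) = Suc p" "ncount D (Suc (Suc n)) = hgt D p"
      using ecount_Suc[of "Suc n" D] ncount_Suc[of "Suc n" D] n \<open>Suc n < length D\<close> by auto
    then show False using hgt_le_ncount[OF bD, of "Suc p" "Suc (Suc n)"] p by simp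
  qed
  ultimately show "P \<in> valleys D" using p n by (auto simp: valleys_def vertex_eq)
qed

end

section \<open>The region cut off by a laser\<close>

context dyck_path begin

context
  fixes p :: nat
  assumes p: "1 \<le> p" "p < b" "hgt D p < hgt D (Suc p)"
begin

definition line :: "real \<Rightarrow> real" where
  "line x = real (hgt D p) + real a / real b * (x - real p)"

text \<open>The number of the east step on which the laser ends, the first one whose right endpoint
  is not above the laser line.\<close>

definition stop :: nat where
  "stop = (LEAST q. p < q \<and> real (hgt D q) \<le> line (real q))"

lemma line_mono: "x \<le> y \<Longrightarrow> line x \<le> line y"
  using mult_left_mono[of "x - real p" "y - real p" "real a / real b"] by (simp add: line_def)

lemma line_strict_mono: "x < y \<Longrightarrow> line x < line y"
  using a_pos b_pos mult_strict_left_mono[of "x - real p" "y - real p" "real a / real b"] by (simp add: line_def)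

lemma line_less_iff: "line x < line y \<longleftrightarrow> x < y"
  using line_mono line_strict_mono by (metis not_less)

lemma line_p: "line (real p) = real (hgt D p)" by (simp add: line_def)

lemma stop: "p < stop" "stop \<le> b" "real (hgt D stop) \<le> line (real stop)"
  and before_stop: "p < i \<Longrightarrow> i < stop \<Longrightarrow> line (real i) < real (hgt D i)"
proof -
  have "real (a * p) \<le> real (b * hgt D p)" unfolding of_nat_le_iff using hgt_ge p by simp
  then have "real (hgt D b) \<le> line (real b)" using b_pos by (simp add: line_def hgt_b field_simps)
  then have w: "p < b \<and> real (hgt D b) \<le> line (real b)" using p by simp
  show "p < stop" "real (hgt D stop) \<le> line (real stop)" using LeastI[of "\<lambda>q. p < q \<and> real (hgt D q) \<le> line (real q)", OF w] by (auto simp: stop_def)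
  show "stop \<le> b" unfolding stop_def
    by (rule Least_le[of "\<lambda>q. p < q \<and> real (hgt D q) \<le> line (real q)", OF w])
  show "p < i \<Longrightarrow> i < stop \<Longrightarrow> line (real i) < real (hgt D i)"
    using not_less_Least[of i "\<lambda>q. p < q \<and> real (hgt D q) \<le> line (real q)"] unfolding stop_def by auto
qed

text \<open>Equality would make \<open>b\<close> divide \<open>a * (stop - p)\<close>, hence
  \<open>stop - p\<close>, which is positive and less than \<open>b\<close>.\<close>

lemma stop_strict: "real (hgt D stop) < line (real stop)"
proof -
  have "real (hgt D stop) \<noteq> line (real stop)"
  proof
    assume "real (hgt D stop) = line (real stop)"
    then have "real b * (real (hgt D stop) - real (hgt D p)) = real a * (real stop - real p)"
      using b_pos by (simp add: line_def field_simps)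
    then have "int b * (int (hgt D stop) - int (hgt D p)) = int a * (int stop - int p)"
      by (metis (mono_tags, lifting) of_int_eq_iff of_int_diff of_int_mult of_int_of_nat_eq)
    then have "int b dvd int a * (int stop - int p)" by (metis dvd_triv_left)
    then have "int b dvd int stop - int p" using coprime_ab
      by (simp add: coprime_dvd_mult_right_iff coprime_commute)
    then have "int b \<le> int stop - int p" using stop(1) by (intro zdvd_imp_le) auto
    then show False using stop(2) p by simp
  qed
  then show ?thesis using stop(3) by simp
qed

text \<open>The laser has slope less than 1, while the path rises by at least 1 at a valley.\<close>

lemma Suc_p_less_stop: "Suc p < stop"
proof (rule ccontr)
  assume "\<not> Suc p < stop"
  then have "stop = Suc p" using stop(1) by simp
  then have "real (hgt D p) + 1 \<le> line (real (Suc p))" using stop(3) p(3) by simp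
  then show False using a_less b_pos by (simp add: line_def)
qed

text \<open>The solution \<open>x\<close> of \<open>line x = real (hgt D stop)\<close>: the laser
  meets the interior of the east step \<open>stop\<close>.\<close>

definition laser_end :: real where
  "laser_end = real p + real b / real a * (real (hgt D stop) - real (hgt D p))"

lemma line_laser_end: "line laser_end = real (hgt D stop)"
  using a_pos b_pos by (simp add: line_def laser_end_def)

lemma laser_end_less: "laser_end < real stop"
  using stop_strict line_less_iff line_laser_end by metis

lemma less_laser_end: "p < i \<Longrightarrow> i < stop \<Longrightarrow> real i < laser_end"
proof -
  assume i: "p < i" "i < stop"
  have "line (real i) < real (hgt D i)" using before_stop[OF i] .
  also have "\<dots> \<le> real (hgt D stop)" using hgt_mono'[of i stop] i stop(2) by simp
  finally show ?thesis using line_less_iff line_laser_end by metis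
qed

lemma p_less_laser_end: "real p < laser_end"
  using less_laser_end[of "Suc p"] Suc_p_less_stop by simp

lemma stop_pred_less: "real stop - 1 < laser_end"
proof -
  have "Suc (stop - 1) = stop" "p < stop - 1" "stop - 1 < stop" using Suc_p_less_stop by auto
  then show ?thesis using less_laser_end[of "stop - 1"] by (simp add: of_nat_diff)
qed

lemma ceiling_index:
  assumes "real p < x" "x \<le> real b"
  obtains i where "1 \<le> i" "i \<le> b" "p < i" "real i - 1 < x" "x \<le> real i"
proof
  have "0 < x" using assms(1) by (meson of_nat_0_le_iff order.strict_trans1)
  show "1 \<le> nat \<lceil>x\<rceil>" "nat \<lceil>x\<rceil> \<le> b" "p < nat \<lceil>x\<rceil>" "real (nat \<lceil>x\<rceil>) - 1 < x" "x \<le> real (nat \<lceil>x\<rceil>)"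
    using assms \<open>0 < x\<close> by linarith+
qed

lemma laser_end_le_b: "laser_end \<le> real b" using laser_end_less stop(2) by linarith

lemma line_not_path:
  assumes "real p < x" "x < laser_end" shows "(x, line x) \<notin> path_points D"
proof
  assume xy: "(x, line x) \<in> path_points D"
  obtain i where i: "1 \<le> i" "i \<le> b" "p < i" "real i - 1 < x" "x \<le> real i"
    using ceiling_index assms laser_end_le_b by (metis less_imp_le order_trans)
  have "real (hgt D i) \<le> line x" by (rule path_points_above[OF bD xy i(1,2,4)])
  moreover have "line x < real (hgt D i)"
  proof (cases "i < stop")
    case True
    then show ?thesis using before_stop[OF i(3)] line_mono[OF i(5)] by simp
  next
    case False
    have "line x < line laser_end" using assms(2) by (rule line_strict_mono)
    also have "\<dots> = real (hgt D stop)" by (rule line_laser_end)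
    also have "\<dots> \<le> real (hgt D i)" using hgt_mono'[of stop i] False i Suc_p_less_stop by simp
    finally show ?thesis .
  qed
  ultimately show False by simp
qed

lemma laser_eq: "laser a b D (real p, real (hgt D p)) = {(x, line x) |x. real p \<le> x \<and> x \<le> laser_end}"
proof -
  have pt: "(real p, real (hgt D p)) + t *\<^sub>R (real b, real a) = (real p + t * real b, line (real p + t * real b))" for t
    using b_pos by (simp add: line_def)
  let ?t = "(laser_end - real p) / real b"
  have t: "0 < ?t" "real p + ?t * real b = laser_end" using p_less_laser_end b_pos by auto
  show ?thesis
  proof (intro subset_antisym subsetI)
    fix z assume "z \<in> laser a b D (real p, real (hgt D p))"
    then obtain t where z: "z = (real p + t * real b, line (real p + t * real b))" "0 \<le> t"
      "\<And>s. 0 < s \<Longrightarrow> s < t \<Longrightarrow> (real p + s * real b, line (real p + s * real b)) \<notin> path_points D"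
      unfolding laser_def pt by blast
    have "t \<le> ?t"
    proof (rule ccontr)
      assume "\<not> t \<le> ?t"
      then have "(laser_end, line laser_end) \<notin> path_points D" using z(3)[of ?t] t by simp
      moreover have "(laser_end, line laser_end) \<in> path_points D"
        unfolding line_laser_end
        by (rule horizontal_path_points[OF bD]) (use Suc_p_less_stop stop(2) laser_end_less stop_pred_less in auto)
      ultimately show False by simp
    qed
    then have "real p + t * real b \<le> laser_end" using b_pos by (simp add: field_simps)
    then show "z \<in> {(x, line x) |x. real p \<le> x \<and> x \<le> laser_end}" using z by auto
  next
    fix z assume "z \<in> {(x, line x) |x. real p \<le> x \<and> x \<le> laser_end}"
    then obtain x where x: "z = (x, line x)" "real p \<le> x" "x \<le> laser_end" by blast
    define t where "t = (x - real p) / real b"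
    have "real p + t * real b = x" "0 \<le> t" using x b_pos by (auto simp: t_def)
    moreover have "(real p + s * real b, line (real p + s * real b)) \<notin> path_points D" if s: "0 < s" "s < t" for s
    proof (rule line_not_path)
      show "real p < real p + s * real b" using s b_pos by simp
      have "s * real b < t * real b" using s b_pos by simp
      then show "real p + s * real b < laser_end" using \<open>real p + t * real b = x\<close> x by linarith
    qed
    ultimately show "z \<in> laser a b D (real p, real (hgt D p))"
      unfolding laser_def pt using x(1) by blast
  qed
qed

section \<open>The enclosed region and its frontier\<close>

definition barrier :: "(real \<times> real) set" where
  "barrier = path_points D \<union> {(x, line x) |x. real p \<le> x \<and> x \<le> laser_end}"

text \<open>Points above the laser and below the path: a bound by \<open>hgt D i\<close> for every
  \<open>i\<close> not left of the point is a bound by the east step over it. As a finite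
  intersection of unions of open half-planes the set is visibly open.\<close>

definition region :: "(real \<times> real) set" where
  "region = {z. real p < fst z \<and> fst z < laser_end \<and> line (fst z) < snd z} \<inter>
     (\<Inter>i\<in>{1..b}. {z. real i < fst z} \<union> {z. snd z < real (hgt D i)})"

lemma mem_region: "(x, y) \<in> region \<longleftrightarrow> real p < x \<and> x < laser_end \<and> line x < y \<and>
    (\<forall>i\<in>{1..b}. real i < x \<or> y < real (hgt D i))"
  by (auto simp: region_def)

lemma continuous_line: "continuous_on S (\<lambda>z. line (fst z))"
  unfolding line_def by (intro continuous_intros)

lemma open_region: "open region"
  unfolding region_def
  by (intro open_Int open_INT open_Un ballI finite_atLeastAtMost open_Collect_conj open_Collect_less
      continuous_line continuous_intros)

text \<open>Weakening all inequalities gives a closed superset. A point of it outside the region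
  turns one inequality into an equality: on the left side it lies on the vertical run of the valley,
  on the right side at the end of the laser, otherwise on the laser or on the path above.\<close>

lemma frontier_region: "frontier region \<subseteq> barrier"
proof -
  let ?C = "{z. real p \<le> fst z \<and> fst z \<le> laser_end \<and> line (fst z) \<le> snd z} \<inter>
     (\<Inter>i\<in>{1..b}. {z. real i \<le> fst z} \<union> {z. snd z \<le> real (hgt D i)})"
  have cl: "closed ?C"
    by (intro closed_Int closed_INT closed_Un ballI closed_Collect_conj closed_Collect_le
        continuous_line continuous_intros)
  have sub: "region \<subseteq> ?C"
  proof
    fix z assume z: "z \<in> region"
    have "real i \<le> fst z \<or> snd z \<le> real (hgt D i)" if "i \<in> {1..b}" for i
    proof -
      have "real i < fst z \<or> snd z < real (hgt D i)" using z that unfolding region_def by blast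
      then show ?thesis by linarith
    qed
    moreover have "real p < fst z \<and> fst z < laser_end \<and> line (fst z) < snd z"
      using z unfolding region_def by blast
    ultimately show "z \<in> ?C" by auto
  qed
  have "closure region \<subseteq> ?C" by (rule closure_minimal[OF sub cl])
  moreover have "(x, y) \<in> barrier" if C: "(x, y) \<in> ?C" and U: "(x, y) \<notin> region" for x y
  proof -
    have c: "real p \<le> x" "x \<le> laser_end" "line x \<le> y" using C by auto
    have "\<forall>i\<in>{1..b}. real i \<le> x \<or> y \<le> real (hgt D i)" using C by auto
    then have ci: "y \<le> real (hgt D i)" if "i \<in> {1..b}" "x < real i" for i using that by fastforce
    consider "x = real p" | "x = laser_end" | "real p < x" "x < laser_end" using c by linarith
    then show ?thesis
    proof cases
      case 1
      then have "y \<le> real (hgt D (Suc p))" using ci[of "Suc p"] p by simp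
      moreover have "real (hgt D p) \<le> y" using c(3) 1 line_p by simp
      ultimately show ?thesis using vertical_path_points[OF bD p(1,2)] 1 by (simp add: barrier_def)
    next
      case 2
      have "y = real (hgt D stop)"
        using ci[of stop] c(3) 2 line_laser_end laser_end_less stop(1,2) p by force
      then show ?thesis
        using horizontal_path_points[OF bD, of stop x] 2 laser_end_less stop_pred_less stop p
        by (simp add: barrier_def)
    next
      case 3
      show ?thesis
      proof (cases "line x = y")
        case True
        then show ?thesis using c by (auto simp: barrier_def)
      next
        case False
        then obtain i where i: "i \<in> {1..b}" "x \<le> real i" "real (hgt D i) \<le> y"
          using U 3 c(3) unfolding mem_region by force
        obtain k where k: "1 \<le> k" "k \<le> b" "p < k" "real k - 1 < x" "x \<le> real k"
          using ceiling_index[OF 3(1)] 3 laser_end_le_b by (metis less_imp_le order_trans)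
        have "k \<le> i" using k(4) i(2) by linarith
        then have ky: "real (hgt D k) \<le> y" using hgt_mono'[of k i] k i by simp
        show ?thesis
        proof (cases "x = real k")
          case True
          then have "k < stop" using 3 laser_end_less by simp
          then have "k < b" using stop(2) by simp
          then have "y \<le> real (hgt D (Suc k))" using ci[of "Suc k"] True by simp
          then show ?thesis using vertical_path_points[OF bD k(1) \<open>k < b\<close> ky] True by (simp add: barrier_def)
        next
          case False
          then have "y \<le> real (hgt D k)" using ci[of k] k by simp
          then have "y = real (hgt D k)" using ky by simp
          then show ?thesis using horizontal_path_points[OF bD k(1,2), of x] k by (simp add: barrier_def)
        qed
      qed
    qed
  qed
  ultimately show ?thesis unfolding frontier_def interior_open[OF open_region] by fast
qed

lemma region_avoids: "region \<subseteq> - barrier"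
proof
  fix z assume z: "z \<in> region"
  obtain x y where xy: "z = (x, y)" by force
  have r: "real p < x" "x < laser_end" "line x < y" "\<forall>i\<in>{1..b}. real i < x \<or> y < real (hgt D i)"
    using z unfolding xy mem_region by auto
  obtain i where i: "1 \<le> i" "i \<le> b" "p < i" "real i - 1 < x" "x \<le> real i"
    using ceiling_index[OF r(1)] r(2) laser_end_le_b by (metis less_imp_le order_trans)
  have "(x, y) \<notin> path_points D"
  proof
    assume "(x, y) \<in> path_points D"
    then have "real (hgt D i) \<le> y" using path_points_above[OF bD _ i(1,2,4)] by simp
    moreover have "real i < x \<or> y < real (hgt D i)" using bspec[OF r(4), of i] i(1,2) by simp
    ultimately show False using i(5) by linarith
  qed
  then show "z \<in> - barrier" using r(3) by (auto simp: xy barrier_def)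
qed

section \<open>Labels inside and outside the region\<close>

lemma label_in_region:
  assumes "p < i" "i < stop" "0 < \<epsilon>" "line (real i) < real (hgt D i) - \<epsilon>"
  shows "label D \<epsilon> i \<in> region"
proof -
  have i: "1 \<le> i" "i \<le> b" using assms stop(2) by auto
  have "real k < real i \<or> real (hgt D i) - \<epsilon> < real (hgt D k)" if k: "k \<in> {1..b}" for k
  proof (cases "k < i")
    case False
    then have "real (hgt D i) \<le> real (hgt D k)" using hgt_mono'[of i k] k i by simp
    then show ?thesis using assms(3) by linarith
  qed simp
  then show ?thesis unfolding label_eq[OF bD i] mem_region using assms less_laser_end[OF assms(1,2)] by auto
qed

lemma label_out_region:
  assumes "1 \<le> i" "i \<le> b" "\<not> (p < i \<and> i < stop)"
  shows "label D \<epsilon> i \<notin> region"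
  unfolding label_eq[OF bD assms(1,2)] mem_region using assms(3) laser_end_less by auto

lemma inside_connected_Suc:
  assumes "p < i" "Suc i < stop" "0 < \<epsilon>" "line (real i) < real (hgt D i) - \<epsilon>"
    "line (real (Suc i)) < real (hgt D (Suc i)) - \<epsilon>"
  shows "connected_component (- barrier) (label D \<epsilon> i) (label D \<epsilon> (Suc i))"
proof (rule connected_componentI)
  have i: "1 \<le> i" "i \<le> b" "1 \<le> Suc i" "Suc i \<le> b" using assms stop(2) by auto
  let ?S = "closed_segment (label D \<epsilon> i) (label D \<epsilon> (Suc i))"
  show "connected ?S" by simp
  show "label D \<epsilon> i \<in> ?S" "label D \<epsilon> (Suc i) \<in> ?S" by auto
  have "?S \<subseteq> region"
  proof
    fix z assume "z \<in> ?S"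
    then obtain u where u: "0 \<le> u" "u \<le> 1"
      and z: "z = (1 - u) *\<^sub>R label D \<epsilon> i + u *\<^sub>R label D \<epsilon> (Suc i)"
      by (auto simp: in_segment)
    define y where "y = (1 - u) * (real (hgt D i) - \<epsilon>) + u * (real (hgt D (Suc i)) - \<epsilon>)"
    have ze: "z = (real i + u, y)"
      unfolding z label_eq[OF bD i(1,2)] label_eq[OF bD i(3,4)] y_def by (simp add: algebra_simps)
    have le: "line (real i + u) = (1 - u) * line (real i) + u * line (real (Suc i))"
    proof -
      have "h + c * (x + u - q) = (1 - u) * (h + c * (x - q)) + u * (h + c * (1 + x - q))" for c h x q :: real
        by (simp add: algebra_simps)
      then show ?thesis unfolding line_def of_nat_Suc by blast
    qed
    have "line (real i + u) < y"
    proof (cases "u = 0")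
      case False
      then have "(1 - u) * line (real i) + u * line (real (Suc i)) < y"
        unfolding y_def using assms(4,5) u by (intro add_le_less_mono mult_left_mono mult_strict_left_mono) auto
      then show ?thesis using le by simp
    qed (use assms(4) in \<open>simp add: y_def\<close>)
    moreover have "real p < real i + u" using assms u by simp
    moreover have "real i + u < laser_end" using less_laser_end[of "Suc i"] assms u by simp
    moreover have "y < real (hgt D k)" if k: "k \<in> {1..b}" "\<not> real k < real i + u" for k
    proof (cases "u = 0")
      case True
      then show ?thesis using hgt_mono'[of i k] k i assms(3) by (simp add: y_def)
    next
      case False
      then have "Suc i \<le> k" using k u by linarith
      then have "real (hgt D (Suc i)) \<le> real (hgt D k)" using hgt_mono'[of "Suc i" k] k by simp
      moreover have "y \<le> real (hgt D (Suc i)) - \<epsilon>"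
      proof -
        have "real (hgt D i) \<le> real (hgt D (Suc i))" using hgt_mono'[of i "Suc i"] i by simp
        then have "y \<le> (1 - u) * (real (hgt D (Suc i)) - \<epsilon>) + u * (real (hgt D (Suc i)) - \<epsilon>)"
          unfolding y_def using u by (intro add_right_mono mult_left_mono) auto
        then show ?thesis by (simp add: algebra_simps)
      qed
      ultimately show ?thesis using assms(3) by linarith
    qed
    \<comment> \<open>The segment stays above the laser because the laser is straight, and below the
      path because the heights do not decrease.\<close>
    ultimately show "z \<in> region" unfolding ze mem_region by blast
  qed
  then show "?S \<subseteq> - barrier" using region_avoids by blast
qed

text \<open>No part of the laser lies below such a label; for \<open>i = p\<close> the label is
  below the starting point. A vertical descent to height \<open>- 1\<close>, under the whole
  barrier, joins all these labels to one base point.\<close>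

lemma outside_connected:
  assumes "1 \<le> i" "i \<le> b" "\<not> (p < i \<and> i < stop)" "0 < \<epsilon>"
  shows "connected_component (- barrier) (label D \<epsilon> i) (0, - 1)"
proof -
  have "connected_component (- barrier) (label D \<epsilon> i) (real i, - 1)"
  proof (rule connected_componentI)
    let ?S = "closed_segment (label D \<epsilon> i) (real i, - 1)"
    show "connected ?S" by simp
    show "label D \<epsilon> i \<in> ?S" "(real i, - 1) \<in> ?S" by auto
    show "?S \<subseteq> - barrier"
    proof
      fix z assume "z \<in> ?S"
      then obtain u where u: "0 \<le> u" "u \<le> 1" and z: "z = (1 - u) *\<^sub>R label D \<epsilon> i + u *\<^sub>R (real i, - 1)"
        by (auto simp: in_segment)
      define y where "y = (1 - u) * (real (hgt D i) - \<epsilon>) + u * (- 1)"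
      have ze: "z = (real i, y)"
        unfolding z label_eq[OF bD assms(1,2)] y_def by (simp add: algebra_simps)
      have "y < real (hgt D i)"
      proof (cases "u = 0")
        case False
        have "(1 - u) * (real (hgt D i) - \<epsilon>) + u * (- 1) < (1 - u) * real (hgt D i) + u * real (hgt D i)"
          using u False assms(4) by (intro add_le_less_mono mult_left_mono mult_strict_left_mono) auto
        then show ?thesis by (simp add: y_def algebra_simps)
      qed (use assms(4) in \<open>simp add: y_def\<close>)
      then have "(real i, y) \<notin> path_points D"
        using path_points_above[OF bD _ assms(1,2), of "real i" y] by auto
      moreover have "\<not> (real p \<le> real i \<and> real i \<le> laser_end \<and> y = line (real i))"
      proof
        assume A: "real p \<le> real i \<and> real i \<le> laser_end \<and> y = line (real i)"
        then have "i < stop" using laser_end_less by simp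
        then have "i = p" using A assms(3) by simp
        then show False using A line_p \<open>y < real (hgt D i)\<close> by simp
      qed
      ultimately show "z \<in> - barrier" by (auto simp: ze barrier_def)
    qed
  qed
  moreover have "connected_component (- barrier) (real i, - 1) (0, - 1)"
  proof (rule connected_componentI)
    let ?S = "closed_segment (real i, - 1) (0, - 1) :: (real \<times> real) set"
    show "connected ?S" by simp
    show "(real i, - 1) \<in> ?S" "(0, - 1) \<in> ?S" by auto
    show "?S \<subseteq> - barrier"
    proof
      fix z assume "z \<in> ?S"
      then have y: "snd z = - 1" by (auto simp: in_segment algebra_simps)
      obtain x where z: "z = (x, - 1)" using y by (cases z) auto
      have "(x, - 1) \<notin> path_points D" using path_points_range(3)[OF bD, of x "- 1"] by auto
      moreover have "line x \<noteq> - 1" if "real p \<le> x"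
        using line_mono[OF that] line_p by (smt (verit) of_nat_0_le_iff)
      ultimately show "z \<in> - barrier" by (auto simp: z barrier_def)
    qed
  qed
  ultimately show ?thesis by (rule connected_component_trans)
qed

lemma separated_iff:
  assumes ij: "i \<in> {1..N}" "j \<in> {1..N}"
  shows "separated D (laser a b D (real p, real (hgt D p))) i j \<longleftrightarrow> ((p < i \<and> i < stop) \<noteq> (p < j \<and> j < stop))"
proof -
  have bar: "path_points D \<union> laser a b D (real p, real (hgt D p)) = barrier"
    unfolding laser_eq barrier_def ..
  let ?cc = "\<lambda>\<epsilon> i j. connected_component (- barrier) (label D \<epsilon> i) (label D \<epsilon> j)"
  have i: "1 \<le> i" "i \<le> b" and j: "1 \<le> j" "j \<le> b" using ij b_eq by auto
  \<comment> \<open>Covered labels have to stay above the laser after being lowered. There are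
    finitely many of them, so all small lowerings do.\<close>
  have small: "\<forall>\<^sub>F \<epsilon> in at_right 0. 0 < \<epsilon> \<and> (\<forall>k\<in>{p<..<stop}. line (real k) < real (hgt D k) - \<epsilon>)"
  proof (intro eventually_conj eventually_ball_finite ballI)
    show "\<forall>\<^sub>F \<epsilon> in at_right (0 :: real). 0 < \<epsilon>" by (rule eventually_at_right_less)
    fix k assume "k \<in> {p<..<stop}"
    then have "line (real k) < real (hgt D k)" using before_stop by simp
    then have "0 < real (hgt D k) - line (real k)" by simp
    then have "\<forall>\<^sub>F \<epsilon> in at_right 0. \<epsilon> < real (hgt D k) - line (real k)"
      by (intro eventually_at_right_less eventually_at_rightI[of 0]) auto
    then show "\<forall>\<^sub>F \<epsilon> in at_right 0. line (real k) < real (hgt D k) - \<epsilon>"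
      by eventually_elim linarith
  qed simp
  have ncc: "\<not> ?cc \<epsilon> k l" if k: "label D \<epsilon> k \<in> region" and l: "label D \<epsilon> l \<notin> region" for \<epsilon> k l
  proof
    assume "?cc \<epsilon> k l"
    then obtain T where T: "connected T" "T \<subseteq> - barrier" "label D \<epsilon> k \<in> T" "label D \<epsilon> l \<in> T"
      unfolding connected_component_def by blast
    then have "T \<inter> frontier region \<noteq> {}" using k l by (intro connected_Int_frontier) auto
    then show False using frontier_region T(2) by blast
  qed
  have not_sep: "\<not> separated D (laser a b D (real p, real (hgt D p))) i j"
    if "\<forall>\<^sub>F \<epsilon> in at_right 0. ?cc \<epsilon> i j"
  proof
    assume "separated D (laser a b D (real p, real (hgt D p))) i j"
    then have "\<forall>\<^sub>F \<epsilon> in at_right 0. \<not> ?cc \<epsilon> i j" unfolding separated_def bar .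
    with that have "\<forall>\<^sub>F \<epsilon> in at_right (0 :: real). False" by eventually_elim blast
    then show False by simp
  qed
  have chain: "?cc \<epsilon> k (k + n)" if "0 < \<epsilon>" "\<forall>k\<in>{p<..<stop}. line (real k) < real (hgt D k) - \<epsilon>" "p < k" "k + n < stop" for \<epsilon> k n
    using that(4)
  proof (induction n)
    case 0
    have "label D \<epsilon> k \<in> - barrier" using label_in_region[of k \<epsilon>] region_avoids that 0 by auto
    then show ?case by simp
  next
    case (Suc n)
    then have "?cc \<epsilon> k (k + n)" by simp
    moreover have "?cc \<epsilon> (k + n) (Suc (k + n))"
      by (rule inside_connected_Suc[OF _ _ that(1) bspec[OF that(2)] bspec[OF that(2)]])
         (use that(3) Suc.prems in auto)
    ultimately show ?case using connected_component_trans by fastforce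
  qed
  consider "p < i \<and> i < stop" "p < j \<and> j < stop" | "\<not> (p < i \<and> i < stop)" "\<not> (p < j \<and> j < stop)"
    | "p < i \<and> i < stop" "\<not> (p < j \<and> j < stop)" | "\<not> (p < i \<and> i < stop)" "p < j \<and> j < stop" by blast
  then show ?thesis
  proof cases
    case 1
    have "\<forall>\<^sub>F \<epsilon> in at_right 0. ?cc \<epsilon> i j"
      using small
    proof eventually_elim
      case (elim \<epsilon>)
      show ?case
      proof (cases "i \<le> j")
        case True
        then show ?thesis using chain[of \<epsilon> i "j - i"] elim 1 by simp
      next
        case False
        then have "?cc \<epsilon> j i" using chain[of \<epsilon> j "i - j"] elim 1 by simp
        then show ?thesis by (rule connected_component_sym)
      qed
    qed
    then show ?thesis using not_sep 1 by blast
  next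
    case 2
    have "\<forall>\<^sub>F \<epsilon> in at_right 0. ?cc \<epsilon> i j"
      using small
    proof eventually_elim
      case (elim \<epsilon>)
      then show ?case
        using outside_connected[OF i 2(1)] outside_connected[OF j 2(2)]
        by (meson connected_component_sym connected_component_trans)
    qed
    then show ?thesis using not_sep 2 by blast
  next
    case 3
    have "\<forall>\<^sub>F \<epsilon> in at_right 0. \<not> ?cc \<epsilon> i j"
      using small
    proof eventually_elim
      case (elim \<epsilon>)
      then show ?case using ncc label_in_region[of i \<epsilon>] label_out_region[OF j 3(2)] 3 by auto
    qed
    then show ?thesis using 3 unfolding separated_def bar by blast
  next
    case 4
    have "\<forall>\<^sub>F \<epsilon> in at_right 0. \<not> ?cc \<epsilon> i j"
      using small
    proof eventually_elim
      case (elim \<epsilon>)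
      then have "\<not> ?cc \<epsilon> j i" using ncc label_in_region[of j \<epsilon>] label_out_region[OF i 4(1)] 4 by auto
      then show ?case using connected_component_sym by blast
    qed
    then show ?thesis using 4 unfolding separated_def bar by blast
  qed
qed

end
end

section \<open>Dyck paths as words\<close>

definition path_of :: "nat list \<Rightarrow> step list" where
  "path_of vs = concat (map (\<lambda>v. replicate v North @ [East]) vs)"

lemma path_of_snoc: "path_of (vs @ [v]) = (path_of vs @ replicate v North) @ [East]"
  by (simp add: path_of_def)

lemma count_list_replicate_other: "s \<noteq> t \<Longrightarrow> count_list (replicate n s) t = 0"
  by (induction n) auto

lemma count_list_replicate_same: "count_list (replicate n s) s = n"
  by (induction n) auto

lemma count_path_of: "count_list (path_of vs) East = length vs" "count_list (path_of vs) North = sum_list vs"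
  by (induction vs)
     (auto simp: path_of_def count_list_replicate_other count_list_replicate_same)

lemma east_steps_replicate: "east_steps (D @ replicate n North) = east_steps D"
proof (induction n)
  case (Suc n)
  have "D @ replicate (Suc n) North = (D @ replicate n North) @ [North]" by (simp add: replicate_append_same)
  then show ?case using Suc by (simp only: east_steps_snoc) simp
qed simp

lemma hgt_path_of: "1 \<le> i \<Longrightarrow> i \<le> length vs \<Longrightarrow> hgt (path_of vs) i = sum_list (take i vs)"
proof (induction vs rule: rev_induct)
  case (snoc v vs)
  let ?D = "path_of vs" and ?D' = "path_of (vs @ [v])"
  have es: "east_steps ?D' = east_steps ?D @ [length ?D + v]"
    unfolding path_of_snoc east_steps_snoc east_steps_replicate by simp
  have len: "length (east_steps ?D) = length vs" by (simp add: length_east_steps count_path_of)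
  show ?case
  proof (cases "i \<le> length vs")
    case True
    have "i - 1 < count_list ?D East" using True snoc.prems by (simp add: count_path_of)
    then have "east_steps ?D ! (i - 1) < length ?D" by (rule east_steps_nth)
    then have "hgt ?D' i = hgt ?D i"
      using True snoc.prems len unfolding hgt_def es ncount_def by (simp add: nth_append path_of_snoc)
    then show ?thesis using snoc True by simp
  next
    case False
    then have i: "i = Suc (length vs)" using snoc.prems by simp
    have "hgt ?D' i = count_list (?D @ replicate v North) North"
      unfolding hgt_def es ncount_def i using len by (simp add: nth_append path_of_snoc)
    then show ?thesis using i by (simp add: count_path_of count_list_replicate_same)
  qed
qed simp

section \<open>The word of a Dyck path\<close>

context dyck_path begin

sublocale S: slope "int a" "int b" "int N"
  by unfold_locales (use a_pos a_less coprime_ab in simp_all, use b_eq in simp)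

text \<open>The origin acts as the end of an east step number 0, so that letter 0 of the word counts
  the north steps on the axis \<open>x = 0\<close>.\<close>

definition hgt0 :: "nat \<Rightarrow> nat" where
  "hgt0 i = (if i = 0 then 0 else hgt D i)"

definition word :: "int \<Rightarrow> nat" where
  "word j = (let r = nat (j mod int N) in hgt0 (Suc r) - hgt0 r)"

lemma hgt0_mono: "i \<le> j \<Longrightarrow> j \<le> b \<Longrightarrow> hgt0 i \<le> hgt0 j"
  using hgt_mono'[of i j] by (auto simp: hgt0_def)

lemma word_nat: "i < N \<Longrightarrow> word (int i) = hgt0 (Suc i) - hgt0 i"
  by (simp add: word_def Let_def flip: of_nat_mod)

lemma ht_word: "i \<le> N \<Longrightarrow> S.ht word (int i) = int b * int (hgt0 i) - int a * int i"
proof (induction i)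
  case (Suc i)
  have "hgt0 i \<le> hgt0 (Suc i)" using hgt0_mono[of i "Suc i"] Suc.prems b_eq by simp
  then have "int (word (int i)) = int (hgt0 (Suc i)) - int (hgt0 i)" using word_nat[of i] Suc.prems by simp
  then have "int b * int (word (int i)) = int b * int (hgt0 (Suc i)) - int b * int (hgt0 i)"
    by (simp add: right_diff_distrib)
  then show ?case using S.ht_step[of word "int i"] Suc by (simp add: algebra_simps)
qed (simp add: hgt0_def)

lemma N_ge: "1 \<le> N" using a_pos a_less b_eq by simp

text \<open>From \<open>b * hgt D N\<close> at least \<open>a * N = b * a - a\<close>, which exceeds
  \<open>b * (a - 1)\<close>. The vertical line \<open>x = N\<close> thus carries no north step, and
  \<open>N\<close> letters suffice.\<close>

lemma hgt_N: "hgt D N = a"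
proof (rule ccontr)
  assume "hgt D N \<noteq> a"
  then have "hgt D N + 1 \<le> a" using hgt_le[of N] N_ge b_eq by simp
  then have "b * (hgt D N + 1) \<le> b * a" by (rule mult_le_mono2)
  moreover have "a * N \<le> b * hgt D N" using hgt_ge[of N] N_ge b_eq by simp
  moreover have "b * a = a * N + a" by (simp add: b_eq)
  moreover have "b * (hgt D N + 1) = b * hgt D N + b" by simp
  ultimately show False using a_less by linarith
qed

lemma word_dyck: "word \<in> S.dyck_words"
proof -
  have per: "periodic (int N) word" by (simp add: periodic_def word_def)
  have "int b * int (psum word (int N)) - int a * int N = int b * int a - int a * int N"
    using S.ht_nonneg_sum[of "int N" word] ht_word[of "N"] hgt_N N_ge by (auto simp: hgt0_def)
  then have full: "S.full word" using per b_pos by (simp add: S.full_def)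
  have "S.root word 0"
  proof (rule S.root_if_window[OF full])
    fix j assume j: "0 < j" "j \<le> 0 + int N"
    define i where "i = nat j"
    have i: "j = int i" "1 \<le> i" "i \<le> N" using j by (auto simp: i_def)
    have "int (a * i) \<le> int (b * hgt D i)" unfolding of_nat_le_iff using hgt_ge i b_eq by simp
    then have "0 \<le> S.ht word j" using ht_word[OF i(3)] i by (simp add: hgt0_def)
    moreover have "S.ht word 0 \<noteq> S.ht word j" using S.ht_inj[of word 0 j] j b_eq by auto
    ultimately show "S.ht word 0 < S.ht word j" by simp
  qed
  then show ?thesis using full by (simp add: S.dyck_words_def)
qed

lemma word_full: "S.full word" and word_root: "S.root word 0"
  using word_dyck by (auto simp: S.dyck_words_def)

text \<open>After clearing denominators, comparing the path with the laser line at a label is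
  comparing the walk with its height at the valley.\<close>

lemma inside_iff:
  assumes p: "1 \<le> p" "p < b" "hgt D p < hgt D (Suc p)" and i: "i \<le> N"
  shows "(p < i \<and> i < stop p) \<longleftrightarrow> p < i \<and> (\<forall>k. int p < k \<and> k \<le> int i \<longrightarrow> S.ht word (int p) < S.ht word k)"
proof -
  have lt: "S.ht word (int p) < S.ht word (int k) \<longleftrightarrow> line p (real k) < real (hgt D k)" if k: "p < k" "k \<le> N" for k
  proof -
    have "S.ht word (int p) < S.ht word (int k) \<longleftrightarrow>
        int b * int (hgt D p) - int a * int p < int b * int (hgt D k) - int a * int k"
      using ht_word[of p] ht_word[of k] k p by (simp add: hgt0_def)
    also have "\<dots> \<longleftrightarrow> real b * real (hgt D p) - real a * real p < real b * real (hgt D k) - real a * real k"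
    proof -
      have "real b * real (hgt D i) - real a * real i = of_int (int b * int (hgt D i) - int a * int i)" for i
        by simp
      then show ?thesis by (simp only: of_int_less_iff)
    qed
    also have "\<dots> \<longleftrightarrow> line p (real k) < real (hgt D k)"
      using b_pos unfolding line_def[OF p] by (simp add: field_simps)
    finally show ?thesis .
  qed
  show ?thesis
  proof
    assume A: "p < i \<and> i < stop p"
    have "S.ht word (int p) < S.ht word k" if k: "int p < k" "k \<le> int i" for k
    proof -
      have "p < nat k" "nat k \<le> i" "int (nat k) = k" using k by auto
      then show ?thesis using lt[of "nat k"] before_stop[OF p, of "nat k"] A i by auto
    qed
    then show "p < i \<and> (\<forall>k. int p < k \<and> k \<le> int i \<longrightarrow> S.ht word (int p) < S.ht word k)" using A by blast
  next
    assume A: "p < i \<and> (\<forall>k. int p < k \<and> k \<le> int i \<longrightarrow> S.ht word (int p) < S.ht word k)"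
    have "i < stop p"
    proof (rule ccontr)
      assume "\<not> i < stop p"
      then have "S.ht word (int p) < S.ht word (int (stop p))" using A stop(1)[OF p] by auto
      then have "line p (real (stop p)) < real (hgt D (stop p))"
        using lt[of "stop p"] stop(1)[OF p] \<open>\<not> i < stop p\<close> i by simp
      then show False using stop(3)[OF p] by simp
    qed
    then show "p < i \<and> i < stop p" using A by simp
  qed
qed

text \<open>All lasers over a label are determined by the innermost one, which starts at the
  previous low; a previous low 0 means that no laser covers the label. So being covered by the same
  lasers amounts to having the same previous low.\<close>

lemma laser_partition_eq: "laser_partition a b D = S.part word"
proof -
  define In where "In p i \<longleftrightarrow> p < i \<and> (\<forall>k. int p < k \<and> k \<le> int i \<longrightarrow> S.ht word (int p) < S.ht word k)" for p i
  have per: "periodic (int N) word" using word_full by (simp add: S.full_def)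
  have sep: "(\<forall>P\<in>valleys D. \<not> separated D (laser a b D P) i j) \<longleftrightarrow>
      (\<forall>p. 1 \<le> p \<and> p < b \<and> hgt D p < hgt D (Suc p) \<longrightarrow> (In p i \<longleftrightarrow> In p j))"
    if ij: "i \<in> {1..N}" "j \<in> {1..N}" for i j
  proof -
    have "\<not> separated D (laser a b D (real p, real (hgt D p))) i j \<longleftrightarrow> (In p i \<longleftrightarrow> In p j)"
      if p: "1 \<le> p" "p < b" "hgt D p < hgt D (Suc p)" for p
    proof -
      have "(p < k \<and> k < stop p) \<longleftrightarrow> In p k" if "k \<in> {1..N}" for k
        unfolding In_def by (rule inside_iff[OF p]) (use that in simp)
      then show ?thesis using separated_iff[OF p ij] ij by presburger
    qed
    then show ?thesis unfolding valleys_eq by blast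
  qed
  have same: "S.rel word (int i) (int j) \<longleftrightarrow> S.same_low word (int i) (int j)"
    if ij: "i \<in> {1..N}" "j \<in> {1..N}" for i j
    by (rule S.rel_window[OF per, of 0]) (use S.root_prev_low_ge[OF word_root] ij in auto)
  have inside: "In p j" if s: "S.same_low word (int i) (int j)" and "In p i" for p i j
  proof -
    have A: "p < i" "\<And>k. int p < k \<Longrightarrow> k \<le> int i \<Longrightarrow> S.ht word (int p) < S.ht word k"
      using \<open>In p i\<close> by (auto simp: In_def)
    obtain t where t: "S.prev_low word t (int i)" using S.full_prev_low_ex[OF word_full] .
    have t': "S.prev_low word t (int j)" using t s by (simp add: S.same_low_def)
    have pt: "int p \<le> t" using S.prev_low_ge[OF t, of "int p"] A(1) A(2)[of "int i"] by simp
    have tt: "t < int i" "t < int j" "S.ht word t < S.ht word (int j)"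
      "\<And>k. t < k \<Longrightarrow> k < int j \<Longrightarrow> S.ht word (int j) \<le> S.ht word k"
      using t t' by (auto simp: S.prev_low_def)
    have pt': "S.ht word (int p) \<le> S.ht word t"
    proof (cases "t = int p")
      case False
      then show ?thesis using A(2)[of t] pt tt(1) by simp
    qed simp
    have "S.ht word (int p) < S.ht word k" if k: "int p < k" "k \<le> int j" for k
    proof -
      consider "k \<le> t" | "t < k" "k < int j" | "k = int j" using k by linarith
      then show ?thesis
      proof cases
        case 1
        then show ?thesis using A(2)[of k] k tt(1) by simp
      next
        case 2
        then show ?thesis using tt(3) tt(4)[of k] pt' by linarith
      qed (use tt(3) pt' in simp)
    qed
    moreover have "p < j" using pt tt by linarith
    ultimately show "In p j" unfolding In_def by blast
  qed
  \<comment> \<open>If the previous low of \<open>j\<close> were the later one, it would be greater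
    than 0, hence a genuine valley, and its laser would cover \<open>j\<close> but not
    \<open>i\<close>.\<close>
  have le: "t \<le> s" if s: "S.prev_low word s (int i)" and t: "S.prev_low word t (int j)"
    and ij: "i \<in> {1..N}" "j \<in> {1..N}"
    and eq: "\<forall>p. 1 \<le> p \<and> p < b \<and> hgt D p < hgt D (Suc p) \<longrightarrow> (In p i \<longleftrightarrow> In p j)" for s t i j
  proof (rule ccontr)
    assume "\<not> t \<le> s"
    then have st: "s < t" by simp
    have "0 \<le> s" using S.root_prev_low_ge[OF word_root _ s] ij by simp
    define p where "p = nat t"
    have tp: "t = int p" using st \<open>0 \<le> s\<close> by (simp add: p_def)
    have t2: "t < int j" "S.ht word t < S.ht word (int j)"
      "\<And>k. t < k \<Longrightarrow> k < int j \<Longrightarrow> S.ht word (int j) \<le> S.ht word k"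
      using t by (auto simp: S.prev_low_def)
    have p1: "1 \<le> p" "p < N" using st \<open>0 \<le> s\<close> tp t2(1) ij by auto
    have "0 < word (int p)" using S.prev_low_succ[OF t] tp S.prev_low_succ_iff by simp
    then have "hgt D p < hgt D (Suc p)" using word_nat[OF p1(2)] p1 by (simp add: hgt0_def)
    then have "In p i \<longleftrightarrow> In p j" using eq p1 b_eq by simp
    moreover have "In p j" unfolding In_def
    proof (intro conjI allI impI)
      show "p < j" using t2 tp by simp
      fix k assume "int p < k \<and> k \<le> int j"
      then show "S.ht word (int p) < S.ht word k"
        using t2(2) t2(3)[of k] tp by (cases "k = int j") auto
    qed
    ultimately have "In p i" by simp
    then have "t < int i" "S.ht word t < S.ht word (int i)" using tp by (auto simp: In_def)
    then have "t \<le> s" using S.prev_low_ge[OF s, of t] by simp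
    then show False using st by simp
  qed
  have main: "(\<forall>P\<in>valleys D. \<not> separated D (laser a b D P) i j) \<longleftrightarrow> S.rel word (int i) (int j)"
    if ij: "i \<in> {1..N}" "j \<in> {1..N}" for i j
    unfolding sep[OF ij] same[OF ij]
  proof
    assume eq: "\<forall>p. 1 \<le> p \<and> p < b \<and> hgt D p < hgt D (Suc p) \<longrightarrow> (In p i \<longleftrightarrow> In p j)"
    obtain s where s: "S.prev_low word s (int i)" using S.full_prev_low_ex[OF word_full] .
    obtain t where t: "S.prev_low word t (int j)" using S.full_prev_low_ex[OF word_full] .
    have eq': "\<forall>p. 1 \<le> p \<and> p < b \<and> hgt D p < hgt D (Suc p) \<longrightarrow> (In p j \<longleftrightarrow> In p i)" using eq by blast
    have "s = t" using le[OF s t ij eq] le[OF t s ij(2,1) eq'] by simp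
    then show "S.same_low word (int i) (int j)" using S.same_low_if_prev_low s t by simp
  next
    assume s: "S.same_low word (int i) (int j)"
    then have s': "S.same_low word (int j) (int i)" by (simp add: S.same_low_def)
    show "\<forall>p. 1 \<le> p \<and> p < b \<and> hgt D p < hgt D (Suc p) \<longrightarrow> (In p i \<longleftrightarrow> In p j)"
      by (intro allI impI iffI) (erule inside[OF s], erule inside[OF s'])
  qed
  have "{(i, j). i \<in> {1..N} \<and> j \<in> {1..N} \<and> (\<forall>P\<in>valleys D. \<not> separated D (laser a b D P) i j)}
      = S.part_rel word"
    unfolding S.part_rel_def nat_int by (intro Collect_cong) (use main in auto)
  moreover have "b - 1 = N" using b_eq by simp
  ultimately show ?thesis unfolding laser_partition_def S.part_def nat_int by simp
qed

end

section \<open>Laser partitions as partitions of full words\<close>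

lemma NC_eq:
  assumes "b = Suc N" "0 < a" "a < b" "coprime a b"
  shows "NC a b = slope.part (int a) (int b) (int N) ` Collect (slope.full (int a) (int N))"
proof -
  interpret S: slope "int a" "int b" "int N"
    by unfold_locales (use assms(2-) in simp_all, use assms(1) in simp)
  have "NC a b = S.part ` S.dyck_words"
  proof (intro subset_antisym subsetI)
    fix \<pi> assume "\<pi> \<in> NC a b"
    then obtain D where D: "D \<in> dyck_paths a b" "\<pi> = laser_partition a b D" by (auto simp: NC_def)
    interpret P: dyck_path a b N D using assms D by unfold_locales
    show "\<pi> \<in> S.part ` S.dyck_words" using P.laser_partition_eq P.word_dyck D by auto
  next
    fix \<pi> assume "\<pi> \<in> S.part ` S.dyck_words"
    then obtain u where u: "u \<in> S.dyck_words" "\<pi> = S.part u" by blast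
    have full: "S.full u" and root: "S.root u 0" using u by (auto simp: S.dyck_words_def)
    have per: "periodic (int N) u" and ps: "int (psum u (int N)) = int a"
      using full by (auto simp: S.full_def)
    \<comment> \<open>The final 0 is the empty vertical line \<open>x = N\<close>.\<close>
    define vs where "vs = map (\<lambda>i. u (int i)) [0..<N] @ [0]"
    have len: "length vs = b" using assms by (simp add: vs_def)
    have tk: "sum_list (take i vs) = psum u (int i)" if "i \<le> N" for i
    proof -
      have "take i vs = map (\<lambda>i. u (int i)) [0..<i]" using that by (simp add: vs_def take_map)
      then show ?thesis
        by (simp add: psum_def sum_int_interval interv_sum_list_conv_sum_set_nat atLeast0LessThan)
    qed
    have sm: "sum_list vs = a"
    proof -
      have "sum_list vs = sum_list (take (N) vs)" by (simp add: vs_def)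
      then show ?thesis using tk[of "N"] ps by simp
    qed
    define D where "D = path_of vs"
    have h: "hgt D i = psum u (int i)" if "1 \<le> i" "i \<le> N" for i
      using hgt_path_of[of i vs] that len tk[of i] assms(1) by (simp add: D_def)
    have hb: "hgt D b = a" using hgt_path_of[of b vs] assms len sm by (simp add: D_def)
    have "a * i \<le> b * hgt D i" if i: "i \<in> {1..b}" for i
    proof (cases "i = b")
      case False
      then have i': "1 \<le> i" "i \<le> N" using i assms(1) by auto
      have "S.ht u 0 < S.ht u (int i)" using root i' by (simp add: S.root_def)
      then have "int a * int i < int b * int (psum u (int i))" using S.ht_nonneg_sum[of "int i" u] by simp
      then have "int (a * i) < int (b * hgt D i)" using h[OF i'] by simp
      then show ?thesis by (simp only: of_nat_less_iff less_imp_le)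
    qed (simp add: hb mult.commute)
    then have D: "D \<in> dyck_paths a b"
      using dyck_paths_iff[of b D a] assms count_path_of[of vs] len sm by (simp add: D_def)
    interpret P: dyck_path a b N D using assms D by unfold_locales
    have "P.word = u"
    proof
      fix j
      define r where "r = nat (j mod int N)"
      have r: "r < N" "int r = j mod int N" using assms by (auto simp: r_def nat_less_iff)
      have hg: "P.hgt0 i = psum u (int i)" if "i \<le> N" for i
        using h[of i] that by (cases "i = 0") (auto simp: P.hgt0_def psum_def)
      have "P.word j = psum u (int (Suc r)) - psum u (int r)"
        unfolding P.word_def Let_def r_def[symmetric] using hg[of r] hg[of "Suc r"] r by simp
      also have "\<dots> = u (int r)" using S.psum_Suc[of "int r" u] by (simp add: add.commute)
      also have "\<dots> = u j" using periodic_mod[OF per, of j] r by simp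
      finally show "P.word j = u j" .
    qed
    then have "laser_partition a b D = \<pi>" using P.laser_partition_eq u by simp
    then show "\<pi> \<in> NC a b" using D by (auto simp: NC_def)
  qed
  then show ?thesis using S.part_dyck_words by simp
qed

section \<open>Cyclic sieving\<close>

lemma funpow_closed: "(\<And>x. x \<in> X \<Longrightarrow> r x \<in> X) \<Longrightarrow> x \<in> X \<Longrightarrow> (r ^^ m) x \<in> X"
  by (induction m) auto

lemma cyclic_group_action:
  assumes n: "0 < n" and cl: "\<And>x. x \<in> X \<Longrightarrow> r x \<in> X" and per: "\<And>x. x \<in> X \<Longrightarrow> (r ^^ n) x = x"
  shows "group_action (integer_mod_group n) X (\<lambda>d. restrict (r ^^ nat d) X)"
proof -
  let ?G = "integer_mod_group n" and ?\<phi> = "\<lambda>d. restrict (r ^^ nat d) X"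
  have car: "carrier ?G = {0..<int n}" using n by (simp add: carrier_integer_mod_group)
  have inv: "(r ^^ (n - m)) ((r ^^ m) x) = x" if "m \<le> n" "x \<in> X" for m x
    using per[OF that(2)] that(1) by (metis comp_apply funpow_add le_add_diff_inverse2)
  have inv': "(r ^^ m) ((r ^^ (n - m)) x) = x" if "m \<le> n" "x \<in> X" for m x
    using per[OF that(2)] that(1) by (metis comp_apply funpow_add le_add_diff_inverse)
  have bij: "?\<phi> d \<in> Bij X" if "d \<in> carrier ?G" for d
  proof -
    have d: "nat d \<le> n" using that by (auto simp: car)
    have "bij_betw (r ^^ nat d) X X"
      by (rule bij_betwI[of _ _ _ "r ^^ (n - nat d)"])
         (use funpow_closed[OF cl] inv[OF d] inv'[OF d] in auto)
    then show ?thesis by (simp add: Bij_def bij_betw_restrict_eq)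
  qed
  have "?\<phi> \<in> hom ?G (BijGroup X)"
  proof (rule homI)
    show "?\<phi> d \<in> carrier (BijGroup X)" if "d \<in> carrier ?G" for d
      using bij[OF that] by (simp add: BijGroup_def)
    fix c d assume cd: "c \<in> carrier ?G" "d \<in> carrier ?G"
    have "?\<phi> ((c + d) mod int n) = compose X (?\<phi> c) (?\<phi> d)"
    proof
      fix x
      show "?\<phi> ((c + d) mod int n) x = compose X (?\<phi> c) (?\<phi> d) x"
      proof (cases "x \<in> X")
        case True
        have "nat ((c + d) mod int n) = (nat c + nat d) mod n"
          using cd by (simp add: car nat_mod_distrib nat_add_distrib)
        then have "(r ^^ nat ((c + d) mod int n)) x = (r ^^ (nat c + nat d)) x"
          using funpow_mod_eq[OF per[OF True]] by simp
        then show ?thesis using True funpow_closed[OF cl True] by (simp add: compose_def funpow_add)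
      qed (simp add: compose_def)
    qed
    then show "?\<phi> (c \<otimes>\<^bsub>?G\<^esub> d) = ?\<phi> c \<otimes>\<^bsub>BijGroup X\<^esub> ?\<phi> d"
      using bij[OF cd(1)] bij[OF cd(2)] by (simp add: BijGroup_def)
  qed
  then show ?thesis
    by (simp add: group_action_def group_hom_def group_hom_axioms_def group_BijGroup)
qed

lemma funpow_fixed_multiple: "(r ^^ g) x = x \<Longrightarrow> (r ^^ (g * m)) x = x"
  by (induction m) (simp_all add: funpow_add)

text \<open>Exponents that fix \<open>x\<close> are closed under multiples, and Bezout's identity
  writes a multiple of \<open>d\<close> as a multiple of \<open>n\<close> plus the gcd.\<close>

lemma funpow_fixed_gcd:
  assumes "(r ^^ n) x = x" shows "(r ^^ d) x = x \<longleftrightarrow> (r ^^ gcd d n) x = x"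
proof
  assume "(r ^^ gcd d n) x = x"
  moreover obtain m where "d = gcd d n * m" by (meson dvdE gcd_dvd1)
  ultimately show "(r ^^ d) x = x" by (metis funpow_fixed_multiple)
next
  assume d: "(r ^^ d) x = x"
  show "(r ^^ gcd d n) x = x"
  proof (cases "d = 0")
    case True
    then show ?thesis using assms by simp
  next
    case False
    then obtain s t where st: "d * s = n * t + gcd d n" using bezout_nat by blast
    have "x = (r ^^ (d * s)) x" using funpow_fixed_multiple[OF d] by simp
    also have "\<dots> = (r ^^ gcd d n) ((r ^^ (n * t)) x)"
      unfolding st by (metis add.commute comp_apply funpow_add)
    also have "\<dots> = (r ^^ gcd d n) x" using funpow_fixed_multiple[OF assms] by simp
    finally show ?thesis by simp
  qed
qed

section \<open>Powers of primitive roots of unity\<close>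

lemma primitive_root_dvd:
  assumes "primitive_unity_root n z" "0 < n" "z ^ m = 1" shows "n dvd m"
proof -
  have "z ^ m = (z ^ n) ^ (m div n) * z ^ (m mod n)" by (metis div_mult_mod_eq mult.commute power_add power_mult)
  then have "z ^ (m mod n) = 1" using assms by (simp add: primitive_unity_root_def)
  moreover have "m mod n < n" using assms by simp
  ultimately have "m mod n = 0" using assms(1) unfolding primitive_unity_root_def by (meson neq0_conv)
  then show ?thesis by (simp add: dvd_eq_mod_eq_0)
qed

lemma primitive_root_power:
  assumes "primitive_unity_root n z" "0 < n"
  shows "primitive_unity_root (n div gcd d n) (z ^ d)"
  unfolding primitive_unity_root_def
proof (intro conjI allI impI notI)
  let ?g = "gcd d n"
  have g: "0 < ?g" using assms(2) by simp
  have "d * (n div ?g) = n * (d div ?g)"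
    by (metis div_mult_swap dvd_div_mult gcd_dvd1 gcd_dvd2 mult.commute)
  then have "(z ^ d) ^ (n div ?g) = (z ^ n) ^ (d div ?g)" by (metis power_mult)
  then show "(z ^ d) ^ (n div ?g) = 1" using assms by (simp add: primitive_unity_root_def)
  fix m assume m: "0 < m \<and> m < n div ?g" and "(z ^ d) ^ m = 1"
  then have "n dvd d * m" using primitive_root_dvd[OF assms] by (simp add: power_mult)
  then have "(n div ?g) * ?g dvd (d div ?g) * ?g * m" by simp
  then have "n div ?g dvd (d div ?g) * m" using g by (metis dvd_mult_cancel_right mult.assoc mult.commute nat_dvd_not_less dvd_times_right_cancel_iff less_numeral_extra(3))
  moreover have "coprime (n div ?g) (d div ?g)" using div_gcd_coprime[of d n] assms(2) by (simp add: coprime_commute)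
  ultimately have "n div ?g dvd m" by (simp add: coprime_dvd_mult_right_iff)
  then show False using m nat_dvd_not_less by blast
qed

section \<open>Values of the q-Narayana polynomial\<close>

lemma ev_narayana_1:
  assumes "qpoly b * p = gauss b k * gauss a' k'"
  shows "of_nat b * ev 1 p = of_nat ((b choose k) * (a' choose k'))"
proof -
  have "ev 1 (qpoly b * p) = ev 1 (gauss b k * gauss a' k')" using assms by simp
  then show ?thesis by (simp add: ev_qpoly ev_gauss_1)
qed

lemma div_mod_mult_add: "r < e \<Longrightarrow> (e * m + r) div e = m" "r < e \<Longrightarrow> (e * m + r) mod e = r" for e m r :: nat
  by (auto intro!: div_nat_eqI mod_nat_eqI)

text \<open>As \<open>b\<close> is 1 modulo \<open>e\<close>, q-Lucas leaves the factor
  \<open>gauss 1 (k mod e)\<close>, which vanishes unless \<open>k\<close> is 0 or 1 modulo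
  \<open>e\<close>. The two residues give the two summands, without and with a central
  block.\<close>

lemma ev_narayana_root:
  assumes p: "qpoly b * p = gauss b k * gauss (a - 1) (k - 1)"
    and e: "2 \<le> e" "primitive_unity_root e z" and b: "b = Suc (e * g)" and a: "0 < a" "1 \<le> k"
  shows "ev z p = of_nat (
     (if e dvd a \<and> e dvd k then (g choose (k div e)) * (a div e - 1 choose (k div e - 1)) else 0) +
     (if e dvd k - 1 then (g choose ((k - 1) div e)) * ((a - 1) div e choose ((k - 1) div e)) else 0))"
proof -
  have "ev z (qpoly b) = 1"
    using z_neq_1[OF e] z_power[OF e] unfolding b ev_qpoly_root[OF e] by (simp add: power_mult)
  then have E: "ev z p = ev z (gauss b k) * ev z (gauss (a - 1) (k - 1))"
    using arg_cong[OF p, of "ev z"] by simp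
  have bd: "b div e = g" "b mod e = 1"
    using e(1) unfolding b by (auto intro!: div_nat_eqI mod_nat_eqI)
  have B: "ev z (gauss b k) = of_nat (g choose (k div e)) * ev z (gauss 1 (k mod e))"
    using ev_gauss_lucas[OF e, of b k] by (simp add: bd)
  have A: "ev z (gauss (a - 1) (k - 1)) = of_nat ((a - 1) div e choose ((k - 1) div e)) * ev z (gauss ((a - 1) mod e) ((k - 1) mod e))"
    by (rule ev_gauss_lucas[OF e])
  consider "e dvd k" | "e dvd k - 1" | "2 \<le> k mod e"
  proof -
    have "k mod e = 0 \<or> k mod e = 1 \<or> 2 \<le> k mod e" by linarith
    moreover have "e dvd k - 1" if "k mod e = 1"
      using that a(2) by (metis dvd_minus_mod)
    ultimately show ?thesis using that by (auto simp: dvd_eq_mod_eq_0)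
  qed
  then show ?thesis
  proof cases
    case 1
    then obtain m where m: "k = e * m" by (auto elim: dvdE)
    then obtain m' where m': "m = Suc m'" using a(2) by (cases m) auto
    have k1: "k - 1 = e * m' + (e - 1)" using e(1) by (simp add: m m')
    have kd: "(k - 1) div e = m'" "(k - 1) mod e = e - 1"
      unfolding k1 by (rule div_mod_mult_add; use e(1) in simp)+
    have nd: "\<not> e dvd k - 1" using kd(2) e(1) by (simp add: dvd_eq_mod_eq_0)
    have Bv: "ev z (gauss b k) = of_nat (g choose m)" using B e(1) by (simp add: m)
    show ?thesis
    proof (cases "e dvd a")
      case True
      then obtain s where s: "a = e * s" by (auto elim: dvdE)
      then obtain s' where s': "s = Suc s'" using a(1) by (cases s) auto
      have a1: "a - 1 = e * s' + (e - 1)" using e(1) by (simp add: s s')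
      have ad: "(a - 1) div e = s'" "(a - 1) mod e = e - 1"
        unfolding a1 by (rule div_mod_mult_add; use e(1) in simp)+
      have "ev z (gauss (a - 1) (k - 1)) = of_nat (s' choose m')" unfolding A ad kd by (simp add: gauss_self)
      then show ?thesis using E Bv True 1 nd e(1) by (simp add: s s' m m')
    next
      case False
      \<comment> \<open>Here \<open>k - 1\<close> has the largest possible remainder
        \<open>e - 1\<close>; any smaller remainder of \<open>a - 1\<close> makes the Gaussian
        factor vanish.\<close>
      have "(a - 1) mod e \<noteq> e - 1"
      proof
        assume A: "(a - 1) mod e = e - 1"
        have "a = (a - 1) div e * e + (a - 1) mod e + 1" using a(1) by simp
        also have "\<dots> = (a - 1) div e * e + e" using A e(1) by simp
        finally show False using False by (metis dvd_add_triv_right_iff dvd_triv_right)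
      qed
      moreover have "(a - 1) mod e < e" using e(1) by simp
      ultimately have "(a - 1) mod e < e - 1" by linarith
      then have "ev z (gauss (a - 1) (k - 1)) = 0" unfolding A kd by (simp add: gauss_eq_0)
      then show ?thesis using E False nd by simp
    qed
  next
    case 2
    then obtain m where m: "k - 1 = e * m" by (auto elim: dvdE)
    then have k: "k = e * m + 1" using a(2) by simp
    have kd: "k div e = m" "k mod e = 1"
      unfolding k by (rule div_mod_mult_add; use e(1) in simp)+
    have nd: "\<not> (e dvd a \<and> e dvd k)" using kd(2) by (simp add: dvd_eq_mod_eq_0)
    have k1: "(k - 1) div e = m" using m e(1) by simp
    have "ev z (gauss b k) = of_nat (g choose m)" unfolding B kd by (simp add: gauss_self)
    moreover have "ev z (gauss (a - 1) (k - 1)) = of_nat ((a - 1) div e choose m)"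
    proof -
      have km: "(k - 1) mod e = 0" using m by simp
      show ?thesis unfolding A k1 km by simp
    qed
    ultimately show ?thesis unfolding E if_P[OF 2] if_not_P[OF nd] k1 by simp
  next
    case 3
    have "ev z (gauss b k) = 0" unfolding B using 3 by (simp add: gauss_eq_0)
    moreover have "\<not> e dvd k" using 3 by (auto simp: dvd_eq_mod_eq_0)
    moreover have "\<not> e dvd k - 1"
    proof
      assume "e dvd k - 1"
      then obtain m where "k - 1 = e * m" by (auto elim: dvdE)
      then have "k = e * m + 1" using a(2) by simp
      then have "k mod e = 1" using div_mod_mult_add(2)[of 1 e m] e(1) by simp
      then show False using 3 by simp
    qed
    ultimately show ?thesis using E by simp
  qed
qed

section \<open>Fixed partitions counted by binomial coefficients\<close>

context slope begin

lemma card_fixed_points_eq: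
  assumes "0 < g" "2 \<le> e" "N = int e * int g" "1 \<le> k" and a': "a = int a'"
  shows "card {\<pi> \<in> part ` Collect full. card \<pi> = k \<and> (rot_partition (nat N) ^^ g) \<pi> = \<pi>} =
     (if e dvd a' \<and> e dvd k then (g choose (k div e)) * (a' div e - 1 choose (k div e - 1)) else 0) +
     (if e dvd k - 1 then (g choose ((k - 1) div e)) * ((a' - 1) div e choose ((k - 1) div e)) else 0)"
proof -
  let ?A = "{u. periodic (int g) u \<and> int e * int (psum u (int g)) = a \<and> e * support u (int g) = k}"
  let ?B = "{u. periodic (int g) u \<and> int e * int (psum u (int g)) < a \<and> e * support u (int g) + 1 = k}"
  have pos: "0 < a'" using a_pos a' by simp
  have "card ?A = (if e dvd a' \<and> e dvd k then (g choose (k div e)) * (a' div e - 1 choose (k div e - 1)) else 0)"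
  proof (cases "e dvd a' \<and> e dvd k")
    case True
    then obtain s m where s: "a' = e * s" and m: "k = e * m" by (auto elim!: dvdE)
    have sm: "0 < s" "0 < m" using pos assms(4) s m by (auto intro: Nat.gr0I)
    have "int e * int x = a \<longleftrightarrow> x = s" for x
    proof -
      have "int e * int x = a \<longleftrightarrow> int (e * x) = int (e * s)" by (simp add: a' s)
      also have "\<dots> \<longleftrightarrow> x = s" unfolding of_nat_eq_iff using assms(2) by simp
      finally show ?thesis .
    qed
    moreover have "e * x = k \<longleftrightarrow> x = m" for x using assms(2) by (simp add: m)
    ultimately have "?A = {u. periodic (int g) u \<and> support u (int g) = m \<and> psum u (int g) = s}" by blast
    then show ?thesis using card_words_sum_eq[OF assms(1) sm] True assms(2) by (simp add: s m)
  next
    case False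
    have "u \<notin> ?A" for u
    proof
      assume "u \<in> ?A"
      then have "int (e * psum u (int g)) = int a'" "e * support u (int g) = k" by (auto simp: a')
      then have "e * psum u (int g) = a'" "e * support u (int g) = k" unfolding of_nat_eq_iff by auto
      then show False using False by (metis dvd_triv_left)
    qed
    then have A: "?A = {}" by blast
    show ?thesis unfolding A if_not_P[OF False] by simp
  qed
  moreover have "card ?B = (if e dvd k - 1 then (g choose ((k - 1) div e)) * ((a' - 1) div e choose ((k - 1) div e)) else 0)"
  proof (cases "e dvd k - 1")
    case True
    then obtain m where m: "k - 1 = e * m" by (auto elim!: dvdE)
    \<comment> \<open>The strict bound on the total sum becomes the floor that also appears as the
      top of the binomial coefficient in q-Lucas.\<close>
    have "int e * int x < a \<longleftrightarrow> x \<le> (a' - 1) div e" for x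
    proof -
      have "int e * int x < a \<longleftrightarrow> int (e * x) < int a'" by (simp add: a')
      also have "\<dots> \<longleftrightarrow> x * e \<le> a' - 1" unfolding of_nat_less_iff using pos by (auto simp: mult.commute)
      also have "\<dots> \<longleftrightarrow> x \<le> (a' - 1) div e" using assms(2) by (simp add: less_eq_div_iff_mult_less_eq)
      finally show ?thesis .
    qed
    moreover have "e * x + 1 = k \<longleftrightarrow> x = m" for x
    proof -
      have "e * x + 1 = k \<longleftrightarrow> e * x = e * m" using m assms(4) by linarith
      then show ?thesis using assms(2) by simp
    qed
    ultimately have B: "?B = {u. periodic (int g) u \<and> support u (int g) = m \<and> psum u (int g) \<le> (a' - 1) div e}" by blast
    have "(k - 1) div e = m" using m assms(2) by simp
    then show ?thesis unfolding B if_P[OF True] using card_words_sum_le[OF assms(1)] by simp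
  next
    case False
    have "u \<notin> ?B" for u
    proof
      assume "u \<in> ?B"
      then have "k - 1 = e * support u (int g)" by auto
      then show False using False by (metis dvd_triv_left)
    qed
    then have B: "?B = {}" by blast
    show ?thesis unfolding B if_not_P[OF False] by simp
  qed
  ultimately show ?thesis using card_fixed_points[OF assms(1-3), of k] by presburger
qed

lemma rot_part_closed:
  assumes "\<pi> \<in> {\<pi> \<in> part ` Collect full. card \<pi> = k}"
  shows "rot_partition (nat N) \<pi> \<in> {\<pi> \<in> part ` Collect full. card \<pi> = k}"
proof -
  obtain u where u: "full u" "\<pi> = part u" using assms by blast
  have per: "periodic N u" using u by (simp add: full_def)
  have r: "rot_partition (nat N) \<pi> = part (\<lambda>j. u (j + - 1))" unfolding u(2) by (rule rot_part[OF per])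
  have "card (part (\<lambda>j. u (j + - 1))) = card (part u)"
    unfolding card_part_full[OF u(1)] card_part_full[OF full_shift[OF u(1)]]
    by (rule support_shift[OF per]) (use N_pos in simp)
  then show ?thesis using assms u full_shift[OF u(1), of "- 1"] r by auto
qed

lemma rot_part_period:
  assumes "\<pi> \<in> part ` Collect full" shows "(rot_partition (nat N) ^^ nat N) \<pi> = \<pi>"
proof -
  obtain u where u: "full u" "\<pi> = part u" using assms by blast
  have per: "periodic N u" using u by (simp add: full_def)
  have "(\<lambda>j. u (j + - int (nat N))) = u" using periodic_mult[OF per, of _ "- 1"] N_pos by auto
  then show ?thesis unfolding u(2) rot_part_power[OF per] by simp
qed

lemma finite_part: "finite (part ` Collect full)"
proof -
  have "finite {u. periodic (int (nat N)) u \<and> psum u (int (nat N)) \<le> nat a}"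
    by (rule finite_words) (use N_pos in simp)
  then have "finite (Collect full)"
    by (rule rev_finite_subset) (use N_pos in \<open>auto simp: full_def\<close>)
  then show ?thesis by simp
qed

end

theorem theorem5p2:
  fixes a b k :: nat
  assumes "0 < a" and "a < b" and "coprime a b"
    and "1 \<le> k" and "k \<le> a"
  shows "\<exists>p :: int poly. to_fract p = q_narayana a b k \<and>
    cyclic_sieving (integer_mod_group (b - 1)) (1 mod int (b - 1))
      (rotation_action (b - 1) (NC_blocks a b k)) (NC_blocks a b k) p"
proof -
  obtain N where bN: "b = Suc N" using assms by (cases b) auto
  have N: "0 < N" "b - 1 = N" using bN assms by auto
  interpret S: slope "int a" "int b" "int N"
    by unfold_locales (use assms in simp_all, use bN in simp)
  let ?X = "NC_blocks a b k" and ?G = "integer_mod_group N" and ?r = "rot_partition N"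
  have X: "?X = {\<pi> \<in> S.part ` Collect S.full. card \<pi> = k}"
    unfolding NC_blocks_def NC_eq[OF bN assms(1-3)] ..
  have fin: "finite ?X" unfolding X using S.finite_part by simp
  have closed: "?r \<pi> \<in> ?X" if "\<pi> \<in> ?X" for \<pi> using S.rot_part_closed[of \<pi> k] that unfolding X nat_int .
  have period: "(?r ^^ N) \<pi> = \<pi>" if "\<pi> \<in> ?X" for \<pi> using S.rot_part_period[of \<pi>] that unfolding X nat_int by blast
  obtain p where p: "to_fract p = q_narayana a b k" and pb: "qpoly b * p = gauss b k * gauss (a - 1) (k - 1)"
    using narayana_poly_ex[OF assms] .
  have "rotation_action N ?X = (\<lambda>d. restrict (?r ^^ nat d) ?X)" by (intro ext) (simp add: rotation_action_def)
  then have action: "group_action ?G ?X (rotation_action N ?X)"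
    using cyclic_group_action[OF N(1) closed period] by simp
  have car: "carrier ?G = {0..<int N}" using N by (simp add: carrier_integer_mod_group)
  \<comment> \<open>For \<open>a = 1\<close> and \<open>b = 2\<close> the group is trivial, and
    reducing modulo \<open>N = 1\<close> makes the generator 0.\<close>
  have gen_in: "1 mod int N \<in> carrier ?G" using N by (simp add: car)
  have gen: "generate ?G {1 mod int N} = carrier ?G"
  proof -
    have "generate ?G {1 mod int N} = {(1 mod int N) [^]\<^bsub>?G\<^esub> (m :: int) |m. m \<in> UNIV}"
      by (rule group.generate_pow[OF group_integer_mod_group gen_in])
    also have "\<dots> = carrier ?G"
    proof (intro subset_antisym subsetI)
      fix x assume "x \<in> carrier ?G"
      then have "x = (1 mod int N) [^]\<^bsub>?G\<^esub> x"
        by (simp add: int_pow_integer_mod_group car mod_mult_right_eq)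
      then show "x \<in> {(1 mod int N) [^]\<^bsub>?G\<^esub> (m :: int) |m. m \<in> UNIV}" by blast
    qed (use N in \<open>auto simp: int_pow_integer_mod_group car\<close>)
    finally show ?thesis .
  qed
  have fix_eq: "{x \<in> ?X. rotation_action N ?X ((1 mod int N) [^]\<^bsub>?G\<^esub> d) x = x} = {x \<in> ?X. (?r ^^ gcd d N) x = x}" for d :: nat
  proof -
    have "(1 mod int N) [^]\<^bsub>?G\<^esub> d = int (d mod N)" by (simp add: mod_mult_right_eq zmod_int)
    moreover have "(?r ^^ (d mod N)) x = x \<longleftrightarrow> (?r ^^ gcd d N) x = x" if "x \<in> ?X" for x
      using funpow_mod_eq[OF period[OF that], of d] funpow_fixed_gcd[OF period[OF that], of d] by simp
    ultimately show ?thesis by (auto simp: rotation_action_def)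
  qed
  have eval: "poly (map_poly of_int p) (\<zeta> ^ d) = of_nat (card {x \<in> ?X. (?r ^^ gcd d N) x = x})"
    if \<zeta>: "primitive_unity_root N \<zeta>" for \<zeta> and d :: nat
  proof -
    define g e where "g = gcd d N" and "e = N div g"
    have g: "0 < g" "N = e * g" using N by (auto simp: g_def e_def)
    then have e: "0 < e" using N by (cases e) auto
    have root: "primitive_unity_root e (\<zeta> ^ d)"
      unfolding e_def g_def by (rule primitive_root_power[OF \<zeta> N(1)])
    have "ev (\<zeta> ^ d) p = of_nat (card {x \<in> ?X. (?r ^^ g) x = x})"
    proof (cases "e = 1")
      \<comment> \<open>The trivial power is outside the range of q-Lucas. The value at 1 is
        compared with the cycle lemma instead, after multiplication by \<open>b\<close>.\<close>
      case True
      then have "\<zeta> ^ d = 1" "g = N" using root g by (auto simp: primitive_unity_root_def)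
      have "{x \<in> ?X. (?r ^^ g) x = x} = ?X" using period \<open>g = N\<close> by auto
      moreover have "b * card ?X = (b choose k) * (a - 1 choose (k - 1))"
        using S.card_dyck_words[of k] S.card_part_full_eq[of k] assms(4) unfolding X by simp
      then have "of_nat b * ev 1 p = of_nat b * of_nat (card ?X)"
        using ev_narayana_1[OF pb] by (metis of_nat_mult)
      then have "ev 1 p = of_nat (card ?X)" using assms by simp
      ultimately show ?thesis using \<open>\<zeta> ^ d = 1\<close> by simp
    next
      case False
      then have e2: "2 \<le> e" using e by simp
      have "{x \<in> ?X. (?r ^^ g) x = x} =
          {\<pi> \<in> S.part ` Collect S.full. card \<pi> = k \<and> (rot_partition (nat (int N)) ^^ g) \<pi> = \<pi>}"
        unfolding X nat_int by blast
      moreover have "int N = int e * int g" using g by simp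
      ultimately show ?thesis
        using S.card_fixed_points_eq[OF g(1) e2 _ assms(4) refl]
          ev_narayana_root[OF pb e2 root _ assms(1,4), of g] bN g(2) by simp
    qed
    then show ?thesis by (simp add: ev_def g_def)
  qed
  have "cyclic_sieving ?G (1 mod int N) (rotation_action N ?X) ?X p"
    unfolding cyclic_sieving_def fix_eq
  proof (intro conjI allI impI)
    show "0 \<le> coeff p i" for i by (rule quotient_coeff_nonneg[OF pb]) (use bN in simp)
    have "Coset.order ?G = N" by (simp add: Coset.order_def car)
    then show "poly (map_poly of_int p) (\<zeta> ^ d) = of_nat (card {x \<in> ?X. (?r ^^ gcd d N) x = x})"
      if "primitive_unity_root (Coset.order ?G) \<zeta>" for \<zeta> d using eval that by simp
  qed (use fin action gen gen_in car in auto)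
  then show ?thesis using p unfolding N(2) by blast
qed

end
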